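(* Let $K$ be a field with $\operatorname{char}(K)\neq 2,3$ and $\zeta_3\notin K$, where $\zeta_3$ is a primitive cubic root of unity. Let $f(x)=x^6+ax^3+b\in K[x]$ be irreducible over $K$, let $F$ be its splitting field over $K$, put $\Delta=a^2-4b$, $R(x)=x^3-3bx+ab$, and suppose that $\Delta=-3n^2$ for some $n\in K$. Let $\alpha,\beta\in F$ be roots of $f$ with $\alpha^3\neq\beta^3$, and write $\sqrt[3]{b}=\alpha\beta$. Then the following are complete lists, without repetition, of the intermediate fields strictly between $K$ and $F$, arranged by degree over $K$; the fields marked (normal) are normal over $K$ and the others are not. (A) If no cubic root of $b$ lies in $K$ and $R(x)$ is reducible over $K$, there are $4$ fields: - degree 2: $K(\zeta_3)$ (normal); - degree 3: $K(\sqrt[3]b)$, $K(\sqrt[3]b\,\zeta_3)$, $K(\sqrt[3]b\,\zeta_3^2)$. (B) If some cubic root of $b$ lies in $K$ and $R(x)$ is irreducible over $K$, and $\beta$ is chosen so that $\alpha\beta\in K$, there are $2$ fields: - degree 2: $K(\zeta_3)$ (normal); - degree 3: $K(\alpha+\beta)$ (normal). (C) If no cubic root of $b$ lies in $K$ and $R(x)$ is irreducible over $K$, there are $12$ fields: - degree 2: $K(\zeta_3)$ (normal); - degree 3: $K(\sqrt[3]b(\alpha+\beta))$ (normal); $K(\sqrt[3]b)$, $K(\sqrt[3]b\,\zeta_3)$, $K(\sqrt[3]b\,\zeta_3^2)$; - degree 6: $K(\zeta_3,\sqrt[3]b)$ and $K(\zeta_3,\sqrt[3]b(\alpha+\beta))$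 (both normal); $K(\alpha)$, $K(\beta)$; - degree 9: $K(\alpha+\beta)$, $K((\alpha+\beta)\zeta_3)$, $K((\alpha+\beta)\zeta_3^2)$.
   Context: The roots of $f$ are $\alpha,\alpha\zeta_3,\alpha\zeta_3^2,\beta,\beta\zeta_3,\beta\zeta_3^2$, where $\alpha^3$ and $\beta^3$ are the two roots $\frac{-a\pm\sqrt\Delta}{2}$ of $y^2+ay+b$; so $(\alpha\beta)^3=b$, and replacing $\beta$ by $\beta\zeta_3^i$ changes the chosen cubic root $\sqrt[3]b=\alpha\beta$ of $b$. *)

theory Defs
  imports "HOL-Algebra.Algebra"
begin

text \<open>
  All fields are subfields of one ambient field \<open>L\<close> in the sense of \<^locale>\<open>subfield\<close>.
  Polynomials over \<open>K\<close> are the coefficient lists of \<^theory>\<open>HOL-Algebra.Polynomials\<close>, leading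
  coefficient first.
\<close>

text \<open>The order of an element is \<open>0\<close> if it is infinite, so this is \<open>0\<close> in characteristic zero.\<close>

definition ring_char :: "('a, 'm) ring_scheme \<Rightarrow> nat"
  where "ring_char R = group.ord (add_monoid R) \<one>\<^bsub>R\<^esub>"

definition primitive_root_of_unity :: "('a, 'm) ring_scheme \<Rightarrow> nat \<Rightarrow> 'a \<Rightarrow> bool"
  where "primitive_root_of_unity L k z \<longleftrightarrow>
    z \<in> carrier L \<and> z [^]\<^bsub>L\<^esub> k = \<one>\<^bsub>L\<^esub> \<and> (\<forall>j. 0 < j \<and> j < k \<longrightarrow> z [^]\<^bsub>L\<^esub> j \<noteq> \<one>\<^bsub>L\<^esub>)"

abbreviation adjoin :: "('a, 'm) ring_scheme \<Rightarrow> 'a set \<Rightarrow> 'a set \<Rightarrow> 'a set"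
  where "adjoin L K S \<equiv> generate_field L (K \<union> S)"

text \<open>
  Splitting over a subfield \<open>E\<close> is \<^const>\<open>ring.splitted\<close> for the ring with carrier \<open>E\<close>.
  The library's \<^const>\<open>ring.splitted_on\<close> is unsuitable, because it intersects with
  \<open>mset_set E\<close>, which is empty for infinite \<open>E\<close>.
\<close>

definition splitting_field :: "('a, 'm) ring_scheme \<Rightarrow> 'a set \<Rightarrow> 'a list \<Rightarrow> 'a set \<Rightarrow> bool"
  where "splitting_field L K p F \<longleftrightarrow>
    subfield F L \<and> K \<subseteq> F \<and> ring.splitted (L\<lparr>carrier := F\<rparr>) p \<and>
    F = adjoin L K {x \<in> F. ring.is_root L p x}"

definition normal_extension :: "('a, 'm) ring_scheme \<Rightarrow> 'a set \<Rightarrow> 'a set \<Rightarrow> bool"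
  where "normal_extension L K E \<longleftrightarrow>
    subfield E L \<and> K \<subseteq> E \<and> (\<forall>x \<in> E. (ring.algebraic L over K) x) \<and>
    (\<forall>p \<in> carrier (K[X]\<^bsub>L\<^esub>).
       pirreducible\<^bsub>L\<^esub> K p \<and> (\<exists>x \<in> E. ring.is_root L p x) \<longrightarrow>
       ring.splitted (L\<lparr>carrier := E\<rparr>) p)"

definition strict_intermediate_fields :: "('a, 'm) ring_scheme \<Rightarrow> 'a set \<Rightarrow> 'a set \<Rightarrow> 'a set set"
  where "strict_intermediate_fields L K F = {E. subfield E L \<and> K \<subset> E \<and> E \<subset> F}"

text \<open>
  An entry \<open>(d, E, \<nu>)\<close> records a field \<open>E\<close>, its degree \<open>d\<close> over \<open>K\<close>, and whether it is
  normal over \<open>K\<close>.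
\<close>

definition complete_field_list ::
    "('a, 'm) ring_scheme \<Rightarrow> 'a set \<Rightarrow> 'a set \<Rightarrow> (nat \<times> 'a set \<times> bool) list \<Rightarrow> bool"
  where "complete_field_list L K F xs \<longleftrightarrow>
    distinct (map (\<lambda>(d, E, \<nu>). E) xs) \<and>
    set (map (\<lambda>(d, E, \<nu>). E) xs) = strict_intermediate_fields L K F \<and>
    (\<forall>(d, E, \<nu>) \<in> set xs.
       ring.dimension L d K E \<and> (\<nu> \<longleftrightarrow> normal_extension L K E))"

end

theory Submission
  imports Defs
begin

text \<open>
  Put \<open>M = K(\<zeta>)\<close>, \<open>c = \<alpha>\<beta>\<close> and \<open>A = \<alpha>\<^sup>2\<beta>\<close>. The hypothesis on \<open>\<Delta>\<close> puts \<open>\<alpha>\<^sup>3\<close> and \<open>\<beta>\<^sup>3\<close> into \<open>M\<close>,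
  so \<open>F = M(c, A)\<close> is a Kummer extension of \<open>M\<close>, and an intermediate field of index 3 in \<open>F\<close> that
  contains \<open>M\<close> contains one of \<open>c\<close>, \<open>\<alpha>\<close>, \<open>\<beta>\<close>, \<open>A\<close>. The resolvent \<open>R\<close> has the roots
  \<open>\<zeta>\<^sup>i A + \<zeta>\<^sup>-\<^sup>i B\<close> with \<open>B = \<alpha>\<beta>\<^sup>2\<close>, and \<open>M(A) = M(A + B)\<close>. A field \<open>E\<close> without \<open>\<zeta>\<close> is compared
  with its quadratic extension \<open>E(\<zeta>)\<close>: a cubic over \<open>E\<close> with a root in a quadratic extension has a
  root in \<open>E\<close>, which forces \<open>E\<close> to contain a cube root of \<open>b\<close> or a root of \<open>R\<close>. Degree counting
  does the rest, and no automorphism group of \<open>F\<close> is needed.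
\<close>

subsection \<open>Degrees and minimal polynomials\<close>

context field
begin

text \<open>A field E between K and F contains \<zeta> exactly when it contains \<alpha>^3: the
  discriminant -3n^2 has the square root n(\<zeta> - \<zeta>^2), and n is nonzero because \<alpha>^3
  and \<beta>^3 differ. Hence fields of odd degree contain none of \<zeta>, \<alpha>, \<beta>. If c
  and A are independent over M, the Kummer group generated by c and \<alpha> has four subgroups of
  order 3, represented by c, \<alpha>, \<beta>, A; they yield the four fields of degree 6. An
  automorphism moving \<zeta> interchanges \<alpha> and \<beta> up to cube roots of unity, so it
  preserves the classes of c and of A (as AB = b) and swaps the other two. This is why only two of
  the four fields are normal. The delicate point is a cubic field E for which E(\<zeta>) contains
  \<alpha> or \<beta>. Neither is a root of a cubic over K, so the descent from E(\<zeta>) to E says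
  nothing. A separate argument with the conjugate of \<alpha> over E is needed, and it uses that a
  is nonzero.\<close>

lemma subfield_imp_subalgebra:
  assumes "subfield K R" "subfield E R" "K \<subseteq> E"
  shows "subalgebra K E R"
proof -
  note E = subfieldE(1)[OF assms(2)]
  show ?thesis
    unfolding subalgebra_def subalgebra_axioms_def
    using subring.axioms(1)[OF E] subringE(6)[OF E] assms(3) by blast
qed

text \<open>The point is that both steps are finite: E is a subalgebra of a finite extension, and a
  K-basis of F still spans F over E. The telescopic formula and uniqueness of the dimension then
  give the product.\<close>

lemma dimension_tower:
  assumes "subfield K R" "subfield E R" "subfield F R" "K \<subseteq> E" "E \<subseteq> F" "dimension n K F"
  obtains d e where "dimension d K E" "dimension e E F" "n = d * e"
proof -
  have "finite_dimension K E"
    using subalbegra_incl_imp_finite_dimension[OF assms(1) finite_dimensionI[OF assms(6)] _ assms(5)]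
      subfield_imp_subalgebra[OF assms(1,2,4)] by blast
  moreover obtain Vs where Vs: "set Vs \<subseteq> carrier R" "Span K Vs = F"
    using exists_base[OF assms(1,6)] by blast
  have "Span E Vs = F"
  proof
    have "set Vs \<subseteq> F"
      using Span_base_incl[OF assms(1) Vs(1)] Vs(2) by blast
    thus "Span E Vs \<subseteq> F"
      using subalgebra_Span_incl[OF assms(2) subfield_imp_subalgebra[OF assms(2,3,5)]] by blast
    show "F \<subseteq> Span E Vs"
      using Vs(2) assms(4)
      unfolding Span_eq_combine_set[OF assms(1) Vs(1)] Span_eq_combine_set[OF assms(2) Vs(1)]
      by blast
  qed
  hence "finite_dimension E F"
    using Span_finite_dimension[OF assms(2) Vs(1)] by simp
  ultimately obtain d e where de: "dimension d K E" "dimension e E F"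
    unfolding finite_dimension_def by blast
  have "n = d * e"
    using dimension_is_inj[OF assms(1,6) telescopic_base[OF assms(1,2) de]] .
  with de that show thesis by blast
qed

lemma dimension_eq_imp_eq:
  assumes "subfield K R" "dimension n K E" "dimension n K F" "E \<subseteq> F"
  shows "E = F"
proof -
  obtain Vs where Vs: "independent K Vs" "length Vs = n" "Span K Vs = E" "set Vs \<subseteq> carrier R"
    using exists_base[OF assms(1,2)] by blast
  moreover have "set Vs \<subseteq> F"
    using Span_base_incl[OF assms(1) Vs(4)] Vs(3) assms(4) by blast
  ultimately show ?thesis
    using independent_length_eq_dimension[OF assms(1,3)] by blast
qed

lemma dimension_one_imp_eq:
  assumes "subfield K R" "K \<subseteq> E" "dimension 1 K E"
  shows "E = K"
  using dimension_eq_imp_eq[OF assms(1) dimension_one[OF assms(1)] assms(3,2)] by simp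

lemma dimension_imp_algebraic:
  assumes "subfield K R" "subfield F R" "dimension n K F" "x \<in> F"
  shows "(algebraic over K) x"
  using finite_dimension_imp_algebraic[OF assms(1) subfieldE(1)[OF assms(2)] finite_dimensionI[OF assms(3)] assms(4)] .

lemma simple_extension_least:
  assumes "subfield E R" "K \<subseteq> E" "x \<in> E"
  shows "simple_extension K x \<subseteq> E"
  using simple_extension_subring_incl[OF subfieldE(1)[OF assms(1)] assms(2,3)] .

lemma adjoin_least:
  assumes "subfield E R" "K \<subseteq> E" "S \<subseteq> E"
  shows "adjoin R K S \<subseteq> E"
  using generate_field_min_subfield1[of "K \<union> S" E] subfieldE(3)[OF assms(1)] assms by blast

lemma adjoin_subfield:
  assumes "K \<subseteq> carrier R" "S \<subseteq> carrier R"
  shows "subfield (adjoin R K S) R" "K \<subseteq> adjoin R K S" "S \<subseteq> adjoin R K S"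
  using generate_field_is_subfield[of "K \<union> S"] generate_field.incl[of _ "K \<union> S" R] assms by auto

lemma adjoin_eqI:
  assumes "subfield E R" "K \<subseteq> E" "S \<subseteq> E"
    and "\<And>E'. subfield E' R \<Longrightarrow> K \<subseteq> E' \<Longrightarrow> S \<subseteq> E' \<Longrightarrow> E \<subseteq> E'"
  shows "adjoin R K S = E"
  using adjoin_least[OF assms(1-3)] adjoin_subfield[of K S] assms subfieldE(3)[OF assms(1)] by blast

lemma adjoin_eq_simple_extension:
  assumes "subfield K R" "x \<in> carrier R" "(algebraic over K) x"
  shows "adjoin R K {x} = simple_extension K x"
proof (rule adjoin_eqI)
  show "subfield (simple_extension K x) R"
    using simple_extension_is_subfield[OF assms(1,2)] assms(3) by simp
  show "K \<subseteq> simple_extension K x"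
    using simple_extension_incl[OF subfieldE(3)[OF assms(1)] assms(2)] .
  show "{x} \<subseteq> simple_extension K x"
    using simple_extension_mem[OF subfieldE(1)[OF assms(1)] assms(2)] by simp
qed (use simple_extension_least in blast)

lemma Irr_nonzero:
  assumes "subfield K R" "x \<in> carrier R" "(algebraic over K) x"
  shows "Irr K x \<noteq> []" "degree (Irr K x) \<ge> 1"
  using IrrE(1,2)[OF assms] pirreducibleE(1)[OF subfieldE(1)[OF assms(1)]]
    pirreducible_degree[OF assms(1)] by blast+

lemma dimension_adjoin:
  assumes "subfield K R" "x \<in> carrier R" "(algebraic over K) x"
  shows "dimension (degree (Irr K x)) K (adjoin R K {x})"
  using dimension_simple_extension[OF assms] adjoin_eq_simple_extension[OF assms] by simp

text \<open>The zero polynomial is the empty list and has degree 0 by truncated subtraction, so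
  additivity fails as soon as one factor is zero.\<close>

lemma degree_univ_poly_mult:
  assumes "subring K R" "q \<in> carrier (K[X])" "r \<in> carrier (K[X])"
  shows "degree (q \<otimes>\<^bsub>K[X]\<^esub> r) = (if q = [] \<or> r = [] then 0 else degree q + degree r)"
  using poly_mult_degree_eq[OF assms(1)] assms(2,3)
  unfolding univ_poly_mult univ_poly_carrier[symmetric] by blast

lemma Irr_factor:
  assumes "subfield K R" "x \<in> carrier R" "p \<in> carrier (K[X])" "p \<noteq> []" "eval p x = \<zero>"
  obtains q where "q \<in> carrier (K[X])" "q \<noteq> []" "p = Irr K x \<otimes>\<^bsub>K[X]\<^esub> q"
    "degree p = degree (Irr K x) + degree q"
proof -
  note alg = algebraicI[OF assms(3-5)]
  note sub = subfieldE(1)[OF assms(1)]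
  note I = IrrE[OF assms(1,2) alg]
  have "Irr K x divides\<^bsub>K[X]\<^esub> p"
    using Irr_minimal[OF assms(1,2) alg assms(3,5)] pdivides_iff_shell[OF assms(1) I(1) assms(3)] by simp
  then obtain q where q: "q \<in> carrier (K[X])" "p = Irr K x \<otimes>\<^bsub>K[X]\<^esub> q"
    by (auto simp: factor_def)
  have "q \<noteq> []"
  proof
    assume "q = []"
    hence "p = []"
      using q(2) I(1) poly_mult_zero(2) subringE(1)[OF sub] polynomial_incl
      unfolding univ_poly_mult univ_poly_carrier[symmetric] by blast
    with assms(4) show False by simp
  qed
  moreover have "degree p = degree (Irr K x) + degree q"
    using poly_mult_degree_eq[OF sub, of "Irr K x" q] q I(1) calculation Irr_nonzero[OF assms(1,2) alg]
    unfolding univ_poly_mult univ_poly_carrier by simp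
  ultimately show thesis using that q by blast
qed

lemma degree_Irr_le:
  assumes "subfield K R" "x \<in> carrier R" "p \<in> carrier (K[X])" "p \<noteq> []" "eval p x = \<zero>"
  shows "degree (Irr K x) \<le> degree p"
  using Irr_factor[OF assms] by (metis le_add1)

lemma degree_Irr_one_imp_mem:
  assumes "subfield K R" "x \<in> carrier R" "(algebraic over K) x" "degree (Irr K x) = 1"
  shows "x \<in> K"
  using dimension_one_imp_eq[OF assms(1) _ dimension_adjoin[OF assms(1-3), unfolded assms(4)]]
    adjoin_subfield(2,3)[OF subfieldE(3)[OF assms(1)], of "{x}"] assms(2) by blast

lemma root_of_degree_one:
  assumes "subfield K R" "q \<in> carrier (K[X])" "degree q = 1"
  obtains r where "r \<in> K" "eval q r = \<zero>"
  using degree_one_root[OF assms] subringE(5)[OF subfieldE(1)[OF assms(1)]] by blast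

lemma eval_mult:
  assumes "subring K R" "x \<in> carrier R" "q \<in> carrier (K[X])" "r \<in> carrier (K[X])"
  shows "eval (q \<otimes>\<^bsub>K[X]\<^esub> r) x = eval q x \<otimes> eval r x"
  using ring_hom_memE(2)[OF eval_is_hom[OF assms(1,2)] assms(3,4)] .

lemma eval_closed:
  assumes "subring K R" "x \<in> carrier R" "q \<in> carrier (K[X])"
  shows "eval q x \<in> carrier R"
  using ring_hom_memE(1)[OF eval_is_hom[OF assms(1,2)] assms(3)] .

text \<open>The degrees of \<open>Irr K x\<close> and of its cofactor add up to 3. If the former
  were 1 or 2, one of the two would be linear, and a linear factor puts a root of p into K.\<close>

lemma cubic_no_root_imp_degree:
  assumes "subfield K R" "x \<in> carrier R" "p \<in> carrier (K[X])" "degree p = 3" "eval p x = \<zero>"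
    and "\<And>r. r \<in> K \<Longrightarrow> eval p r \<noteq> \<zero>"
  shows "degree (Irr K x) = 3"
proof -
  have p: "p \<noteq> []" using assms(4) by auto
  note alg = algebraicI[OF assms(3) p assms(5)]
  obtain q where q: "q \<in> carrier (K[X])" "p = Irr K x \<otimes>\<^bsub>K[X]\<^esub> q" "3 = degree (Irr K x) + degree q"
    using Irr_factor[OF assms(1-3) p assms(5)] assms(4) by metis
  have "degree (Irr K x) \<noteq> 1"
    using degree_Irr_one_imp_mem[OF assms(1,2) alg] assms(5,6) by blast
  moreover have "degree q \<noteq> 1"
  proof
    assume "degree q = 1"
    then obtain r where r: "r \<in> K" "eval q r = \<zero>"
      using root_of_degree_one[OF assms(1) q(1)] by blast
    hence rc: "r \<in> carrier R" using subfieldE(3)[OF assms(1)] by blast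
    have "eval p r = eval (Irr K x) r \<otimes> eval q r"
      using eval_mult[OF subfieldE(1)[OF assms(1)] rc IrrE(1)[OF assms(1,2) alg] q(1)] q(2) by simp
    moreover have "eval (Irr K x) r \<in> carrier R"
      using eval_closed[OF subfieldE(1)[OF assms(1)] rc IrrE(1)[OF assms(1,2) alg]] .
    ultimately have "eval p r = \<zero>" using r by simp
    with assms(6) r(1) show False by blast
  qed
  ultimately show ?thesis
    using q(3) Irr_nonzero(2)[OF assms(1,2) alg] by linarith
qed

text \<open>Without a root in E the element x would generate an extension of degree 3 inside one of
  degree 2, and 3 does not divide 2.\<close>

lemma cubic_root_in_quadratic_extension:
  assumes "subfield E R" "subfield F R" "E \<subseteq> F" "dimension 2 E F"
    and "p \<in> carrier (E[X])" "degree p = 3" "x \<in> F" "eval p x = \<zero>"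
  obtains r where "r \<in> E" "eval p r = \<zero>"
proof (rule ccontr)
  assume "\<not> thesis"
  hence nr: "\<And>r. r \<in> E \<Longrightarrow> eval p r \<noteq> \<zero>" using that by blast
  have x: "x \<in> carrier R" using assms(2,7) subfieldE(3) by blast
  note alg = dimension_imp_algebraic[OF assms(1,2,4,7)]
  have 3: "dimension 3 E (adjoin R E {x})"
    using dimension_adjoin[OF assms(1) x alg] cubic_no_root_imp_degree[OF assms(1) x assms(5,6,8) nr] by simp
  have "adjoin R E {x} \<subseteq> F"
    using adjoin_least[OF assms(2,3), of "{x}"] assms(7) by simp
  then obtain d e where "dimension d E (adjoin R E {x})" "2 = d * e"
    using dimension_tower[OF assms(1) _ assms(2) _ _ assms(4)]
      adjoin_subfield[OF subfieldE(3)[OF assms(1)], of "{x}"] x by (metis empty_subsetI insert_subset)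
  with dimension_is_inj[OF assms(1) 3] have "2 = 3 * e" by blast
  thus False by presburger
qed

lemma degree_Irr_pirreducible:
  assumes "subfield K R" "x \<in> carrier R" "p \<in> carrier (K[X])" "pirreducible K p" "eval p x = \<zero>"
  shows "degree (Irr K x) = degree p"
proof -
  note sub = subfieldE(1)[OF assms(1)]
  have p: "p \<noteq> []" using pirreducibleE(1)[OF sub assms(3,4)] .
  note alg = algebraicI[OF assms(3) p assms(5)]
  obtain q where q: "q \<in> carrier (K[X])" "q \<noteq> []" "p = Irr K x \<otimes>\<^bsub>K[X]\<^esub> q" "degree p = degree (Irr K x) + degree q"
    using Irr_factor[OF assms(1-3) p assms(5)] by metis
  have "Irr K x \<notin> Units (K[X])"
    using IrrE(1,2)[OF assms(1,2) alg] pirreducibleE(2)[OF sub] by blast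
  hence "q \<in> Units (K[X])"
    using pirreducibleE(3)[OF sub assms(3,4) IrrE(1)[OF assms(1,2) alg] q(1,3)] by blast
  thus ?thesis using univ_poly_units'[OF assms(1)] q(4) by simp
qed

text \<open>In a factorisation of p one factor vanishes at x, so it already has at least the degree
  of p and leaves only a constant for the other.\<close>

lemma pirreducible_if_degree_Irr:
  assumes "subfield K R" "x \<in> carrier R" "p \<in> carrier (K[X])" "p \<noteq> []" "eval p x = \<zero>"
    and "degree (Irr K x) = degree p"
  shows "pirreducible K p"
proof -
  note alg = algebraicI[OF assms(3-5)]
  note sub = subfieldE(1)[OF assms(1)]
  have pos: "degree p \<ge> 1" using Irr_nonzero(2)[OF assms(1,2) alg] assms(6) by simp
  show ?thesis
  proof (rule pirreducibleI[OF sub assms(3,4)])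
    show "p \<notin> Units (K[X])" unfolding univ_poly_units'[OF assms(1)] using pos by auto
    fix q r assume q: "q \<in> carrier (K[X])" and r: "r \<in> carrier (K[X])" and p: "p = q \<otimes>\<^bsub>K[X]\<^esub> r"
    have *: "degree p = (if q = [] \<or> r = [] then 0 else degree q + degree r)"
      unfolding p by (rule degree_univ_poly_mult[OF sub q r])
    have "eval q x \<otimes> eval r x = \<zero>" "eval q x \<in> carrier R" "eval r x \<in> carrier R"
      using eval_mult[OF sub assms(2) q r, folded p] assms(5) eval_closed[OF sub assms(2) q] eval_closed[OF sub assms(2) r] by simp_all
    hence "eval q x = \<zero> \<or> eval r x = \<zero>" using integral by blast
    hence "degree p \<le> degree q \<or> degree p \<le> degree r"
      using degree_Irr_le[OF assms(1,2) q] degree_Irr_le[OF assms(1,2) r] * pos assms(6)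
      by (auto split: if_splits)
    thus "q \<in> Units (K[X]) \<or> r \<in> Units (K[X])"
      unfolding univ_poly_units'[OF assms(1)] using q r * pos by (auto split: if_splits)
  qed
qed

text \<open>A root r in K is also a root of X - r, so its minimal polynomial has degree at most 1;
  irreducibility makes that degree equal to the degree of p.\<close>

lemma pirreducible_imp_no_root:
  assumes "subfield K R" "p \<in> carrier (K[X])" "pirreducible K p" "degree p \<noteq> 1" "r \<in> K"
  shows "eval p r \<noteq> \<zero>"
proof
  assume 0: "eval p r = \<zero>"
  have r: "r \<in> carrier R" using assms(1,5) subfieldE(3) by blast
  have lin: "[\<one>, \<ominus> r] \<in> carrier (K[X])"
    using subringE(3,5)[OF subfieldE(1)[OF assms(1)]] assms(5)
    unfolding univ_poly_carrier[symmetric] polynomial_def by simp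
  have "eval [\<one>, \<ominus> r] r = \<zero>" using r by (simp add: r_neg)
  hence "degree (Irr K r) \<le> 1"
    using degree_Irr_le[OF assms(1) r lin] by simp
  thus False
    using degree_Irr_pirreducible[OF assms(1) r assms(2,3) 0] assms(4)
      pirreducible_degree[OF assms(1-3)] by linarith
qed

lemma cubic_pirreducible_iff:
  assumes "subfield K R" "p \<in> carrier (K[X])" "degree p = 3"
  shows "pirreducible K p \<longleftrightarrow> (\<forall>r \<in> K. eval p r \<noteq> \<zero>)"
proof
  show "pirreducible K p \<Longrightarrow> \<forall>r \<in> K. eval p r \<noteq> \<zero>"
    using pirreducible_imp_no_root[OF assms(1,2)] assms(3) by auto
next
  assume nr: "\<forall>r \<in> K. eval p r \<noteq> \<zero>"
  note sub = subfieldE(1)[OF assms(1)]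
  show "pirreducible K p"
  proof (rule pirreducibleI[OF sub assms(2)])
    show "p \<noteq> []" "p \<notin> Units (K[X])"
      unfolding univ_poly_units'[OF assms(1)] using assms(3) by auto
    fix q r assume q: "q \<in> carrier (K[X])" and r: "r \<in> carrier (K[X])" and p: "p = q \<otimes>\<^bsub>K[X]\<^esub> r"
    have *: "degree p = (if q = [] \<or> r = [] then 0 else degree q + degree r)"
      unfolding p by (rule degree_univ_poly_mult[OF sub q r])
    have ev: "eval p x = eval q x \<otimes> eval r x" "eval q x \<in> carrier R" "eval r x \<in> carrier R" if "x \<in> K" for x
    proof -
      have x: "x \<in> carrier R" using that assms(1) subfieldE(3) by blast
      show "eval p x = eval q x \<otimes> eval r x" "eval q x \<in> carrier R" "eval r x \<in> carrier R"
        using eval_mult[OF sub x q r, folded p] eval_closed[OF sub x q] eval_closed[OF sub x r] by simp_all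
    qed
    have "degree q \<noteq> 1"
    proof
      assume "degree q = 1"
      then obtain x where "x \<in> K" "eval q x = \<zero>"
        using root_of_degree_one[OF assms(1) q] by blast
      with ev[of x] nr show False by simp
    qed
    moreover have "degree r \<noteq> 1"
    proof
      assume "degree r = 1"
      then obtain x where "x \<in> K" "eval r x = \<zero>"
        using root_of_degree_one[OF assms(1) r] by blast
      with ev[of x] nr show False by simp
    qed
    ultimately have "degree q \<noteq> 1" "degree r \<noteq> 1" by blast+
    hence "q \<noteq> [] \<and> r \<noteq> [] \<and> (degree q = 0 \<or> degree r = 0)"
      using * assms(3) by (auto split: if_splits)
    thus "q \<in> Units (K[X]) \<or> r \<in> Units (K[X])"
      unfolding univ_poly_units'[OF assms(1)] using q r by auto
  qed
qed

lemma dimension_pos: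
  assumes "subfield K R" "dimension n K E" "\<one> \<in> E"
  shows "n > 0"
proof (rule ccontr)
  assume "\<not> n > 0"
  hence "E = {\<zero>}" using dimension_zero[OF assms(1)] assms(2) by simp
  thus False using assms(3) by simp
qed

lemma dimension_tower_dvd:
  assumes "subfield K R" "subfield E R" "subfield F R" "K \<subseteq> E" "E \<subseteq> F" "dimension n K F" "dimension d K E"
  shows "d dvd n" "dimension (n div d) E F"
proof -
  obtain d' e where *: "dimension d' K E" "dimension e E F" "n = d' * e"
    using dimension_tower[OF assms(1-6)] by blast
  have "d' = d" using dimension_is_inj[OF assms(1) *(1) assms(7)] .
  moreover have "d > 0"
    using dimension_pos[OF assms(1,7)] subringE(3)[OF subfieldE(1)[OF assms(2)]] by blast
  ultimately show "d dvd n" "dimension (n div d) E F" using * by auto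
qed

lemma dimension_prime_tower:
  assumes "subfield K R" "subfield E R" "subfield F R" "K \<subseteq> E" "E \<subseteq> F" "dimension p K F" "Factorial_Ring.prime (p::nat)"
  shows "E = K \<or> E = F"
proof -
  obtain d e where *: "dimension d K E" "dimension e E F" "p = d * e"
    using dimension_tower[OF assms(1-6)] by blast
  hence "d dvd p" by simp
  hence "d = 1 \<or> d = p" using assms(7) unfolding prime_nat_iff by blast
  thus ?thesis
  proof
    assume "d = 1"
    thus ?thesis using dimension_one_imp_eq[OF assms(1,4)] *(1) by simp
  next
    assume "d = p"
    thus ?thesis using dimension_eq_imp_eq[OF assms(1) _ assms(6,5)] *(1) by simp
  qed
qed

lemma degree_Irr_eq_dimension:
  assumes "subfield K R" "x \<in> carrier R" "dimension n K (adjoin R K {x})"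
  shows "degree (Irr K x) = n"
proof -
  have "(algebraic over K) x"
    using dimension_imp_algebraic[OF assms(1) _ assms(3)] adjoin_subfield[of K "{x}"]
      subfieldE(3)[OF assms(1)] assms(2) by blast
  thus ?thesis using dimension_is_inj[OF assms(1) dimension_adjoin[OF assms(1,2)] assms(3)] by blast
qed

lemma adjoin_adjoin:
  assumes "K \<subseteq> carrier R" "S \<subseteq> carrier R" "T \<subseteq> carrier R"
  shows "adjoin R (adjoin R K S) T = adjoin R K (S \<union> T)"
proof (rule adjoin_eqI)
  have "S \<union> T \<subseteq> carrier R" using assms(2,3) by simp
  note E = adjoin_subfield[OF assms(1) this]
  show "subfield (adjoin R K (S \<union> T)) R" by (rule E(1))
  have S: "S \<subseteq> adjoin R K (S \<union> T)" using E(3) by (rule order.trans[OF Un_upper1])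
  show "adjoin R K S \<subseteq> adjoin R K (S \<union> T)" by (rule adjoin_least[OF E(1,2) S])
  show "T \<subseteq> adjoin R K (S \<union> T)" using E(3) by (rule order.trans[OF Un_upper2])
  fix E' assume E': "subfield E' R" "adjoin R K S \<subseteq> E'" "T \<subseteq> E'"
  have "K \<subseteq> E'" "S \<subseteq> E'"
    using order.trans[OF adjoin_subfield(2)[OF assms(1,2)] E'(2)]
      order.trans[OF adjoin_subfield(3)[OF assms(1,2)] E'(2)] .
  thus "adjoin R K (S \<union> T) \<subseteq> E'" using adjoin_least[OF E'(1), of K "S \<union> T"] E'(3) by simp
qed

subsection \<open>Normality of simple extensions\<close>

lemma card_roots_le_degree:
  assumes "q \<in> carrier (poly_ring R)" "q \<noteq> []" "S \<subseteq> carrier R" "\<And>x. x \<in> S \<Longrightarrow> eval q x = \<zero>"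
  shows "card S \<le> degree q"
proof -
  have "S \<subseteq> set_mset (roots q)"
    using roots_mem_iff_is_root[OF assms(1)] assms(2-4) unfolding is_root_def by blast
  hence "card S \<le> card (set_mset (roots q))" by (simp add: card_mono)
  also have "\<dots> \<le> size (roots q)" by (metis size_multiset_overloaded_eq card_eq_sum sum_mono count_greater_eq_one_iff)
  also have "\<dots> \<le> degree q" using size_roots_le_degree[OF assms(1)] .
  finally show ?thesis .
qed

lemma carrier_univ_poly_mono:
  assumes "K \<subseteq> E" shows "carrier (K[X]) \<subseteq> carrier (E[X])"
  using assms unfolding univ_poly_carrier[symmetric] univ_poly_def polynomial_def by auto

lemma poly_ring_subfield:
  assumes "subfield E R"
  shows "poly_ring (R\<lparr>carrier := E\<rparr>) = E[X]"
  using univ_poly_consistent[OF subfieldE(1)[OF assms]] by simp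

text \<open>Roots counted with multiplicity never exceed the degree, so it suffices to exhibit as
  many distinct roots as the degree.\<close>

lemma splitted_subfieldI:
  assumes "subfield E R" "p \<in> carrier (E[X])" "p \<noteq> []"
    and "S \<subseteq> E" "degree p \<le> card S" "\<And>x. x \<in> S \<Longrightarrow> eval p x = \<zero>"
  shows "ring.splitted (R\<lparr>carrier := E\<rparr>) p"
proof -
  interpret E: field "R\<lparr>carrier := E\<rparr>" using subfield_iff(2)[OF assms(1)] .
  have p: "p \<in> carrier (poly_ring (R\<lparr>carrier := E\<rparr>))"
    using assms(2) poly_ring_subfield[OF assms(1)] by simp
  have "S \<subseteq> set_mset (E.roots p)"
    using E.roots_mem_iff_is_root[OF p] assms(3-6)
    unfolding E.is_root_def eval_consistent[OF subfieldE(1)[OF assms(1)]] by auto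
  hence "card S \<le> card (set_mset (E.roots p))" by (simp add: card_mono)
  also have "\<dots> \<le> size (E.roots p)" by (metis size_multiset_overloaded_eq card_eq_sum sum_mono count_greater_eq_one_iff)
  finally show ?thesis
    unfolding E.splitted_def using E.size_roots_le_degree[OF p] assms(5) by simp
qed

text \<open>The irreducible factors of a split polynomial are linear, and \<open>Irr E x\<close> is
  one of them.\<close>

lemma splitted_subfield_imp_mem:
  assumes "subfield E R" "p \<in> carrier (E[X])" "p \<noteq> []"
    and "ring.splitted (R\<lparr>carrier := E\<rparr>) p" "x \<in> carrier R" "eval p x = \<zero>"
  shows "x \<in> E"
proof -
  interpret E: field "R\<lparr>carrier := E\<rparr>" using subfield_iff(2)[OF assms(1)] .
  note alg = algebraicI[OF assms(2,3,6)]
  note I = IrrE[OF assms(1,5) alg]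
  have "Irr E x divides\<^bsub>E[X]\<^esub> p"
    using Irr_minimal[OF assms(1,5) alg assms(2,6)] pdivides_iff_shell[OF assms(1) I(1) assms(2)] by simp
  hence "degree (Irr E x) = 1"
    using E.splitted_imp_trivial_factors[of p "Irr E x"] assms(2-4) I(1,2)
    unfolding pdivides_def poly_ring_subfield[OF assms(1)]
      univ_poly_consistent[OF subfieldE(1)[OF assms(1)]] by simp
  thus ?thesis using degree_Irr_one_imp_mem[OF assms(1,5) alg] by simp
qed

text \<open>This serves to refute normality: x attains the full degree of p, so p is irreducible,
  and a normal field containing x must contain every other root of p.\<close>

lemma normal_extension_conjugate_mem:
  assumes "subfield K R" "normal_extension R K E" "x \<in> E" "p \<in> carrier (K[X])" "p \<noteq> []" "eval p x = \<zero>"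
    and "degree (Irr K x) = degree p" "y \<in> carrier R" "eval p y = \<zero>"
  shows "y \<in> E"
proof -
  have E: "subfield E R" "K \<subseteq> E" using assms(2) unfolding normal_extension_def by auto
  have x: "x \<in> carrier R" using assms(3) subfieldE(3)[OF E(1)] by blast
  have "pirreducible K p" using pirreducible_if_degree_Irr[OF assms(1) x assms(4-7)] .
  hence "ring.splitted (R\<lparr>carrier := E\<rparr>) p"
    using assms(2,3,4,5,6) x unfolding normal_extension_def is_root_def by blast
  thus ?thesis
    using splitted_subfield_imp_mem[OF E(1) _ assms(5) _ assms(8,9)] carrier_univ_poly_mono[OF E(2)] assms(4) by blast
qed

section \<open>Monic polynomials determined by their roots\<close>

lemma monic_poly_with_roots:
  assumes "subring E R" "finite S" "S \<subseteq> E"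
  obtains q where "q \<in> carrier (E[X])" "q \<noteq> []" "lead_coeff q = \<one>" "degree q = card S" "\<And>x. x \<in> S \<Longrightarrow> eval q x = \<zero>"
proof -
  have Ec: "E \<subseteq> carrier R" using subringE(1)[OF assms(1)] .
  have "\<exists>q. q \<in> carrier (E[X]) \<and> q \<noteq> [] \<and> lead_coeff q = \<one> \<and> degree q = card S \<and> (\<forall>x \<in> S. eval q x = \<zero>)"
    using assms(2,3)
  proof (induction S rule: finite_induct)
    case empty
    show ?case
      using subringE(3)[OF assms(1)]
      by (intro exI[of _ "[\<one>]"]) (simp add: univ_poly_carrier[symmetric] polynomial_def)
  next
    case (insert y S)
    then obtain q where q: "q \<in> carrier (E[X])" "q \<noteq> []" "lead_coeff q = \<one>" "degree q = card S" "\<forall>x \<in> S. eval q x = \<zero>"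
      by auto
    have y: "y \<in> E" "y \<in> carrier R" using insert.prems Ec by auto
    have lin: "[\<one>, \<ominus> y] \<in> carrier (E[X])"
      using subringE(3,5)[OF assms(1)] y unfolding univ_poly_carrier[symmetric] polynomial_def by simp
    let ?p = "[\<one>, \<ominus> y] \<otimes>\<^bsub>E[X]\<^esub> q"
    have "?p \<in> carrier (E[X])"
      using univ_poly_is_ring[OF assms(1)] lin q(1) by (simp add: ring.ring_simprules)
    moreover have "degree ?p = card (insert y S)"
      using degree_univ_poly_mult[OF assms(1) lin q(1)] q(2,4) insert.hyps by (cases q) auto
    moreover have "lead_coeff ?p = \<one>"
      using poly_mult_lead_coeff[OF assms(1), of "[\<one>, \<ominus> y]" q] lin q(1-3)
      unfolding univ_poly_mult univ_poly_carrier by simp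
    moreover have "eval ?p x = \<zero>" if "x \<in> insert y S" for x
    proof -
      have x: "x \<in> carrier R" using that insert.prems Ec by auto
      have "eval [\<one>, \<ominus> y] y = \<zero>" using y(2) by (simp add: r_neg)
      thus ?thesis
        using eval_mult[OF assms(1) x lin q(1)] that q(5) eval_closed[OF assms(1) x lin]
          eval_closed[OF assms(1) x q(1)] by auto
    qed
    moreover have "?p \<noteq> []"
      using \<open>degree ?p = card (insert y S)\<close> insert.hyps by auto
    ultimately show ?case by blast
  qed
  with that show thesis by blast
qed

text \<open>The subtraction works on raw coefficient lists of equal length, so no leading zeros are
  dropped and positions can still be compared in \<open>monic_eqI\<close>.\<close>

lemma eval_map2_minus:
  assumes "length p = length q" "set p \<subseteq> carrier R" "set q \<subseteq> carrier R" "x \<in> carrier R"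
  shows "eval (map2 (\<lambda>a b. a \<ominus> b) p q) x = eval p x \<ominus> eval q x"
  using assms
proof (induction p q rule: list_induct2)
  case Nil
  then show ?case by (simp add: minus_eq)
next
  case (Cons a p b q)
  then have "a \<in> carrier R" "b \<in> carrier R" "x [^] length q \<in> carrier R" "eval p x \<in> carrier R" "eval q x \<in> carrier R"
    by (auto simp: eval_in_carrier)
  then show ?case using Cons by (simp add: minus_eq l_distr l_minus minus_add a_ac)
qed

lemma normalize_eq_Nil: "normalize p = [] \<Longrightarrow> set p \<subseteq> {\<zero>}"
  by (induction p) (auto split: if_splits)

text \<open>The leading ones cancel, so the difference is given by n coefficients and has degree
  below n. It vanishes on the n points of S, hence all its coefficients are zero.\<close>

lemma monic_eqI:
  assumes "set p \<subseteq> carrier R" "set q \<subseteq> carrier R" "length p = Suc n" "length q = Suc n"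
    and "hd p = \<one>" "hd q = \<one>" "S \<subseteq> carrier R" "n \<le> card S"
    and "\<And>x. x \<in> S \<Longrightarrow> eval p x = \<zero>" "\<And>x. x \<in> S \<Longrightarrow> eval q x = \<zero>"
  shows "p = q"
proof -
  obtain p' q' where p: "p = \<one> # p'" and q: "q = \<one> # q'"
    using assms(3-6) by (metis length_Suc_conv list.sel(1))
  have len: "length p' = length q'" "length p' = n" using assms(3,4) p q by auto
  have c: "set p' \<subseteq> carrier R" "set q' \<subseteq> carrier R" using assms(1,2) p q by auto
  let ?d = "normalize (map2 (\<lambda>a b. a \<ominus> b) p' q')"
  have set_d: "set (map2 (\<lambda>a b. a \<ominus> b) p' q') \<subseteq> carrier R"
    using c by (auto dest: set_zip_leftD set_zip_rightD intro!: minus_closed)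
  hence d: "?d \<in> carrier (poly_ring R)"
    using normalize_gives_polynomial unfolding univ_poly_carrier[symmetric] by blast
  have ev: "eval ?d x = \<zero>" if "x \<in> S" for x
  proof -
    have x: "x \<in> carrier R" using that assms(7) by blast
    have "\<zero> = eval p x \<ominus> eval q x" using assms(9,10)[OF that] by (simp add: minus_eq)
    also have "\<dots> = eval (map2 (\<lambda>a b. a \<ominus> b) p q) x"
      using eval_map2_minus[OF _ assms(1,2) x] assms(3,4) by simp
    also have "\<dots> = eval (map2 (\<lambda>a b. a \<ominus> b) p' q') x"
      using x eval_in_carrier[OF set_d x] unfolding p q by (simp add: minus_eq r_neg)
    finally show ?thesis using eval_normalize[OF set_d x] by simp
  qed
  have "?d = []"
  proof (rule ccontr)
    assume ne: "?d \<noteq> []"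
    have "card S \<le> degree ?d" using card_roots_le_degree[OF d ne assms(7) ev] .
    moreover have "length ?d \<le> n" using normalize_length_le[of "map2 (\<lambda>a b. a \<ominus> b) p' q'"] len by simp
    ultimately show False using ne assms(8) by (cases ?d) auto
  qed
  hence z: "set (map2 (\<lambda>a b. a \<ominus> b) p' q') \<subseteq> {\<zero>}" by (rule normalize_eq_Nil)
  have "p' ! i = q' ! i" if "i < n" for i
  proof -
    have "p' ! i \<ominus> q' ! i \<in> set (map2 (\<lambda>a b. a \<ominus> b) p' q')"
      using that len by (metis (no_types, lifting) length_map length_zip min.idem nth_map nth_mem nth_zip case_prod_conv)
    hence "p' ! i \<ominus> q' ! i = \<zero>" using z by blast
    moreover have "p' ! i \<in> carrier R" "q' ! i \<in> carrier R"
      using that len c by (auto simp: subset_iff)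
    ultimately show ?thesis by simp
  qed
  hence "p' = q'" using len by (simp add: list_eq_iff_nth_eq)
  thus ?thesis unfolding p q by simp
qed


section \<open>Conjugate maps on a simple extension and their fixed elements\<close>

text \<open>Independent of the choice of \<open>g\<close> only if \<open>y\<close> is a root of the minimal polynomial of \<open>x\<close> over \<open>K\<close>.\<close>

definition conj_map :: "'a set \<Rightarrow> 'a \<Rightarrow> 'a \<Rightarrow> 'a \<Rightarrow> 'a"
  where "conj_map K x y z = eval (SOME g. g \<in> carrier (K[X]) \<and> eval g x = z) y"

text \<open>Two polynomials with the same value at x differ by a multiple of \<open>Irr K x\<close>,
  which vanishes at y too. So the representative picked by the choice operator does not
  matter.\<close>

lemma conj_map_eval:
  assumes "subfield K R" "x \<in> carrier R" "(algebraic over K) x" "y \<in> carrier R"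
    and "eval (Irr K x) y = \<zero>" "g \<in> carrier (K[X])"
  shows "conj_map K x y (eval g x) = eval g y"
proof -
  note sub = subfieldE(1)[OF assms(1)]
  interpret UP: ring "K[X]" using univ_poly_is_ring[OF sub] .
  interpret ex: ring_hom_ring "K[X]" R "\<lambda>p. eval p x" using eval_ring_hom[OF sub assms(2)] .
  interpret ey: ring_hom_ring "K[X]" R "\<lambda>p. eval p y" using eval_ring_hom[OF sub assms(4)] .
  define h where "h = (SOME h. h \<in> carrier (K[X]) \<and> eval h x = eval g x)"
  have h: "h \<in> carrier (K[X])" "eval h x = eval g x"
    using someI[of "\<lambda>h. h \<in> carrier (K[X]) \<and> eval h x = eval g x" g] assms(6) unfolding h_def by auto
  have gh: "g \<ominus>\<^bsub>K[X]\<^esub> h \<in> carrier (K[X])" using assms(6) h(1) by simp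
  have "eval (g \<ominus>\<^bsub>K[X]\<^esub> h) x = \<zero>"
    using assms(6) h unfolding UP.minus_eq by (simp add: r_neg)
  hence "Irr K x pdivides (g \<ominus>\<^bsub>K[X]\<^esub> h)"
    using Irr_minimal[OF assms(1-3) gh] by simp
  hence "eval (g \<ominus>\<^bsub>K[X]\<^esub> h) y = \<zero>"
    using pdivides_imp_root_sharing[OF carrier_polynomial_shell[OF sub IrrE(1)[OF assms(1-3)]] _ assms(4,5)] by blast
  moreover have "eval (g \<ominus>\<^bsub>K[X]\<^esub> h) y = eval g y \<ominus> eval h y"
    using assms(6) h unfolding UP.minus_eq by (simp add: minus_eq)
  ultimately have "eval g y = eval h y"
    using ey.hom_closed assms(6) h(1) by simp
  thus ?thesis unfolding conj_map_def h_def by simp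
qed

lemma conj_map_ring_hom:
  assumes "subfield K R" "x \<in> carrier R" "(algebraic over K) x" "y \<in> carrier R"
    and "eval (Irr K x) y = \<zero>"
  shows "ring_hom_ring (R\<lparr>carrier := simple_extension K x\<rparr>) R (conj_map K x y)"
proof -
  note sub = subfieldE(1)[OF assms(1)]
  interpret UP: ring "K[X]" using univ_poly_is_ring[OF sub] .
  interpret ex: ring_hom_ring "K[X]" R "\<lambda>p. eval p x" using eval_ring_hom[OF sub assms(2)] .
  interpret ey: ring_hom_ring "K[X]" R "\<lambda>p. eval p y" using eval_ring_hom[OF sub assms(4)] .
  note img = simple_extension_as_eval_img[OF subringE(1)[OF sub] assms(2)]
  note ev = conj_map_eval[OF assms]
  show ?thesis
  proof (rule ring_hom_ringI)
    show "ring (R\<lparr>carrier := simple_extension K x\<rparr>)"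
      using subring_is_ring[OF simple_extension_is_subring[OF sub assms(2)]] .
    show "ring R" by (rule ring_axioms)
    fix u assume "u \<in> carrier (R\<lparr>carrier := simple_extension K x\<rparr>)"
    then obtain g where g: "g \<in> carrier (K[X])" "u = eval g x" using img by auto
    thus "conj_map K x y u \<in> carrier R" using ev by simp
    fix v assume "v \<in> carrier (R\<lparr>carrier := simple_extension K x\<rparr>)"
    then obtain h where h: "h \<in> carrier (K[X])" "v = eval h x" using img by auto
    show "conj_map K x y (u \<otimes>\<^bsub>R\<lparr>carrier := simple_extension K x\<rparr>\<^esub> v) = conj_map K x y u \<otimes> conj_map K x y v"
      using ev[OF UP.m_closed[OF g(1) h(1)]] g h ev by simp
    show "conj_map K x y (u \<oplus>\<^bsub>R\<lparr>carrier := simple_extension K x\<rparr>\<^esub> v) = conj_map K x y u \<oplus> conj_map K x y v"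
      using ev[OF UP.a_closed[OF g(1) h(1)]] g h ev by simp
  next
    show "conj_map K x y \<one>\<^bsub>R\<lparr>carrier := simple_extension K x\<rparr>\<^esub> = \<one>"
      using ev[OF UP.one_closed] by simp
  qed
qed

lemma conj_map_const:
  assumes "subfield K R" "x \<in> carrier R" "(algebraic over K) x" "y \<in> carrier R"
    and "eval (Irr K x) y = \<zero>" "k \<in> K"
  shows "conj_map K x y k = k"
proof -
  have k: "k \<in> carrier R" using assms(1,6) subfieldE(3) by blast
  \<comment> \<open>For k = 0 the list \<open>[k]\<close> has leading coefficient zero and is not a
    polynomial; normalising turns it into the empty list.\<close>
  have "normalize [k] \<in> carrier (K[X])"
    using normalize_gives_polynomial[of "[k]"] assms(6) unfolding univ_poly_carrier[symmetric] by simp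
  moreover have "eval (normalize [k]) w = k" if "w \<in> carrier R" for w
    using eval_normalize[of "[k]" w] k that by simp
  ultimately show ?thesis
    using conj_map_eval[OF assms(1-5), of "normalize [k]"] assms(2,4) by simp
qed

lemma conj_map_gen:
  assumes "subfield K R" "x \<in> carrier R" "(algebraic over K) x" "y \<in> carrier R"
    and "eval (Irr K x) y = \<zero>"
  shows "conj_map K x y x = y"
  using conj_map_eval[OF assms var_closed(1)[OF subfieldE(1)[OF assms(1)]]] assms(2,4)
  by (simp add: eval_var)

lemma conj_map_eval_poly:
  assumes "subfield K R" "x \<in> carrier R" "(algebraic over K) x" "y \<in> carrier R"
    and "eval (Irr K x) y = \<zero>" "p \<in> carrier (K[X])" "z \<in> simple_extension K x"
  shows "conj_map K x y (eval p z) = eval p (conj_map K x y z)"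
proof -
  let ?E = "simple_extension K x"
  interpret h: ring_hom_ring "R\<lparr>carrier := ?E\<rparr>" R "conj_map K x y"
    using conj_map_ring_hom[OF assms(1-5)] .
  have "set p \<subseteq> K" using assms(6) polynomial_incl unfolding univ_poly_carrier[symmetric] by blast
  moreover have "K \<subseteq> ?E" using simple_extension_incl[OF subfieldE(3)[OF assms(1)] assms(2)] .
  moreover have "map (conj_map K x y) p = p"
    using conj_map_const[OF assms(1-5)] calculation(1) by (simp add: map_idI subset_iff)
  ultimately show ?thesis
    using h.eval_hom'[of z p] assms(7)
    unfolding eval_consistent[OF simple_extension_is_subring[OF subfieldE(1)[OF assms(1)] assms(2)]]
    by simp
qed

text \<open>Write z = g(x) with g of degree below the degree d of x. If all conjugate maps fix z,
  then g - z has the d roots in S, which is too many unless g is constant.\<close>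

lemma conj_map_fixed_imp_mem:
  assumes "subfield K R" "x \<in> carrier R" "(algebraic over K) x" "z \<in> simple_extension K x"
    and "S \<subseteq> carrier R" "card S = degree (Irr K x)" "\<And>y. y \<in> S \<Longrightarrow> eval (Irr K x) y = \<zero>"
    and "\<And>y. y \<in> S \<Longrightarrow> conj_map K x y z = z"
  shows "z \<in> K"
proof -
  note sub = subfieldE(1)[OF assms(1)]
  have "z \<in> Span K (exp_base x (degree (Irr K x)))"
    using Span_exp_base[OF assms(1-3)] assms(4) by simp
  then obtain g where g: "g \<in> carrier (K[X])" "length g \<le> degree (Irr K x)" "z = eval g x"
    unfolding Span_eq_eval_img[OF assms(1,2)] by blast
  have z: "z \<in> carrier R"
    using assms(4) simple_extension_in_carrier[OF subfieldE(3)[OF assms(1)] assms(2)] by blast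
  have ev: "eval g y = z" if "y \<in> S" for y
    using conj_map_eval[OF assms(1-3) _ assms(7)[OF that] g(1)] assms(5,8) that g(3) by auto
  have gK: "set g \<subseteq> K" using g(1) polynomial_incl unfolding univ_poly_carrier[symmetric] by blast
  consider "g = []" | k where "g = [k]" | k l h where "g = k # h @ [l]"
    by (metis append_butlast_last_id list.exhaust)
  thus ?thesis
  proof cases
    case 1
    thus ?thesis using g(3) subringE(2)[OF sub] by simp
  next
    case 2
    thus ?thesis using g(3) gK subringE(1)[OF sub] by auto
  next
    case 3
    have kc: "k \<in> carrier R" "l \<in> carrier R" "set h \<subseteq> carrier R" "k \<noteq> \<zero>"
      using 3 gK subringE(1)[OF sub] g(1) unfolding univ_poly_carrier[symmetric] polynomial_def by auto
    \<comment> \<open>This is g - z. As g has at least two coefficients, only the constant term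
      changes and the leading coefficient k stays nonzero.\<close>
    let ?q = "(k # h) @ [l \<ominus> z]"
    have q: "?q \<in> carrier (poly_ring R)"
      using kc z unfolding univ_poly_carrier[symmetric] polynomial_def by auto
    have "eval ?q y = \<zero>" if "y \<in> S" for y
    proof -
      have y: "y \<in> carrier R" using that assms(5) by blast
      have e: "eval (k # h) y \<in> carrier R" using kc y eval_in_carrier[of "k # h" y] by auto
      have "eval (k # h) y \<otimes> y \<oplus> l = z"
        using ev[OF that] eval_append_aux[of "k # h" l y] kc y unfolding 3 by simp
      moreover have "eval ?q y = eval (k # h) y \<otimes> y \<oplus> (l \<ominus> z)"
        using eval_append_aux[of "k # h" "l \<ominus> z" y] kc y z by simp
      moreover have "\<dots> = eval (k # h) y \<otimes> y \<oplus> l \<ominus> z"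
        using e y kc(2) z by (simp add: minus_eq a_assoc)
      ultimately show ?thesis using z by (simp add: minus_eq r_neg)
    qed
    hence "card S \<le> degree ?q"
      using card_roots_le_degree[OF q _ assms(5)] by blast
    thus ?thesis using assms(6) g(2) 3 by simp
  qed
qed

text \<open>The conjugate maps permute the roots of \<open>p\<close> in \<open>E\<close>, so they fix the coefficients of the monic
  polynomial with exactly these roots; this polynomial is therefore defined over \<open>K\<close>, and \<open>p\<close> divides it.\<close>

theorem normal_simple_extensionI:
  assumes "subfield K R" "x \<in> carrier R" "(algebraic over K) x"
    and "S \<subseteq> simple_extension K x" "card S = degree (Irr K x)" "\<And>y. y \<in> S \<Longrightarrow> eval (Irr K x) y = \<zero>"
  shows "normal_extension R K (simple_extension K x)"
proof -
  let ?E = "simple_extension K x"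
  note sub = subfieldE(1)[OF assms(1)]
  have E: "subfield ?E R" using simple_extension_is_subfield[OF assms(1,2)] assms(3) by simp
  have KE: "K \<subseteq> ?E" using simple_extension_incl[OF subfieldE(3)[OF assms(1)] assms(2)] .
  have Ec: "?E \<subseteq> carrier R" using subfieldE(3)[OF E] .
  note Esub = subfieldE(1)[OF E]
  have dim: "dimension (degree (Irr K x)) K ?E" using dimension_simple_extension[OF assms(1-3)] .
  interpret E: field "R\<lparr>carrier := ?E\<rparr>" using subfield_iff(2)[OF E] .
  have "ring.splitted (R\<lparr>carrier := ?E\<rparr>) p"
    if p: "p \<in> carrier (K[X])" "pirreducible K p" and z: "z \<in> ?E" "is_root p z" for p z
  proof -
    define Z where "Z = {w \<in> ?E. eval p w = \<zero>}"
    have p0: "p \<noteq> []" using pirreducibleE(1)[OF sub p] .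
    have ZE: "Z \<subseteq> ?E" unfolding Z_def by blast
    have finZ: "finite Z"
      by (rule finite_subset[OF _ finite_number_of_roots[OF carrier_polynomial_shell[OF sub p(1)]]])
        (use Ec p0 in \<open>auto simp: Z_def is_root_def\<close>)
    obtain q where q: "q \<in> carrier (?E[X])" "q \<noteq> []" "lead_coeff q = \<one>" "degree q = card Z" "\<And>w. w \<in> Z \<Longrightarrow> eval q w = \<zero>"
      using monic_poly_with_roots[OF Esub finZ ZE] by blast
    have qE: "set q \<subseteq> ?E" using q(1) polynomial_incl unfolding univ_poly_carrier[symmetric] by blast
    have fixq: "map (conj_map K x y) q = q" if y: "y \<in> S" for y
    proof -
      have yc: "y \<in> carrier R" and yE: "y \<in> ?E" using y assms(4) Ec by auto
      note Irry = assms(6)[OF y]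
      let ?h = "conj_map K x y"
      interpret h: ring_hom_ring "R\<lparr>carrier := ?E\<rparr>" R ?h
        using conj_map_ring_hom[OF assms(1-3) yc Irry] .
      have hE: "?h w \<in> ?E" if w: "w \<in> ?E" for w
      proof -
        obtain g where g: "g \<in> carrier (K[X])" "w = eval g x"
          using w simple_extension_as_eval_img[OF subringE(1)[OF sub] assms(2)] by auto
        have "set g \<subseteq> ?E" using g(1) KE polynomial_incl unfolding univ_poly_carrier[symmetric] by blast
        hence "eval g y \<in> ?E"
          using E.eval_in_carrier[of g y] yE unfolding eval_consistent[OF Esub] by simp
        thus ?thesis using conj_map_eval[OF assms(1-3) yc Irry g(1)] g(2) by simp
      qed
      have hK: "?h k = k" if "k \<in> K" for k
        using conj_map_const[OF assms(1-3) yc Irry that] .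
      have hev: "?h (eval r w) = eval (map ?h r) (?h w)" if "set r \<subseteq> ?E" "w \<in> ?E" for r w
        using h.eval_hom'[of w r] that unfolding eval_consistent[OF Esub] by simp
      \<comment> \<open>A homomorphism from a field that is not identically zero is injective; on
        the finite set Z an injective self-map is a permutation.\<close>
      have "\<one> \<in> ?h ` ?E"
        using hK[OF subringE(3)[OF sub]] subringE(3)[OF Esub] by force
      hence "?h ` ?E \<noteq> {\<zero>}" using one_not_zero by blast
      hence inj: "inj_on ?h ?E"
        using h.non_trivial_field_hom_imp_inj[OF E.field_axioms] by simp
      have "?h ` Z \<subseteq> Z"
      proof
        fix u assume "u \<in> ?h ` Z"
        then obtain w where w: "w \<in> ?E" "eval p w = \<zero>" "u = ?h w" unfolding Z_def by blast
        hence "eval p u = \<zero>"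
          using conj_map_eval_poly[OF assms(1-3) yc Irry p(1) w(1)] w(2,3) h.hom_zero by simp
        thus "u \<in> Z" using hE w unfolding Z_def by blast
      qed
      hence hZ: "?h ` Z = Z"
        using endo_inj_surj[OF finZ] inj_on_subset[OF inj ZE] by blast
      \<comment> \<open>Both q and its image are monic of degree \<open>card Z\<close>, and the
        image vanishes on \<open>?h\<close> of Z, which is Z again.\<close>
      show ?thesis
      proof (rule monic_eqI[where S = Z and n = "card Z"])
        show "set (map ?h q) \<subseteq> carrier R" "set q \<subseteq> carrier R" using qE hE Ec by auto
        show "length (map ?h q) = Suc (card Z)" "length q = Suc (card Z)" using q(2,4) by (cases q; simp)+
        show "hd (map ?h q) = \<one>" "hd q = \<one>" using q(2,3) h.hom_one by (simp_all add: hd_map)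
        show "Z \<subseteq> carrier R" "card Z \<le> card Z" using ZE Ec by auto
        fix u assume u: "u \<in> Z"
        then obtain w where w: "w \<in> Z" "u = ?h w" using hZ by blast
        show "eval (map ?h q) u = \<zero>"
          using hev[OF qE, of w] w q(5) ZE h.hom_zero by auto
        show "eval q u = \<zero>" using q(5)[OF u] .
      qed
    qed
    have "set q \<subseteq> K"
    proof
      fix c assume c: "c \<in> set q"
      have "conj_map K x y c = c" if "y \<in> S" for y
        using fixq[OF that] c by (metis list.map_ident map_eq_conv)
      thus "c \<in> K"
        using conj_map_fixed_imp_mem[OF assms(1-3) _ _ assms(5,6)] c qE assms(4) Ec by blast
    qed
    hence qK: "q \<in> carrier (K[X])"
      using q(2,3) unfolding univ_poly_carrier[symmetric] polynomial_def by simp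
    have zZ: "z \<in> Z" "z \<in> carrier R" "eval p z = \<zero>"
      using z unfolding Z_def is_root_def by auto
    \<comment> \<open>Since q lies over K and vanishes at z, its degree \<open>card Z\<close> bounds
      the degree of z over K, which is the degree of the irreducible p. So E contains enough roots
      for p to split.\<close>
    have "degree p \<le> card Z"
      using degree_Irr_le[OF assms(1) zZ(2) qK q(2) q(5)[OF zZ(1)]]
        degree_Irr_pirreducible[OF assms(1) zZ(2) p zZ(3)] q(4) by simp
    thus ?thesis
      using splitted_subfieldI[OF E _ p0 ZE] p(1) carrier_univ_poly_mono[OF KE] unfolding Z_def by blast
  qed
  moreover have "(algebraic over K) z" if "z \<in> ?E" for z
    using dimension_imp_algebraic[OF assms(1) E dim that] .
  ultimately show ?thesis
    unfolding normal_extension_def using E KE by blast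
qed


text \<open>Equal degrees force the cofactor of \<open>Irr K x\<close> in p to be a nonzero
  constant.\<close>

lemma Irr_shares_roots:
  assumes "subfield K R" "x \<in> carrier R" "p \<in> carrier (K[X])" "p \<noteq> []" "eval p x = \<zero>"
    and "degree (Irr K x) = degree p" "y \<in> carrier R" "eval p y = \<zero>"
  shows "eval (Irr K x) y = \<zero>"
proof -
  note sub = subfieldE(1)[OF assms(1)]
  note alg = algebraicI[OF assms(3-5)]
  obtain q where q: "q \<in> carrier (K[X])" "q \<noteq> []" "p = Irr K x \<otimes>\<^bsub>K[X]\<^esub> q" "degree p = degree (Irr K x) + degree q"
    using Irr_factor[OF assms(1-5)] by metis
  then obtain k where k: "q = [k]" using assms(6) by (cases q) auto
  hence kc: "k \<in> carrier R" "k \<noteq> \<zero>"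
    using q(1) subringE(1)[OF sub] unfolding univ_poly_carrier[symmetric] polynomial_def by auto
  have e: "eval (Irr K x) y \<in> carrier R"
    using eval_closed[OF sub assms(7) IrrE(1)[OF assms(1,2) alg]] .
  have "eval (Irr K x) y \<otimes> k = \<zero>"
    using assms(8) eval_mult[OF sub assms(7) IrrE(1)[OF assms(1,2) alg] q(1), folded q(3)] k kc(1) by simp
  thus ?thesis using e kc integral by blast
qed

text \<open>Every normality claim below is proved through this criterion: p is the minimal
  polynomial of x up to a constant, and S lists all its roots inside K(x).\<close>

corollary normal_adjoinI:
  assumes "subfield K R" "x \<in> carrier R" "p \<in> carrier (K[X])" "p \<noteq> []" "eval p x = \<zero>"
    and "degree (Irr K x) = degree p" "S \<subseteq> adjoin R K {x}" "card S = degree p"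
    and "\<And>y. y \<in> S \<Longrightarrow> eval p y = \<zero>"
  shows "normal_extension R K (adjoin R K {x})"
proof -
  note sub = subfieldE(1)[OF assms(1)]
  note alg = algebraicI[OF assms(3-5)]
  note E = adjoin_eq_simple_extension[OF assms(1,2) alg]
  have Sc: "S \<subseteq> carrier R"
    using assms(7) adjoin_subfield(1)[of K "{x}"] subfieldE(3) assms(1,2) by blast
  have "eval (Irr K x) y = \<zero>" if "y \<in> S" for y
    using Irr_shares_roots[OF assms(1-6)] assms(9)[OF that] Sc that by blast
  with normal_simple_extensionI[OF assms(1,2) alg] assms(6-8) E show ?thesis by simp
qed

subsection \<open>Cube roots of unity and Kummer theory\<close>

lemma subfield_closed:
  assumes "subfield E R"
  shows "\<And>x. x \<in> E \<Longrightarrow> x \<in> carrier R" "\<zero> \<in> E" "\<one> \<in> E"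
    and "\<And>x y. x \<in> E \<Longrightarrow> y \<in> E \<Longrightarrow> x \<otimes> y \<in> E"
    and "\<And>x y. x \<in> E \<Longrightarrow> y \<in> E \<Longrightarrow> x \<oplus> y \<in> E"
    and "\<And>x. x \<in> E \<Longrightarrow> \<ominus> x \<in> E"
    and "\<And>x y. x \<in> E \<Longrightarrow> y \<in> E \<Longrightarrow> x \<ominus> y \<in> E"
  using subringE[OF subfieldE(1)[OF assms]] by (auto simp: minus_eq)

lemma subfield_cancel:
  assumes "subfield E R" "x \<in> E" "x \<noteq> \<zero>" "y \<in> carrier R" "x \<otimes> y \<in> E"
  shows "y \<in> E"
  using subfield_m_inv_simprule[OF assms(1)] assms(2-5) by blast

lemma cube_eq: "x \<in> carrier R \<Longrightarrow> x [^] (3::nat) = x \<otimes> x \<otimes> x"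
  by (simp add: numeral_3_eq_3)

lemma square_eq: "x \<in> carrier R \<Longrightarrow> x [^] (2::nat) = x \<otimes> x"
  by (simp add: numeral_2_eq_2)

lemma eval_cubic:
  assumes "x \<in> carrier R" "p \<in> carrier R" "q \<in> carrier R"
  shows "eval [\<one>, \<zero>, p, q] x = x \<otimes> x \<otimes> x \<oplus> p \<otimes> x \<oplus> q"
  using assms by (simp add: numeral_3_eq_3 a_assoc)

lemma eval_sextic:
  assumes "x \<in> carrier R" "p \<in> carrier R" "q \<in> carrier R"
  shows "eval [\<one>, \<zero>, \<zero>, p, \<zero>, \<zero>, q] x
    = (x \<otimes> x \<otimes> x) \<otimes> (x \<otimes> x \<otimes> x) \<oplus> p \<otimes> (x \<otimes> x \<otimes> x) \<oplus> q"
proof -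
  have "x [^] (6::nat) = x [^] (3::nat) \<otimes> x [^] (3::nat)"
    using assms by (simp add: nat_pow_mult)
  hence "x [^] (6::nat) = (x \<otimes> x \<otimes> x) \<otimes> (x \<otimes> x \<otimes> x)"
    using assms(1) cube_eq by simp
  thus ?thesis using assms by (simp add: cube_eq a_assoc m_assoc)
qed

lemma cubic_closed:
  assumes "subfield E R" "p \<in> E" "q \<in> E"
  shows "[\<one>, \<zero>, p, q] \<in> carrier (E[X])"
  using assms subfield_closed(2,3)[OF assms(1)]
  unfolding univ_poly_carrier[symmetric] polynomial_def by simp

lemma sextic_closed:
  assumes "subfield E R" "p \<in> E" "q \<in> E"
  shows "[\<one>, \<zero>, \<zero>, p, \<zero>, \<zero>, q] \<in> carrier (E[X])"
  using assms subfield_closed(2,3)[OF assms(1)]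
  unfolding univ_poly_carrier[symmetric] polynomial_def by simp

lemma sum_diff_imp_mem:
  assumes "subfield E R" "x \<in> carrier R" "y \<in> carrier R" "x \<oplus> y \<in> E" "x \<ominus> y \<in> E" "\<one> \<oplus> \<one> \<noteq> \<zero>"
  shows "x \<in> E"
proof -
  have "(x \<oplus> y) \<oplus> (x \<ominus> y) = (\<one> \<oplus> \<one>) \<otimes> x" using assms(2,3) by algebra
  thus ?thesis
    using subfield_cancel[OF assms(1) _ assms(6,2)] subfield_closed(3,5)[OF assms(1)] assms(4,5) by metis
qed

end

text \<open>The quadratic equation makes \<zeta> a cube root of unity. It is different from 1
  because 1 satisfies the equation only when 3 = 0. The abbreviation \<open>w\<close> is the other
  primitive cube root, the inverse of \<zeta>.\<close>

locale cube_root_of_unity = field +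
  fixes \<zeta>
  assumes z_closed [simp]: "\<zeta> \<in> carrier R"
    and z_eq: "\<zeta> \<otimes> \<zeta> \<oplus> \<zeta> \<oplus> \<one> = \<zero>"
    and three: "\<one> \<oplus> \<one> \<oplus> \<one> \<noteq> \<zero>"
begin

abbreviation "w \<equiv> \<zeta> \<otimes> \<zeta>"

lemma zw: "\<zeta> \<otimes> w = \<one>" "w \<otimes> \<zeta> = \<one>"
proof -
  have "(\<zeta> \<ominus> \<one>) \<otimes> (\<zeta> \<otimes> \<zeta> \<oplus> \<zeta> \<oplus> \<one>) = \<zeta> \<otimes> w \<ominus> \<one>"
    using z_closed one_closed by algebra
  hence "\<zeta> \<otimes> w \<ominus> \<one> = \<zero>" using z_eq z_closed by simp
  thus "\<zeta> \<otimes> w = \<one>" by simp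
  thus "w \<otimes> \<zeta> = \<one>" by (simp add: m_comm)
qed

lemma ww: "w \<otimes> w = \<zeta>"
proof -
  have "w \<otimes> w = \<zeta> \<otimes> (\<zeta> \<otimes> w)" by (simp add: m_assoc)
  thus ?thesis using zw by simp
qed

lemma z_plus_w: "\<zeta> \<oplus> w = \<ominus> \<one>"
proof -
  have "\<zeta> \<oplus> w = (\<zeta> \<otimes> \<zeta> \<oplus> \<zeta> \<oplus> \<one>) \<ominus> \<one>"
    using z_closed one_closed by algebra
  thus ?thesis using z_eq by (simp add: minus_eq)
qed

lemma z_neq: "\<zeta> \<noteq> \<one>" "\<zeta> \<noteq> \<zero>" "w \<noteq> \<zero>" "w \<noteq> \<one>" "w \<noteq> \<zeta>"
proof -
  show "\<zeta> \<noteq> \<one>" using z_eq three by auto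
  show "\<zeta> \<noteq> \<zero>" using zw by auto
  show "w \<noteq> \<zero>" using zw by auto
  show "w \<noteq> \<one>" using zw \<open>\<zeta> \<noteq> \<one>\<close> by auto
  show "w \<noteq> \<zeta>"
  proof
    assume "w = \<zeta>"
    hence "\<zeta> = \<one>" using ww zw by metis
    with \<open>\<zeta> \<noteq> \<one>\<close> show False by simp
  qed
qed

text \<open>This reads off the factorisation u^3 - v^3 = (u - v)(u - \<zeta> v)(u - \<zeta>^2
  v).\<close>

lemma cubes_eq_imp:
  assumes "u \<in> carrier R" "v \<in> carrier R" "u \<otimes> u \<otimes> u = v \<otimes> v \<otimes> v"
  shows "u = v \<or> u = \<zeta> \<otimes> v \<or> u = w \<otimes> v"
proof -
  have w: "w \<in> carrier R" by simp
  have "(u \<ominus> \<zeta> \<otimes> v) \<otimes> (u \<ominus> w \<otimes> v) = u \<otimes> u \<ominus> (\<zeta> \<oplus> w) \<otimes> (u \<otimes> v) \<oplus> (\<zeta> \<otimes> w) \<otimes> (v \<otimes> v)"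
    using assms(1,2) z_closed w by algebra
  also have "\<dots> = u \<otimes> u \<oplus> u \<otimes> v \<oplus> v \<otimes> v"
    unfolding z_plus_w zw using assms(1,2) by (simp add: minus_eq l_minus)
  finally have "(u \<ominus> v) \<otimes> ((u \<ominus> \<zeta> \<otimes> v) \<otimes> (u \<ominus> w \<otimes> v)) = (u \<ominus> v) \<otimes> (u \<otimes> u \<oplus> u \<otimes> v \<oplus> v \<otimes> v)"
    by simp
  also have "\<dots> = u \<otimes> u \<otimes> u \<ominus> v \<otimes> v \<otimes> v" using assms(1,2) by algebra
  also have "\<dots> = \<zero>" using assms by simp
  finally have "u \<ominus> v = \<zero> \<or> u \<ominus> \<zeta> \<otimes> v = \<zero> \<or> u \<ominus> w \<otimes> v = \<zero>"
    using integral assms(1,2) w z_closed by (metis minus_closed m_closed)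
  thus ?thesis using assms(1,2) by simp
qed

lemma cube_unity_mult:
  assumes "v \<in> carrier R"
  shows "(\<zeta> \<otimes> v) \<otimes> (\<zeta> \<otimes> v) \<otimes> (\<zeta> \<otimes> v) = v \<otimes> v \<otimes> v"
    and "(w \<otimes> v) \<otimes> (w \<otimes> v) \<otimes> (w \<otimes> v) = v \<otimes> v \<otimes> v"
proof -
  have w: "w \<in> carrier R" by simp
  have "(\<zeta> \<otimes> v) \<otimes> (\<zeta> \<otimes> v) \<otimes> (\<zeta> \<otimes> v) = (\<zeta> \<otimes> w) \<otimes> (v \<otimes> v \<otimes> v)"
    using assms z_closed by algebra
  thus *: "(\<zeta> \<otimes> v) \<otimes> (\<zeta> \<otimes> v) \<otimes> (\<zeta> \<otimes> v) = v \<otimes> v \<otimes> v" using zw assms by simp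
  have "(w \<otimes> v) \<otimes> (w \<otimes> v) \<otimes> (w \<otimes> v) = ((\<zeta> \<otimes> w) \<otimes> (\<zeta> \<otimes> w)) \<otimes> (v \<otimes> v \<otimes> v)"
    using assms z_closed by algebra
  thus "(w \<otimes> v) \<otimes> (w \<otimes> v) \<otimes> (w \<otimes> v) = v \<otimes> v \<otimes> v" using zw assms by simp
qed

text \<open>So \<zeta> - \<zeta>^2 is a square root of -3, and -3n^2 becomes a square once \<zeta>
  is adjoined.\<close>

lemma z_minus_w_square: "(\<zeta> \<ominus> w) \<otimes> (\<zeta> \<ominus> w) = \<ominus> (\<one> \<oplus> \<one> \<oplus> \<one>)"
proof -
  have "(\<zeta> \<ominus> w) \<otimes> (\<zeta> \<ominus> w) = w \<oplus> w \<otimes> w \<ominus> (\<zeta> \<otimes> w \<oplus> \<zeta> \<otimes> w)"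
    using z_closed by algebra
  also have "\<dots> = (\<zeta> \<oplus> w) \<ominus> (\<one> \<oplus> \<one>)" unfolding ww zw by (simp add: a_comm)
  also have "\<dots> = \<ominus> (\<one> \<oplus> \<one> \<oplus> \<one>)" unfolding z_plus_w using one_closed by algebra
  finally show ?thesis .
qed

text \<open>This is Cardano's solution of the cubic, with A and B the two cube roots in his formula.
  The last two factors multiply to x^2 + (A + B)x + A^2 - AB + B^2.\<close>

lemma cubic_factorization:
  assumes "x \<in> carrier R" "A \<in> carrier R" "B \<in> carrier R"
  shows "(x \<ominus> (A \<oplus> B)) \<otimes> ((x \<ominus> (\<zeta> \<otimes> A \<oplus> w \<otimes> B)) \<otimes> (x \<ominus> (w \<otimes> A \<oplus> \<zeta> \<otimes> B)))
    = x \<otimes> x \<otimes> x \<oplus> \<ominus> (A \<otimes> B \<oplus> A \<otimes> B \<oplus> A \<otimes> B) \<otimes> x \<oplus> \<ominus> (A \<otimes> A \<otimes> A \<oplus> B \<otimes> B \<otimes> B)"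
proof -
  define v where "v = w"
  have v: "v \<in> carrier R" "\<zeta> \<otimes> v = \<one>" "\<zeta> \<oplus> v = \<ominus> \<one>" "\<zeta> \<otimes> \<zeta> \<oplus> v \<otimes> v = \<ominus> \<one>"
    unfolding v_def using zw ww z_plus_w by (simp_all add: a_comm)
  define p q where "p = \<zeta> \<otimes> A \<oplus> v \<otimes> B" and "q = v \<otimes> A \<oplus> \<zeta> \<otimes> B"
  have pq: "p \<in> carrier R" "q \<in> carrier R" unfolding p_def q_def using assms v(1) by simp_all
  have "p \<oplus> q = (\<zeta> \<oplus> v) \<otimes> (A \<oplus> B)"
    unfolding p_def q_def using assms(2,3) z_closed v(1) by algebra
  hence sum: "p \<oplus> q = \<ominus> (A \<oplus> B)" unfolding v(3) using assms by (simp add: l_minus)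
  have "p \<otimes> q = (\<zeta> \<otimes> v) \<otimes> (A \<otimes> A \<oplus> B \<otimes> B) \<oplus> (\<zeta> \<otimes> \<zeta> \<oplus> v \<otimes> v) \<otimes> (A \<otimes> B)"
    unfolding p_def q_def using assms(2,3) z_closed v(1) by algebra
  also have "\<dots> = A \<otimes> A \<ominus> A \<otimes> B \<oplus> B \<otimes> B"
    unfolding v(2,4) using assms(2,3) by (simp add: minus_eq l_minus a_ac)
  finally have prod: "p \<otimes> q = A \<otimes> A \<ominus> A \<otimes> B \<oplus> B \<otimes> B" .
  have "(x \<ominus> p) \<otimes> (x \<ominus> q) = x \<otimes> x \<ominus> (p \<oplus> q) \<otimes> x \<oplus> p \<otimes> q"
    using assms(1) pq by algebra
  also have "\<dots> = x \<otimes> x \<oplus> (A \<oplus> B) \<otimes> x \<oplus> (A \<otimes> A \<ominus> A \<otimes> B \<oplus> B \<otimes> B)"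
    unfolding sum prod using assms by (simp add: minus_eq l_minus)
  finally have *: "(x \<ominus> (\<zeta> \<otimes> A \<oplus> w \<otimes> B)) \<otimes> (x \<ominus> (w \<otimes> A \<oplus> \<zeta> \<otimes> B))
    = x \<otimes> x \<oplus> (A \<oplus> B) \<otimes> x \<oplus> (A \<otimes> A \<ominus> A \<otimes> B \<oplus> B \<otimes> B)"
    unfolding p_def q_def v_def .
  define p q where "p = A \<oplus> B" and "q = A \<otimes> A \<ominus> A \<otimes> B \<oplus> B \<otimes> B"
  have pq: "p \<in> carrier R" "q \<in> carrier R" unfolding p_def q_def using assms by simp_all
  have "(x \<ominus> p) \<otimes> (x \<otimes> x \<oplus> p \<otimes> x \<oplus> q) = x \<otimes> x \<otimes> x \<oplus> (q \<ominus> p \<otimes> p) \<otimes> x \<oplus> \<ominus> (p \<otimes> q)"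
    using assms(1) pq by algebra
  moreover have "q \<ominus> p \<otimes> p = \<ominus> (A \<otimes> B \<oplus> A \<otimes> B \<oplus> A \<otimes> B)"
    unfolding p_def q_def using assms(2,3) by algebra
  moreover have "p \<otimes> q = A \<otimes> A \<otimes> A \<oplus> B \<otimes> B \<otimes> B"
    unfolding p_def q_def using assms(2,3) by algebra
  ultimately show ?thesis unfolding * p_def q_def by simp
qed

text \<open>The conjugation \<open>c \<mapsto> \<zeta> c\<close> of \<open>N(c)\<close> multiplies \<open>x\<close> by a cube root of unity; multiplying \<open>x\<close> by
  a suitable power of \<open>c\<close> makes it invariant.\<close>

lemma kummer_cubic:
  assumes "subfield N R" "\<zeta> \<in> N" "c \<in> carrier R" "c \<otimes> c \<otimes> c \<in> N" "c \<notin> N"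
    and "x \<in> adjoin R N {c}" "x \<otimes> x \<otimes> x \<in> N"
  shows "x \<in> N \<or> x \<otimes> c \<in> N \<or> x \<otimes> c \<otimes> c \<in> N"
proof -
  let ?p = "[\<one>, \<zero>, \<zero>, \<ominus> (c \<otimes> c \<otimes> c)]"
  note sub = subfieldE(1)[OF assms(1)]
  note Nc = subfield_closed[OF assms(1)]
  have p: "?p \<in> carrier (N[X])" using cubic_closed[OF assms(1) Nc(2) Nc(6)[OF assms(4)]] .
  have ev: "eval ?p u = u \<otimes> u \<otimes> u \<ominus> c \<otimes> c \<otimes> c" if "u \<in> carrier R" for u
    using eval_cubic[OF that zero_closed, of "\<ominus> (c \<otimes> c \<otimes> c)"] that assms(3) by (simp add: minus_eq)
  have root: "eval ?p u = \<zero> \<longleftrightarrow> u \<otimes> u \<otimes> u = c \<otimes> c \<otimes> c" if "u \<in> carrier R" for u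
    using ev[OF that] that assms(3) by simp
  have c0: "eval ?p c = \<zero>" using root assms(3) by simp
  note alg = algebraicI[OF p _ c0, simplified]
  have cN: "v \<otimes> c \<notin> N" if "v \<in> N" "v \<noteq> \<zero>" for v
    using subfield_cancel[OF assms(1) that assms(3)] assms(5) by blast
  have wN: "w \<in> N" using assms(2) Nc(4) by blast
  \<comment> \<open>The roots of X^3 - c^3 are c, \<zeta> c and \<zeta>^2 c. With \<zeta> in N, none
    of them lies in N, so c has degree 3 over N.\<close>
  have "eval ?p r \<noteq> \<zero>" if r: "r \<in> N" for r
  proof
    assume "eval ?p r = \<zero>"
    hence "r = c \<or> r = \<zeta> \<otimes> c \<or> r = w \<otimes> c"
      using root cubes_eq_imp[of r c] Nc(1)[OF r] assms(3) by blast
    thus False using r cN assms(2,5) wN z_neq by auto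
  qed
  hence deg: "degree (Irr N c) = 3"
    using cubic_no_root_imp_degree[OF assms(1,3) p _ c0] by simp
  have Irr_root: "eval (Irr N c) u = \<zero>" if u: "u \<in> carrier R" "u \<otimes> u \<otimes> u = c \<otimes> c \<otimes> c" for u
  proof (rule Irr_shares_roots[OF assms(1,3) p _ c0 _ u(1)])
    show "eval ?p u = \<zero>" using root u by blast
  qed (use deg in simp_all)
  let ?E = "simple_extension N c"
  have E: "adjoin R N {c} = ?E" using adjoin_eq_simple_extension[OF assms(1,3) alg] .
  have xE: "x \<in> ?E" using assms(6) E by simp
  have cE: "c \<in> ?E" using simple_extension_mem[OF sub assms(3)] .
  have Es: "subfield ?E R" using simple_extension_is_subfield[OF assms(1,3)] alg by simp
  have xc: "x \<in> carrier R" using xE subfield_closed(1)[OF Es] by blast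
  have NE: "N \<subseteq> ?E" using simple_extension_incl[OF subfieldE(3)[OF assms(1)] assms(3)] .
  have zc: "\<zeta> \<otimes> c \<in> carrier R" "w \<otimes> c \<in> carrier R" using assms(3) by simp_all
  note cub = cube_unity_mult[OF assms(3)]
  note Iz = Irr_root[OF zc(1) cub(1)]
  let ?h = "conj_map N c (\<zeta> \<otimes> c)"
  interpret h: ring_hom_ring "R\<lparr>carrier := ?E\<rparr>" R ?h
    using conj_map_ring_hom[OF assms(1,3) alg zc(1) Iz] .
  have hm: "?h (u \<otimes> v) = ?h u \<otimes> ?h v" if "u \<in> ?E" "v \<in> ?E" for u v
    using h.hom_mult that by simp
  note hN = conj_map_const[OF assms(1,3) alg zc(1) Iz]
  note hc = conj_map_gen[OF assms(1,3) alg zc(1) Iz]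
  \<comment> \<open>One conjugate map suffices. If u = g(c) is fixed, then g(c) = g(\<zeta> c);
    applying the map again gives g(\<zeta> c) = g(\<zeta>^2 c), so all three conjugate maps fix
    u.\<close>
  have fixed: "u \<in> N" if u: "u \<in> ?E" "?h u = u" for u
  proof (rule conj_map_fixed_imp_mem[OF assms(1,3) alg u(1), of "{c, \<zeta> \<otimes> c, w \<otimes> c}"])
    obtain g where g: "g \<in> carrier (N[X])" "u = eval g c"
      using u(1) simple_extension_as_eval_img[OF subfieldE(3)[OF assms(1)] assms(3)] by auto
    have g1: "u = eval g (\<zeta> \<otimes> c)"
      using conj_map_eval[OF assms(1,3) alg zc(1) Iz g(1)] g(2) u(2) by simp
    have "?h (\<zeta> \<otimes> c) = w \<otimes> c"
      using hm[of \<zeta> c] hN[OF assms(2)] hc NE assms(2,3) cE by (auto simp: m_assoc)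
    moreover have "\<zeta> \<otimes> c \<in> ?E" using subfield_closed(4)[OF Es] NE assms(2) cE by blast
    ultimately have g2: "u = eval g (w \<otimes> c)"
      using conj_map_eval_poly[OF assms(1,3) alg zc(1) Iz g(1), of "\<zeta> \<otimes> c"] g1 u(2) by simp
    show "{c, \<zeta> \<otimes> c, w \<otimes> c} \<subseteq> carrier R" using assms(3) zc by blast
    have cz: "c \<noteq> \<zero>" using assms(5) Nc(2) by blast
    have "c \<noteq> \<zeta> \<otimes> c" "c \<noteq> w \<otimes> c" "\<zeta> \<otimes> c \<noteq> w \<otimes> c"
      using m_rcancel[OF cz assms(3), of \<one> \<zeta>] m_rcancel[OF cz assms(3), of \<one> w]
        m_rcancel[OF cz assms(3), of \<zeta> w] z_neq assms(3) by auto
    thus "card {c, \<zeta> \<otimes> c, w \<otimes> c} = degree (Irr N c)" using deg by simp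
    show "eval (Irr N c) y = \<zero>" if "y \<in> {c, \<zeta> \<otimes> c, w \<otimes> c}" for y
      using that Irr_root assms(3) zc cub by auto
    show "conj_map N c y u = u" if "y \<in> {c, \<zeta> \<otimes> c, w \<otimes> c}" for y
    proof -
      have y: "y \<in> carrier R" "eval (Irr N c) y = \<zero>" using that Irr_root assms(3) zc cub by auto
      have "eval g y = u" using that g(2) g1 g2 by auto
      thus ?thesis using conj_map_eval[OF assms(1,3) alg y g(1)] g(2) by simp
    qed
  qed
  have hx: "?h x \<in> carrier R" using h.hom_closed xE by simp
  \<comment> \<open>Since x^3 lies in N it is fixed, so \<open>?h x\<close> is again a cube root of
    x^3.\<close>
  have "?h x \<otimes> ?h x \<otimes> ?h x = ?h (x \<otimes> x \<otimes> x)"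
    using hm xE subfield_closed(4)[OF Es] by simp
  also have "\<dots> = x \<otimes> x \<otimes> x" using hN[OF assms(7)] .
  finally consider "?h x = x" | "?h x = \<zeta> \<otimes> x" | "?h x = w \<otimes> x"
    using cubes_eq_imp[OF hx xc] by blast
  thus ?thesis
  proof cases
    case 1
    thus ?thesis using fixed xE by blast
  next
    case 2
    have "?h (x \<otimes> c \<otimes> c) = (\<zeta> \<otimes> x) \<otimes> (\<zeta> \<otimes> c) \<otimes> (\<zeta> \<otimes> c)"
      using hm xE cE subfield_closed(4)[OF Es] hc 2 by simp
    also have "\<dots> = (\<zeta> \<otimes> w) \<otimes> (x \<otimes> c \<otimes> c)" using xc assms(3) z_closed by algebra
    finally have "?h (x \<otimes> c \<otimes> c) = x \<otimes> c \<otimes> c" using zw xc assms(3) by simp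
    thus ?thesis using fixed xE cE subfield_closed(4)[OF Es] by blast
  next
    case 3
    have "?h (x \<otimes> c) = (w \<otimes> x) \<otimes> (\<zeta> \<otimes> c)"
      using hm xE cE hc 3 by simp
    also have "\<dots> = (\<zeta> \<otimes> w) \<otimes> (x \<otimes> c)" using xc assms(3) z_closed by algebra
    finally have "?h (x \<otimes> c) = x \<otimes> c" using zw xc assms(3) by simp
    thus ?thesis using fixed xE cE subfield_closed(4)[OF Es] by blast
  qed
qed

lemma zeta_poly:
  assumes "subfield E R"
  shows "[\<one>, \<one>, \<one>] \<in> carrier (E[X])" "eval [\<one>, \<one>, \<one>] \<zeta> = \<zero>" "eval [\<one>, \<one>, \<one>] w = \<zero>"
proof -
  show "[\<one>, \<one>, \<one>] \<in> carrier (E[X])"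
    using subfield_closed(3)[OF assms] unfolding univ_poly_carrier[symmetric] polynomial_def by simp
  show "eval [\<one>, \<one>, \<one>] \<zeta> = \<zero>" using z_eq by (simp add: numeral_2_eq_2 a_assoc)
  have "eval [\<one>, \<one>, \<one>] w = w \<otimes> w \<oplus> (w \<oplus> \<one>)" by (simp add: numeral_2_eq_2)
  also have "\<dots> = \<zeta> \<otimes> \<zeta> \<oplus> \<zeta> \<oplus> \<one>" unfolding ww by (simp add: a_ac)
  finally show "eval [\<one>, \<one>, \<one>] w = \<zero>" using z_eq by simp
qed

lemma degree_Irr_zeta:
  assumes "subfield E R" "\<zeta> \<notin> E"
  shows "degree (Irr E \<zeta>) = 2"
proof -
  note p = zeta_poly[OF assms(1)]
  note alg = algebraicI[OF p(1) _ p(2), simplified]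
  have "degree (Irr E \<zeta>) \<le> 2"
    using degree_Irr_le[OF assms(1) z_closed p(1) _ p(2)] by simp
  moreover have "degree (Irr E \<zeta>) \<noteq> 1"
    using degree_Irr_one_imp_mem[OF assms(1) z_closed alg] assms(2) by blast
  ultimately show ?thesis using Irr_nonzero(2)[OF assms(1) z_closed alg] by linarith
qed

lemma dimension_adjoin_zeta:
  assumes "subfield E R" "\<zeta> \<notin> E"
  shows "dimension 2 E (adjoin R E {\<zeta>})"
  using dimension_adjoin[OF assms(1) z_closed algebraicI[OF zeta_poly(1)[OF assms(1)] _ zeta_poly(2)[OF assms(1)]]]
    degree_Irr_zeta[OF assms] by simp

lemma cube_root_mem:
  assumes "subfield E R" "\<zeta> \<in> E" "u \<in> E" "v \<in> carrier R" "u \<otimes> u \<otimes> u = v \<otimes> v \<otimes> v"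
  shows "v \<in> E"
proof -
  note E = subfield_closed[OF assms(1)]
  have "v = u \<or> v = \<zeta> \<otimes> u \<or> v = w \<otimes> u"
    using cubes_eq_imp[OF assms(4) E(1)[OF assms(3)]] assms(5) by simp
  thus ?thesis using E(4) assms(2,3) by auto
qed

text \<open>The quotient of two distinct cube roots is \<zeta> or \<zeta>^2, and the square of
  \<zeta>^2 is \<zeta>. Read contrapositively, a field without \<zeta> has at most one cube root of
  each element.\<close>

lemma zeta_mem_if_two_cube_roots:
  assumes "subfield E R" "u \<in> E" "v \<in> E" "u \<otimes> u \<otimes> u = v \<otimes> v \<otimes> v" "u \<noteq> v"
  shows "\<zeta> \<in> E"
proof -
  note E = subfield_closed[OF assms(1)]
  have c: "u \<in> carrier R" "v \<in> carrier R" using assms(2,3) E(1) by auto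
  have v0: "v \<noteq> \<zero>"
  proof
    assume "v = \<zero>"
    hence "u \<otimes> u \<otimes> u = \<zero>" using assms(4) by simp
    hence "u = \<zero>" using integral c by (metis m_closed)
    with \<open>v = \<zero>\<close> assms(5) show False by simp
  qed
  have "u = \<zeta> \<otimes> v \<or> u = w \<otimes> v" using cubes_eq_imp[OF c assms(4)] assms(5) by blast
  hence "v \<otimes> \<zeta> \<in> E \<or> v \<otimes> w \<in> E" using assms(2) c by (metis m_comm z_closed m_closed)
  hence "\<zeta> \<in> E \<or> w \<in> E" using subfield_cancel[OF assms(1,3) v0] by auto
  thus ?thesis using E(4)[of w w] ww by auto
qed

end

subsection \<open>The sextic\<close>

locale sextic = cube_root_of_unity +
  fixes K a b n \<alpha> \<beta>
  assumes K: "subfield K R" and z_notin: "\<zeta> \<notin> K" and two: "\<one> \<oplus> \<one> \<noteq> \<zero>"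
    and aK: "a \<in> K" and bK: "b \<in> K" and nK: "n \<in> K"
    and f_irr: "pirreducible K [\<one>, \<zero>, \<zero>, a, \<zero>, \<zero>, b]"
    and disc: "a \<otimes> a \<ominus> (b \<oplus> b \<oplus> b \<oplus> b) = \<ominus> (n \<otimes> n \<oplus> n \<otimes> n \<oplus> n \<otimes> n)"
    and al: "\<alpha> \<in> carrier R" and be: "\<beta> \<in> carrier R"
    and f_al: "eval [\<one>, \<zero>, \<zero>, a, \<zero>, \<zero>, b] \<alpha> = \<zero>"
    and f_be: "eval [\<one>, \<zero>, \<zero>, a, \<zero>, \<zero>, b] \<beta> = \<zero>"
    and cubes_neq: "\<alpha> \<otimes> \<alpha> \<otimes> \<alpha> \<noteq> \<beta> \<otimes> \<beta> \<otimes> \<beta>"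
begin

abbreviation "f \<equiv> [\<one>, \<zero>, \<zero>, a, \<zero>, \<zero>, b]"
abbreviation "Res \<equiv> [\<one>, \<zero>, \<ominus> (b \<oplus> b \<oplus> b), a \<otimes> b]"
abbreviation "cb \<equiv> [\<one>, \<zero>, \<zero>, \<ominus> b]"
abbreviation "y1 \<equiv> \<alpha> \<otimes> \<alpha> \<otimes> \<alpha>"
abbreviation "y2 \<equiv> \<beta> \<otimes> \<beta> \<otimes> \<beta>"
abbreviation "c \<equiv> \<alpha> \<otimes> \<beta>"
abbreviation "M \<equiv> adjoin R K {\<zeta>}"
abbreviation "F \<equiv> adjoin R K {\<alpha>, \<beta>}"

text \<open>The hypotheses are symmetric in \<alpha> and \<beta>; this transfers each statement
  about \<alpha> to \<beta>.\<close>

lemma swap: "sextic R \<zeta> K a b n \<beta> \<alpha>"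
  using sextic_axioms unfolding sextic_def sextic_axioms_def by metis

lemmas K_closed = subfield_closed[OF K]

lemma abn_closed [simp]: "a \<in> carrier R" "b \<in> carrier R" "n \<in> carrier R"
  using aK bK nK K_closed(1) by auto

lemmas [simp] = al be

lemma polys_closed:
  "f \<in> carrier (K[X])" "Res \<in> carrier (K[X])" "cb \<in> carrier (K[X])"
  using sextic_closed[OF K aK bK] cubic_closed[OF K] aK bK K_closed by auto

lemma y_root: "y1 \<otimes> y1 \<oplus> a \<otimes> y1 \<oplus> b = \<zero>" "y2 \<otimes> y2 \<oplus> a \<otimes> y2 \<oplus> b = \<zero>"
  using f_al f_be eval_sextic by auto

text \<open>Both cubes solve y^2 + ay + b = 0. Subtracting the equations and cancelling the nonzero
  difference of the cubes leaves Vieta's formula.\<close>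

lemma y_sum: "y1 \<oplus> y2 = \<ominus> a"
proof -
  have "u \<oplus> v = \<ominus> a" if "u \<in> carrier R" "v \<in> carrier R" "u \<noteq> v"
    "u \<otimes> u \<oplus> a \<otimes> u \<oplus> b = \<zero>" "v \<otimes> v \<oplus> a \<otimes> v \<oplus> b = \<zero>" for u v
  proof -
    have "(u \<ominus> v) \<otimes> (u \<oplus> v \<oplus> a) = (u \<otimes> u \<oplus> a \<otimes> u \<oplus> b) \<ominus> (v \<otimes> v \<oplus> a \<otimes> v \<oplus> b)"
      using that(1,2) abn_closed by algebra
    hence "(u \<ominus> v) \<otimes> (u \<oplus> v \<oplus> a) = \<zero>" unfolding that(4,5) by simp
    hence "u \<oplus> v \<oplus> a = \<zero>" using that(1-3) integral by (metis a_closed abn_closed(1) minus_closed r_right_minus_eq)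
    thus ?thesis using that(1,2) by (metis a_closed abn_closed(1) minus_equality)
  qed
  thus ?thesis using cubes_neq y_root by simp
qed

lemma y2_eq: "y2 = \<ominus> a \<ominus> y1"
proof -
  have "y2 = (y1 \<oplus> y2) \<ominus> y1" using al be by algebra
  thus ?thesis unfolding y_sum .
qed

lemma y_prod: "y1 \<otimes> y2 = b"
proof -
  have "y1 \<otimes> (\<ominus> a \<ominus> y1) = b \<ominus> (y1 \<otimes> y1 \<oplus> a \<otimes> y1 \<oplus> b)"
    using al abn_closed by algebra
  thus ?thesis using y2_eq y_root(1) by (simp add: minus_eq)
qed

text \<open>The square of the difference is the discriminant a^2 - 4b = -3n^2, which is the square
  of n(\<zeta> - \<zeta>^2). The sign depends on which cube is called \<open>y1\<close>.\<close>

lemma y_diff: "y1 \<ominus> y2 = n \<otimes> (\<zeta> \<ominus> w) \<or> y1 \<ominus> y2 = \<ominus> (n \<otimes> (\<zeta> \<ominus> w))"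
proof -
  define u v where "u = y1" and "v = y2"
  have uv: "u \<in> carrier R" "v \<in> carrier R" unfolding u_def v_def by simp_all
  define s where "s = \<zeta> \<ominus> w"
  have s: "s \<in> carrier R" "s \<otimes> s = \<ominus> (\<one> \<oplus> \<one> \<oplus> \<one>)" unfolding s_def using z_minus_w_square by simp_all
  have "(u \<ominus> v) \<otimes> (u \<ominus> v) = (u \<oplus> v) \<otimes> (u \<oplus> v) \<ominus> (u \<otimes> v \<oplus> u \<otimes> v \<oplus> u \<otimes> v \<oplus> u \<otimes> v)"
    using uv by algebra
  also have "\<dots> = a \<otimes> a \<ominus> (b \<oplus> b \<oplus> b \<oplus> b)"
    unfolding u_def v_def y_sum y_prod by (simp add: l_minus r_minus)
  also have "\<dots> = n \<otimes> n \<otimes> (\<ominus> (\<one> \<oplus> \<one> \<oplus> \<one>))"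
    unfolding disc using abn_closed one_closed by algebra
  also have "\<dots> = (n \<otimes> s) \<otimes> (n \<otimes> s)"
    unfolding s(2)[symmetric] using s(1) abn_closed by algebra
  finally have "(u \<ominus> v) \<otimes> (u \<ominus> v) = (n \<otimes> s) \<otimes> (n \<otimes> s)" .
  moreover have "((u \<ominus> v) \<ominus> n \<otimes> s) \<otimes> ((u \<ominus> v) \<oplus> n \<otimes> s) = (u \<ominus> v) \<otimes> (u \<ominus> v) \<ominus> (n \<otimes> s) \<otimes> (n \<otimes> s)"
    using uv s(1) abn_closed by algebra
  ultimately have "((u \<ominus> v) \<ominus> n \<otimes> s) \<otimes> ((u \<ominus> v) \<oplus> n \<otimes> s) = \<zero>" using uv s(1) by simp
  hence "(u \<ominus> v) \<ominus> n \<otimes> s = \<zero> \<or> (u \<ominus> v) \<oplus> n \<otimes> s = \<zero>"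
    using integral uv s(1) by (metis a_closed abn_closed(3) m_closed minus_closed)
  moreover have "u \<ominus> v = \<ominus> (n \<otimes> s)" if "(u \<ominus> v) \<oplus> n \<otimes> s = \<zero>"
    using minus_equality[OF that] uv s(1) by simp
  ultimately show ?thesis using uv s(1) unfolding u_def v_def s_def by auto
qed

lemma n_nonzero: "n \<noteq> \<zero>"
  using y_diff cubes_neq by auto

lemma degree_al: "degree (Irr K \<alpha>) = 6"
  using degree_Irr_pirreducible[OF K al polys_closed(1) f_irr f_al] by simp

text \<open>Otherwise \<alpha> would be a root of the cubic X^3 - \<open>y1\<close> over K, although
  it has degree 6.\<close>

lemma y1_notin: "y1 \<notin> K"
proof
  assume y: "y1 \<in> K"
  have p: "[\<one>, \<zero>, \<zero>, \<ominus> y1] \<in> carrier (K[X])"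
    using cubic_closed[OF K K_closed(2) K_closed(6)[OF y]] .
  have "eval [\<one>, \<zero>, \<zero>, \<ominus> y1] \<alpha> = \<zero>"
    using eval_cubic[of \<alpha> \<zero> "\<ominus> y1"] by (simp add: r_neg)
  thus False using degree_Irr_le[OF K al p] degree_al by simp
qed

lemma nonzero: "\<alpha> \<noteq> \<zero>" "\<beta> \<noteq> \<zero>" "b \<noteq> \<zero>" "c \<noteq> \<zero>"
proof -
  show 1: "\<alpha> \<noteq> \<zero>" using y1_notin K_closed(2) by auto
  show 2: "\<beta> \<noteq> \<zero>" using sextic.y1_notin[OF swap] K_closed(2) by auto
  show "c \<noteq> \<zero>" using 1 2 integral al be by blast
  show "b \<noteq> \<zero>" unfolding y_prod[symmetric] using 1 2 integral by (metis al be m_closed)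
qed

lemma c_cube: "c \<otimes> c \<otimes> c = b"
proof -
  have "c \<otimes> c \<otimes> c = y1 \<otimes> y2" using al be by algebra
  thus ?thesis using y_prod by simp
qed

text \<open>The difference of the cubes yields \<zeta> - \<zeta>^2 after division by n, and \<zeta>
  + \<zeta>^2 = -1 is always available. Together with \<open>y1_if_zeta\<close> this says that
  K(\<alpha>^3) = K(\<zeta>).\<close>

lemma zeta_if_y1:
  assumes "subfield E R" "K \<subseteq> E" "y1 \<in> E"
  shows "\<zeta> \<in> E"
proof -
  note E = subfield_closed[OF assms(1)]
  have "y2 \<in> E" using y2_eq E(6,7) assms(2,3) aK by auto
  with assms(3) have "y1 \<ominus> y2 \<in> E" by (rule E(7))
  hence "n \<otimes> (\<zeta> \<ominus> w) \<in> E"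
    using y_diff E(6)[of "\<ominus> (n \<otimes> (\<zeta> \<ominus> w))"] by auto
  hence d: "\<zeta> \<ominus> w \<in> E" using subfield_cancel[OF assms(1) _ n_nonzero] nK assms(2) by auto
  have s: "\<zeta> \<oplus> w \<in> E" unfolding z_plus_w using E(3,6) by blast
  show ?thesis by (rule sum_diff_imp_mem[OF assms(1) _ _ s d two]) simp_all
qed

lemma y1_if_zeta:
  assumes "subfield E R" "K \<subseteq> E" "\<zeta> \<in> E"
  shows "y1 \<in> E" "y2 \<in> E"
proof -
  note E = subfield_closed[OF assms(1)]
  have "n \<otimes> (\<zeta> \<ominus> w) \<in> E" using E(4,7) assms(2,3) nK by blast
  hence d: "y1 \<ominus> y2 \<in> E" using y_diff E(6) by metis
  have s: "y1 \<oplus> y2 \<in> E" unfolding y_sum using E(6) aK assms(2) by blast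
  show "y1 \<in> E" by (rule sum_diff_imp_mem[OF assms(1) _ _ s d two]) simp_all
  thus "y2 \<in> E" using y2_eq E(6,7) assms(2) aK by auto
qed

lemma zeta_if_al:
  assumes "subfield E R" "K \<subseteq> E" "\<alpha> \<in> E \<or> \<beta> \<in> E"
  shows "\<zeta> \<in> E"
  using zeta_if_y1[OF assms(1,2)] sextic.zeta_if_y1[OF swap assms(1,2)] assms(3)
    subfield_closed(4)[OF assms(1)] by blast

lemma M_props: "subfield M R" "K \<subseteq> M" "\<zeta> \<in> M"
  using adjoin_subfield[OF subfieldE(3)[OF K], of "{\<zeta>}"] by auto

lemma M_least: "subfield E R \<Longrightarrow> K \<subseteq> E \<Longrightarrow> \<zeta> \<in> E \<Longrightarrow> M \<subseteq> E"
  using adjoin_least[of E K "{\<zeta>}"] by simp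

lemma F_props: "subfield F R" "K \<subseteq> F" "\<alpha> \<in> F" "\<beta> \<in> F" "\<zeta> \<in> F" "M \<subseteq> F"
proof -
  show *: "subfield F R" "K \<subseteq> F" "\<alpha> \<in> F" "\<beta> \<in> F"
    using adjoin_subfield[OF subfieldE(3)[OF K], of "{\<alpha>, \<beta>}"] by auto
  thus "\<zeta> \<in> F" using zeta_if_al by blast
  thus "M \<subseteq> F" using M_least * by blast
qed

lemma F_least: "subfield E R \<Longrightarrow> K \<subseteq> E \<Longrightarrow> \<alpha> \<in> E \<Longrightarrow> \<beta> \<in> E \<Longrightarrow> F \<subseteq> E"
  using adjoin_least[of E K "{\<alpha>, \<beta>}"] by simp

lemma M_dim: "dimension 2 K M"
  using dimension_adjoin_zeta[OF K z_notin] .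

subsection \<open>The resolvent cubic\<close>

abbreviation "A \<equiv> c \<otimes> \<alpha>"
abbreviation "B \<equiv> c \<otimes> \<beta>"

text \<open>The roots of the resolvent are the sums \<open>u \<oplus> v\<close> over the three conjugates
  \<open>(u, v) = (\<zeta>\<^sup>i A, \<zeta>\<^sup>-\<^sup>i B)\<close>.\<close>

definition conj_pair :: "'a \<Rightarrow> 'a \<Rightarrow> bool"
  where "conj_pair u v \<longleftrightarrow> u \<in> carrier R \<and> v \<in> carrier R \<and> u \<otimes> v = b \<and>
    u \<otimes> u \<otimes> u = b \<otimes> y1 \<and> v \<otimes> v \<otimes> v = b \<otimes> y2"

lemma conj_pair_AB: "conj_pair A B"
proof -
  have "(x \<otimes> u) \<otimes> (x \<otimes> u) \<otimes> (x \<otimes> u) = (x \<otimes> x \<otimes> x) \<otimes> (u \<otimes> u \<otimes> u)"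
    if "x \<in> carrier R" "u \<in> carrier R" for x u using that by algebra
  hence "A \<otimes> A \<otimes> A = (c \<otimes> c \<otimes> c) \<otimes> y1" "B \<otimes> B \<otimes> B = (c \<otimes> c \<otimes> c) \<otimes> y2" by simp_all
  moreover have "A \<otimes> B = c \<otimes> c \<otimes> c" using al be by (simp add: m_ac)
  ultimately show ?thesis unfolding conj_pair_def c_cube by simp
qed

lemma conj_pair_rotate: "conj_pair u v \<Longrightarrow> conj_pair (\<zeta> \<otimes> u) (w \<otimes> v)"
  "conj_pair u v \<Longrightarrow> conj_pair (w \<otimes> u) (\<zeta> \<otimes> v)"
proof -
  assume uv: "conj_pair u v"
  hence c: "u \<in> carrier R" "v \<in> carrier R" "u \<otimes> v = b" unfolding conj_pair_def by auto
  have "(\<zeta> \<otimes> u) \<otimes> (w \<otimes> v) = (\<zeta> \<otimes> w) \<otimes> (u \<otimes> v)" "(w \<otimes> u) \<otimes> (\<zeta> \<otimes> v) = (\<zeta> \<otimes> w) \<otimes> (u \<otimes> v)"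
    using c(1,2) z_closed by algebra+
  hence "(\<zeta> \<otimes> u) \<otimes> (w \<otimes> v) = b" "(w \<otimes> u) \<otimes> (\<zeta> \<otimes> v) = b" unfolding zw c(3) by simp_all
  thus "conj_pair (\<zeta> \<otimes> u) (w \<otimes> v)" "conj_pair (w \<otimes> u) (\<zeta> \<otimes> v)"
    using uv cube_unity_mult c(1,2) unfolding conj_pair_def by simp_all
qed

text \<open>The two rotated sums differ by (\<zeta> - \<zeta>^2)(u - v). Applied to each of the
  three pairs, this separates all roots of the resolvent.\<close>

lemma conj_pair_neq:
  assumes "conj_pair u v"
  shows "u \<noteq> v" "\<zeta> \<otimes> u \<oplus> w \<otimes> v \<noteq> w \<otimes> u \<oplus> \<zeta> \<otimes> v"
proof -
  show neq: "u \<noteq> v"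
  proof
    assume "u = v"
    hence "b \<otimes> y1 = b \<otimes> y2" using assms unfolding conj_pair_def by metis
    thus False using cubes_neq m_lcancel[OF nonzero(3)] by simp
  qed
  have c: "u \<in> carrier R" "v \<in> carrier R" using assms unfolding conj_pair_def by auto
  have "(\<zeta> \<otimes> u \<oplus> w \<otimes> v) \<ominus> (w \<otimes> u \<oplus> \<zeta> \<otimes> v) = (\<zeta> \<ominus> w) \<otimes> (u \<ominus> v)"
    using c z_closed by algebra
  moreover have "(\<zeta> \<ominus> w) \<otimes> (u \<ominus> v) \<noteq> \<zero>"
    using integral[of "\<zeta> \<ominus> w" "u \<ominus> v"] neq z_neq c by auto
  moreover have "(w \<otimes> u \<oplus> \<zeta> \<otimes> v) \<ominus> (w \<otimes> u \<oplus> \<zeta> \<otimes> v) = \<zero>" using c by simp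
  ultimately show "\<zeta> \<otimes> u \<oplus> w \<otimes> v \<noteq> w \<otimes> u \<oplus> \<zeta> \<otimes> v" by metis
qed

text \<open>Cardano's factorisation applies because uv = b gives the linear coefficient and u^3 +
  v^3 = b(\<open>y1\<close> + \<open>y2\<close>) = -ab the constant one.\<close>

lemma Res_root_iff:
  assumes "conj_pair u v" "x \<in> carrier R"
  shows "eval Res x = \<zero> \<longleftrightarrow> x = u \<oplus> v \<or> x = \<zeta> \<otimes> u \<oplus> w \<otimes> v \<or> x = w \<otimes> u \<oplus> \<zeta> \<otimes> v"
proof -
  have c: "u \<in> carrier R" "v \<in> carrier R" "u \<otimes> v = b" "u \<otimes> u \<otimes> u = b \<otimes> y1" "v \<otimes> v \<otimes> v = b \<otimes> y2"
    using assms(1) unfolding conj_pair_def by auto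
  have "b \<otimes> y1 \<oplus> b \<otimes> y2 = b \<otimes> (y1 \<oplus> y2)" using al be abn_closed by algebra
  hence "\<ominus> (b \<otimes> y1 \<oplus> b \<otimes> y2) = a \<otimes> b" unfolding y_sum by (simp add: r_minus m_comm)
  hence "eval Res x = (x \<ominus> (u \<oplus> v)) \<otimes> ((x \<ominus> (\<zeta> \<otimes> u \<oplus> w \<otimes> v)) \<otimes> (x \<ominus> (w \<otimes> u \<oplus> \<zeta> \<otimes> v)))"
    unfolding cubic_factorization[OF assms(2) c(1,2)] c(3-5)
    using eval_cubic[OF assms(2), of "\<ominus> (b \<oplus> b \<oplus> b)" "a \<otimes> b"] by simp
  moreover have "x \<ominus> (u \<oplus> v) \<in> carrier R" "x \<ominus> (\<zeta> \<otimes> u \<oplus> w \<otimes> v) \<in> carrier R" "x \<ominus> (w \<otimes> u \<oplus> \<zeta> \<otimes> v) \<in> carrier R"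
    using assms(2) c by simp_all
  ultimately have "eval Res x = \<zero> \<longleftrightarrow> x \<ominus> (u \<oplus> v) = \<zero> \<or> x \<ominus> (\<zeta> \<otimes> u \<oplus> w \<otimes> v) = \<zero> \<or> x \<ominus> (w \<otimes> u \<oplus> \<zeta> \<otimes> v) = \<zero>"
    using integral_iff by (metis m_closed)
  thus ?thesis using assms(2) c by simp
qed

text \<open>Since uv = b, the cofactor in u^3 - v^3 = (u - v)((u + v)^2 - uv) lies in E, and u^3 -
  v^3 = b(\<open>y1\<close> - \<open>y2\<close>). The multiplier x is 1 when E contains \<zeta>, and
  \<zeta> - \<zeta>^2 otherwise: its product with \<open>y1\<close> - \<open>y2\<close> is 3n up to
  sign, which lies in K.\<close>

lemma conj_pair_diff:
  assumes "conj_pair u v" "subfield E R" "K \<subseteq> E" "u \<oplus> v \<in> E" "x \<in> carrier R"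
    and "x \<otimes> (b \<otimes> (y1 \<ominus> y2)) \<in> E"
  shows "x \<otimes> (u \<ominus> v) \<in> E"
proof -
  note E = subfield_closed[OF assms(2)]
  have c: "u \<in> carrier R" "v \<in> carrier R" "u \<otimes> v = b" "u \<otimes> u \<otimes> u = b \<otimes> y1" "v \<otimes> v \<otimes> v = b \<otimes> y2"
    using assms(1) unfolding conj_pair_def by auto
  let ?s = "(u \<oplus> v) \<otimes> (u \<oplus> v) \<ominus> u \<otimes> v"
  have eq: "?s \<otimes> (u \<ominus> v) = u \<otimes> u \<otimes> u \<ominus> v \<otimes> v \<otimes> v" using c(1,2) by algebra
  also have "\<dots> = b \<otimes> (y1 \<ominus> y2)" unfolding c(4,5) using al be abn_closed by algebra
  finally have eq: "?s \<otimes> (u \<ominus> v) = b \<otimes> (y1 \<ominus> y2)" .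
  have "b \<otimes> (y1 \<ominus> y2) \<noteq> \<zero>"
    using integral[of b "y1 \<ominus> y2"] nonzero(3) cubes_neq by auto
  hence s0: "?s \<noteq> \<zero>" using eq c(1,2) by (metis l_null minus_closed)
  have sE: "?s \<in> E" unfolding c(3) using E(4,7) assms(3,4) bK by blast
  have "?s \<otimes> (x \<otimes> (u \<ominus> v)) = x \<otimes> (?s \<otimes> (u \<ominus> v))" using c(1,2) assms(5) by (simp add: m_lcomm)
  hence "?s \<otimes> (x \<otimes> (u \<ominus> v)) \<in> E" using assms(6) unfolding eq by simp
  thus ?thesis using subfield_cancel[OF assms(2) sE s0] c(1,2) assms(5) by simp
qed

lemma conj_pair_mem:
  assumes "conj_pair u v" "subfield E R" "K \<subseteq> E" "\<zeta> \<in> E" "u \<oplus> v \<in> E"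
  shows "u \<in> E"
proof -
  note E = subfield_closed[OF assms(2)]
  have c: "u \<in> carrier R" "v \<in> carrier R" using assms(1) unfolding conj_pair_def by auto
  have "b \<otimes> (y1 \<ominus> y2) \<in> E"
    using E(4)[of b "y1 \<ominus> y2"] E(7)[OF y1_if_zeta[OF assms(2-4)]] bK assms(3) by blast
  hence "\<one> \<otimes> (b \<otimes> (y1 \<ominus> y2)) \<in> E" by simp
  hence "\<one> \<otimes> (u \<ominus> v) \<in> E" by (rule conj_pair_diff[OF assms(1-3,5) one_closed])
  thus ?thesis using sum_diff_imp_mem[OF assms(2) c assms(5) _ two] c by simp
qed

text \<open>The resolvent has the square discriminant (9bn)^2, so one root generates the others.
  Concretely, the other two have the sum -(u + v) and the difference (\<zeta> - \<zeta>^2)(u - v),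
  and both lie in E even without \<zeta>.\<close>

lemma conj_pair_rotate_mem:
  assumes "conj_pair u v" "subfield E R" "K \<subseteq> E" "u \<oplus> v \<in> E"
  shows "\<zeta> \<otimes> u \<oplus> w \<otimes> v \<in> E" "w \<otimes> u \<oplus> \<zeta> \<otimes> v \<in> E"
proof -
  note E = subfield_closed[OF assms(2)]
  have c: "u \<in> carrier R" "v \<in> carrier R" using assms(1) unfolding conj_pair_def by auto
  let ?s = "\<zeta> \<ominus> w"
  have sc: "?s \<in> carrier R" by simp
  have "?s \<otimes> (b \<otimes> (n \<otimes> ?s)) = (?s \<otimes> ?s) \<otimes> (b \<otimes> n)" using sc abn_closed by algebra
  moreover have "?s \<otimes> ?s \<in> E" unfolding z_minus_w_square using E(3,5,6) by blast
  ultimately have m: "?s \<otimes> (b \<otimes> (n \<otimes> ?s)) \<in> E" using E(4)[OF _ E(4)[of b n]] bK nK assms(3) by auto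
  hence "?s \<otimes> (b \<otimes> (\<ominus> (n \<otimes> ?s))) \<in> E"
    using E(6)[OF m] sc by (simp add: r_minus)
  hence "?s \<otimes> (b \<otimes> (y1 \<ominus> y2)) \<in> E" using m y_diff by metis
  hence "?s \<otimes> (u \<ominus> v) \<in> E" by (rule conj_pair_diff[OF assms sc])
  moreover have "?s \<otimes> (u \<ominus> v) = (\<zeta> \<otimes> u \<oplus> w \<otimes> v) \<ominus> (w \<otimes> u \<oplus> \<zeta> \<otimes> v)"
    using c z_closed by algebra
  moreover have "(\<zeta> \<oplus> w) \<otimes> (u \<oplus> v) = (\<zeta> \<otimes> u \<oplus> w \<otimes> v) \<oplus> (w \<otimes> u \<oplus> \<zeta> \<otimes> v)"
    using c z_closed by algebra
  moreover have "(\<zeta> \<oplus> w) \<otimes> (u \<oplus> v) \<in> E" unfolding z_plus_w using E(3,4,6) assms(4) by blast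
  ultimately have s: "(\<zeta> \<otimes> u \<oplus> w \<otimes> v) \<oplus> (w \<otimes> u \<oplus> \<zeta> \<otimes> v) \<in> E" and
    d: "(\<zeta> \<otimes> u \<oplus> w \<otimes> v) \<ominus> (w \<otimes> u \<oplus> \<zeta> \<otimes> v) \<in> E" by simp_all
  show 1: "\<zeta> \<otimes> u \<oplus> w \<otimes> v \<in> E"
    using sum_diff_imp_mem[OF assms(2) _ _ s d two] c by simp
  have "w \<otimes> u \<oplus> \<zeta> \<otimes> v = (\<zeta> \<otimes> u \<oplus> w \<otimes> v) \<ominus> ((\<zeta> \<otimes> u \<oplus> w \<otimes> v) \<ominus> (w \<otimes> u \<oplus> \<zeta> \<otimes> v))"
    using c z_closed by algebra
  thus "w \<otimes> u \<oplus> \<zeta> \<otimes> v \<in> E" using E(7)[OF 1 d] by simp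
qed

abbreviation "t \<equiv> A \<oplus> B"

lemma Res_t: "eval Res t = \<zero>"
  using Res_root_iff[OF conj_pair_AB, of t] by simp

text \<open>Any root can be rotated back to t inside E, because \<zeta> and \<zeta>^2 are inverse to
  each other.\<close>

lemma Res_root_imp_t:
  assumes "subfield E R" "K \<subseteq> E" "r \<in> E" "eval Res r = \<zero>"
  shows "t \<in> E"
proof -
  have "r \<in> carrier R" using subfield_closed(1)[OF assms(1,3)] .
  then consider "r = t" | "r = \<zeta> \<otimes> A \<oplus> w \<otimes> B" | "r = w \<otimes> A \<oplus> \<zeta> \<otimes> B"
    using Res_root_iff[OF conj_pair_AB, of r] assms(4) by blast
  thus ?thesis
  proof cases
    case 1
    thus ?thesis using assms(3) by simp
  next
    case 2
    have "w \<otimes> (\<zeta> \<otimes> A) \<oplus> \<zeta> \<otimes> (w \<otimes> B) \<in> E"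
      using conj_pair_rotate_mem(2)[OF conj_pair_rotate(1)[OF conj_pair_AB] assms(1,2)] assms(3) 2 by simp
    moreover have "w \<otimes> (\<zeta> \<otimes> A) = (w \<otimes> \<zeta>) \<otimes> A" "\<zeta> \<otimes> (w \<otimes> B) = (\<zeta> \<otimes> w) \<otimes> B"
      by (simp_all add: m_assoc)
    ultimately show ?thesis unfolding zw by simp
  next
    case 3
    have "\<zeta> \<otimes> (w \<otimes> A) \<oplus> w \<otimes> (\<zeta> \<otimes> B) \<in> E"
      using conj_pair_rotate_mem(1)[OF conj_pair_rotate(2)[OF conj_pair_AB] assms(1,2)] assms(3) 3 by simp
    moreover have "\<zeta> \<otimes> (w \<otimes> A) = (\<zeta> \<otimes> w) \<otimes> A" "w \<otimes> (\<zeta> \<otimes> B) = (w \<otimes> \<zeta>) \<otimes> B"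
      by (simp_all add: m_assoc)
    ultimately show ?thesis unfolding zw by simp
  qed
qed

lemma A_if_t:
  assumes "subfield E R" "K \<subseteq> E" "\<zeta> \<in> E" "t \<in> E"
  shows "A \<in> E"
  using conj_pair_mem[OF conj_pair_AB assms] .

lemma t_if_A:
  assumes "subfield E R" "K \<subseteq> E" "A \<in> E"
  shows "t \<in> E"
proof -
  note E = subfield_closed[OF assms(1)]
  have "A \<noteq> \<zero>" using nonzero integral by (metis al be m_closed)
  moreover have "A \<otimes> B = b" using conj_pair_AB unfolding conj_pair_def by blast
  ultimately have "B \<in> E" using subfield_cancel[OF assms(1,3)] assms(2) bK by auto
  thus ?thesis using E(5) assms(3) by blast
qed

declare eval.simps [simp del]

subsection \<open>Degrees\<close>

lemma two_dvd_if_zeta: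
  assumes "subfield E R" "K \<subseteq> E" "\<zeta> \<in> E" "dimension d K E"
  shows "even d"
  using dimension_tower_dvd(1)[OF K M_props(1) assms(1) M_props(2) M_least[OF assms(1-3)] assms(4) M_dim] .

lemma dimension_al: "dimension 6 K (adjoin R K {\<alpha>})"
  using dimension_adjoin[OF K al algebraicI[OF polys_closed(1) _ f_al]] degree_al by simp

lemma adjoin_al: "subfield (adjoin R K {\<alpha>}) R" "K \<subseteq> adjoin R K {\<alpha>}" "\<alpha> \<in> adjoin R K {\<alpha>}"
  using adjoin_subfield[OF subfieldE(3)[OF K], of "{\<alpha>}"] by simp_all

lemma al_notin_M: "\<alpha> \<notin> M"
proof
  assume "\<alpha> \<in> M"
  hence "adjoin R K {\<alpha>} \<subseteq> M" using adjoin_least[OF M_props(1,2), of "{\<alpha>}"] by simp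
  hence "6 dvd (2::nat)"
    using dimension_tower_dvd(1)[OF K adjoin_al(1) M_props(1) adjoin_al(2) _ M_dim dimension_al] by simp
  thus False by presburger
qed

lemma F_subset_if_c:
  assumes "subfield E R" "K \<subseteq> E" "c \<in> E" "\<alpha> \<in> E \<or> \<beta> \<in> E \<or> A \<in> E"
  shows "F \<subseteq> E"
proof -
  have "\<alpha> \<in> E \<or> \<beta> \<in> E"
    using subfield_cancel[OF assms(1,3) nonzero(4) al] assms(4) by blast
  moreover have "\<beta> \<otimes> \<alpha> \<in> E" using assms(3) by (simp add: m_comm)
  ultimately have "\<alpha> \<in> E" "\<beta> \<in> E"
    using subfield_cancel[OF assms(1) _ nonzero(1) be] assms(3)
      subfield_cancel[OF assms(1) _ nonzero(2) al] by blast+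
  thus ?thesis using F_least assms(1,2) by blast
qed

text \<open>Dividing A by \<beta> gives \<alpha>^2. As \<beta> brings \<zeta> and hence \<alpha>^3
  into E, the quotient \<alpha>^3/\<alpha>^2 = \<alpha> lies in E too.\<close>

lemma F_subset_if_be_A:
  assumes "subfield E R" "K \<subseteq> E" "\<beta> \<in> E" "A \<in> E"
  shows "F \<subseteq> E"
proof -
  note E = subfield_closed[OF assms(1)]
  have "\<beta> \<otimes> (\<alpha> \<otimes> \<alpha>) = A" by (simp add: m_ac)
  hence aa: "\<alpha> \<otimes> \<alpha> \<in> E" using subfield_cancel[OF assms(1,3) nonzero(2)] assms(4) by simp
  have "\<alpha> \<otimes> \<alpha> \<noteq> \<zero>" using nonzero(1) integral al by blast
  moreover have "(\<alpha> \<otimes> \<alpha>) \<otimes> \<alpha> \<in> E"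
    using y1_if_zeta[OF assms(1,2)] zeta_if_al[OF assms(1,2)] assms(3) by blast
  ultimately have "\<alpha> \<in> E" using subfield_cancel[OF assms(1) aa] by simp
  thus ?thesis using F_least assms(1-3) by blast
qed

lemma F_subset_if_al_A:
  assumes "subfield E R" "K \<subseteq> E" "\<alpha> \<in> E" "A \<in> E"
  shows "F \<subseteq> E"
proof -
  have "\<alpha> \<otimes> c \<in> E" using assms(4) by (simp add: m_comm)
  hence "c \<in> E" using subfield_cancel[OF assms(1,3) nonzero(1)] by simp
  thus ?thesis using F_subset_if_c assms by blast
qed

lemma cb_root_iff: "u \<in> carrier R \<Longrightarrow> eval cb u = \<zero> \<longleftrightarrow> u \<otimes> u \<otimes> u = b"
  using eval_cubic[of u \<zero> "\<ominus> b"] by (simp add: minus_eq[symmetric])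

lemma poly_mono: "p \<in> carrier (K[X]) \<Longrightarrow> K \<subseteq> E \<Longrightarrow> p \<in> carrier (E[X])"
  using carrier_univ_poly_mono by blast

text \<open>The descent is applied to X^3 - b and to the resolvent. The outcomes differ in form:
  without \<zeta> in E only some cube root of b is obtained, while any root of the resolvent already
  yields t.\<close>

lemma quadratic_descent:
  assumes "subfield E R" "subfield N R" "K \<subseteq> E" "E \<subseteq> N" "dimension 2 E N"
  shows "c \<in> N \<Longrightarrow> \<exists>u \<in> E. u \<otimes> u \<otimes> u = b" and "t \<in> N \<Longrightarrow> t \<in> E"
proof -
  assume "c \<in> N"
  moreover have "eval cb c = \<zero>" using cb_root_iff c_cube by simp
  ultimately obtain r where "r \<in> E" "eval cb r = \<zero>"
    using cubic_root_in_quadratic_extension[OF assms(1,2,4,5) poly_mono[OF polys_closed(3) assms(3)]] by auto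
  thus "\<exists>u \<in> E. u \<otimes> u \<otimes> u = b" using cb_root_iff subfield_closed(1)[OF assms(1)] by blast
next
  assume "t \<in> N"
  then obtain r where "r \<in> E" "eval Res r = \<zero>"
    using cubic_root_in_quadratic_extension[OF assms(1,2,4,5) poly_mono[OF polys_closed(2) assms(3)] _ _ Res_t] by auto
  thus "t \<in> E" using Res_root_imp_t[OF assms(1,3)] by blast
qed

lemma dimension_adjoin_cubic:
  assumes "subfield E R" "x \<in> carrier R" "p \<in> carrier (E[X])" "degree p = 3" "eval p x = \<zero>"
    and "\<And>r. r \<in> E \<Longrightarrow> eval p r \<noteq> \<zero>"
  shows "dimension 3 E (adjoin R E {x})"
proof -
  have "p \<noteq> []" using assms(4) by auto
  thus ?thesis
    using dimension_adjoin[OF assms(1,2) algebraicI[OF assms(3) _ assms(5)]]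
      cubic_no_root_imp_degree[OF assms] by simp
qed

lemma dimension_adjoin_cube_root:
  assumes "subfield E R" "K \<subseteq> E" "u \<in> carrier R" "u \<otimes> u \<otimes> u = b" "\<forall>v \<in> E. v \<otimes> v \<otimes> v \<noteq> b"
  shows "dimension 3 E (adjoin R E {u})"
  using dimension_adjoin_cubic[OF assms(1,3) poly_mono[OF polys_closed(3) assms(2)]]
    cb_root_iff assms(3-5) subfield_closed(1)[OF assms(1)] by simp

lemma dimension_adjoin_t:
  assumes "subfield E R" "K \<subseteq> E" "t \<notin> E"
  shows "dimension 3 E (adjoin R E {t})"
  using dimension_adjoin_cubic[OF assms(1) _ poly_mono[OF polys_closed(2) assms(2)] _ Res_t]
    Res_root_imp_t[OF assms(1,2)] assms(3) by auto

lemma t_in_K_iff: "t \<in> K \<longleftrightarrow> \<not> pirreducible K Res"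
  using cubic_pirreducible_iff[OF K polys_closed(2)] Res_t Res_root_imp_t[OF K order.refl] by auto

lemma no_cube_root_in_M:
  assumes "\<forall>u \<in> K. u \<otimes> u \<otimes> u \<noteq> b"
  shows "\<forall>u \<in> M. u \<otimes> u \<otimes> u \<noteq> b"
proof (intro ballI notI)
  fix u assume u: "u \<in> M" "u \<otimes> u \<otimes> u = b"
  hence "c \<in> M" using cube_root_mem[OF M_props(1,3) u(1)] c_cube by simp
  thus False using quadratic_descent(1)[OF K M_props(1) order.refl M_props(2) M_dim] assms by blast
qed

lemma t_notin_M: "t \<notin> K \<Longrightarrow> t \<notin> M"
  using quadratic_descent(2)[OF K M_props(1) order.refl M_props(2) M_dim] by blast

lemma a_nonzero:
  assumes "t \<notin> K" shows "a \<noteq> \<zero>"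
proof
  assume "a = \<zero>"
  hence "eval Res \<zero> = \<zero>" using eval_cubic[of \<zero> "\<ominus> (b \<oplus> b \<oplus> b)" "a \<otimes> b"] by simp
  thus False using Res_root_imp_t[OF K order.refl K_closed(2)] assms by blast
qed

text \<open>This is the independence of the Kummer classes of c and A over M. Otherwise c, cA or
  cA^2 would lie in M. The first is a cube root of b; cA \<beta> = b puts \<beta> into M; and cA^2 =
  b \<alpha>^2 puts \<alpha>^2 and with \<alpha>^3 also \<alpha> into M, against their degree
  6.\<close>

lemma c_notin_if_t:
  assumes nb: "\<forall>u \<in> K. u \<otimes> u \<otimes> u \<noteq> b" and t: "t \<notin> K"
  shows "c \<notin> adjoin R M {A}"
proof
  assume cA: "c \<in> adjoin R M {A}"
  note M = subfield_closed[OF M_props(1)]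
  have bM: "b \<in> M" using bK M_props(2) by blast
  have y: "y1 \<in> M" using y1_if_zeta[OF M_props] by blast
  have A3: "A \<otimes> A \<otimes> A = b \<otimes> y1" using conj_pair_AB unfolding conj_pair_def by blast
  have A3M: "A \<otimes> A \<otimes> A \<in> M" unfolding A3 using M(4)[OF bM y] .
  have A: "A \<notin> M" using t_if_A[OF M_props(1,2)] t_notin_M[OF t] by blast
  have "c \<in> M \<or> c \<otimes> A \<in> M \<or> c \<otimes> A \<otimes> A \<in> M"
    using kummer_cubic[OF M_props(1,3) _ A3M A cA] c_cube bM by simp
  then consider "c \<in> M" | "c \<otimes> A \<in> M" | "c \<otimes> A \<otimes> A \<in> M" by blast
  thus False
  proof cases
    case 1
    thus False using no_cube_root_in_M[OF nb] c_cube by blast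
  next
    case 2
    have "(c \<otimes> A) \<otimes> \<beta> = c \<otimes> c \<otimes> c" by (simp add: m_ac)
    moreover have "c \<otimes> A \<noteq> \<zero>" using nonzero integral al be by (metis m_closed)
    ultimately have "\<beta> \<in> M" using subfield_cancel[OF M_props(1) 2] c_cube bM by simp
    thus False using sextic.al_notin_M[OF swap] by blast
  next
    case 3
    have "c \<otimes> A \<otimes> A = (c \<otimes> c \<otimes> c) \<otimes> (\<alpha> \<otimes> \<alpha>)" by (simp add: m_ac)
    hence aa: "\<alpha> \<otimes> \<alpha> \<in> M" using subfield_cancel[OF M_props(1) bM nonzero(3)] 3 unfolding c_cube by simp
    have "\<alpha> \<otimes> \<alpha> \<noteq> \<zero>" using nonzero(1) integral al by blast
    hence "\<alpha> \<in> M" using subfield_cancel[OF M_props(1) aa] y by simp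
    thus False using al_notin_M by blast
  qed
qed

subsection \<open>Fields containing \<open>\<zeta>\<close>\<close>

lemma adjoin_M: "S \<subseteq> carrier R \<Longrightarrow> adjoin R M S = adjoin R K (insert \<zeta> S)"
  using adjoin_adjoin[OF subfieldE(3)[OF K], of "{\<zeta>}" S] by simp

text \<open>If c is not in N, then N(c) = F because the index 3 is prime. So \<alpha> is an element
  of N(c) with cube in N, and \<alpha>, \<alpha> c = A or \<alpha> c^2 lies in N. The last gives
  \<beta> because \<alpha> c^2 \<beta> = b.\<close>

lemma kummer_classification:
  assumes "subfield N R" "K \<subseteq> N" "\<zeta> \<in> N" "N \<subseteq> F" "dimension 3 N F"
  shows "c \<in> N \<or> \<alpha> \<in> N \<or> \<beta> \<in> N \<or> A \<in> N"
proof (cases "c \<in> N")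
  case False
  have cF: "c \<in> F" using subfield_closed(4)[OF F_props(1,3,4)] .
  note Nc = adjoin_subfield[OF subfieldE(3)[OF assms(1)], of "{c}"]
  have bN: "b \<in> N" using bK assms(2) by blast
  have "adjoin R N {c} \<subseteq> F" using adjoin_least[OF F_props(1) assms(4), of "{c}"] cF by simp
  hence "adjoin R N {c} = N \<or> adjoin R N {c} = F"
    using dimension_prime_tower[OF assms(1) Nc(1) F_props(1) Nc(2) _ assms(5)] by simp
  hence "\<alpha> \<in> adjoin R N {c}" using Nc(3) False F_props(3) by auto
  hence "\<alpha> \<in> N \<or> \<alpha> \<otimes> c \<in> N \<or> \<alpha> \<otimes> c \<otimes> c \<in> N"
    using kummer_cubic[OF assms(1,3) _ _ False] c_cube bN y1_if_zeta[OF assms(1-3)] by simp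
  moreover have "\<beta> \<in> N" if "\<alpha> \<otimes> c \<otimes> c \<in> N"
  proof -
    have "(\<alpha> \<otimes> c \<otimes> c) \<otimes> \<beta> = c \<otimes> c \<otimes> c" by (simp add: m_ac)
    moreover have "\<alpha> \<otimes> c \<otimes> c \<noteq> \<zero>" using nonzero integral al be by (metis m_closed)
    ultimately show ?thesis using subfield_cancel[OF assms(1) that] c_cube bN by simp
  qed
  ultimately show ?thesis by (auto simp: m_comm)
qed blast

lemma f_root_cases:
  assumes "x \<in> carrier R" "eval f x = \<zero>"
  shows "x \<otimes> x \<otimes> x = y1 \<or> x \<otimes> x \<otimes> x = y2"
proof -
  define y where "y = x \<otimes> x \<otimes> x"
  have yc: "y \<in> carrier R" unfolding y_def using assms(1) by simp
  have "(y \<ominus> u) \<otimes> (y \<ominus> v) = y \<otimes> y \<ominus> (u \<oplus> v) \<otimes> y \<oplus> u \<otimes> v"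
    if "u \<in> carrier R" "v \<in> carrier R" for u v using that yc by algebra
  hence "(y \<ominus> y1) \<otimes> (y \<ominus> y2) = y \<otimes> y \<ominus> (y1 \<oplus> y2) \<otimes> y \<oplus> y1 \<otimes> y2" by simp
  also have "\<dots> = y \<otimes> y \<oplus> a \<otimes> y \<oplus> b" unfolding y_sum y_prod using yc by (simp add: l_minus minus_eq)
  also have "\<dots> = \<zero>" using assms(2) eval_sextic[OF assms(1)] unfolding y_def by simp
  finally have "y \<ominus> y1 = \<zero> \<or> y \<ominus> y2 = \<zero>" by (rule integral) (use yc in simp_all)
  thus ?thesis using yc unfolding y_def by simp
qed

text \<open>A quadratic conjugate of \<open>\<alpha>\<close> over a field not containing \<open>\<zeta>\<close> must be a cube root of \<open>\<beta>\<^sup>3\<close>: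
  otherwise the norm of \<open>\<alpha>\<^sup>3\<close> would be \<open>\<alpha>\<^sup>6\<close>, and \<open>a \<alpha>\<^sup>3\<close> would lie in the small field.\<close>

lemma be_mem_if_quadratic:
  assumes "subfield E R" "subfield N R" "K \<subseteq> E" "E \<subseteq> N" "dimension 2 E N" "\<zeta> \<notin> E"
    and "\<alpha> \<in> N" "a \<noteq> \<zero>"
  shows "\<beta> \<in> N"
proof -
  note E = subfield_closed[OF assms(1)]
  note N = subfield_closed[OF assms(2)]
  have alE: "\<alpha> \<notin> E" using zeta_if_al[OF assms(1,3)] assms(6) by blast
  have zN: "\<zeta> \<in> N" using zeta_if_al[OF assms(2)] assms(3,4,7) by blast
  note Ea = adjoin_subfield[OF subfieldE(3)[OF assms(1)], of "{\<alpha>}"]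
  have "adjoin R E {\<alpha>} \<subseteq> N" using adjoin_least[OF assms(2,4), of "{\<alpha>}"] assms(7) by simp
  hence "adjoin R E {\<alpha>} = E \<or> adjoin R E {\<alpha>} = N"
    using dimension_prime_tower[OF assms(1) Ea(1) assms(2) Ea(2) _ assms(5)] by simp
  hence eqN: "adjoin R E {\<alpha>} = N" using Ea(3) alE by auto
  hence deg: "degree (Irr E \<alpha>) = 2" using degree_Irr_eq_dimension[OF assms(1) al] assms(5) by simp
  have alg: "(algebraic over E) \<alpha>" using dimension_imp_algebraic[OF assms(1,2,5,7)] .
  note I = IrrE[OF assms(1) al alg]
  from deg have "length (Irr E \<alpha>) = Suc (Suc (Suc 0))" by simp
  then obtain l p q where l: "Irr E \<alpha> = [l, p, q]" by (auto simp: length_Suc_conv)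
  hence l1: "l = \<one>" using I(3) by simp
  have pq: "p \<in> E" "q \<in> E" using I(1) l unfolding univ_poly_carrier[symmetric] polynomial_def by auto
  have pqc: "p \<in> carrier R" "q \<in> carrier R" using pq E(1) by auto
  have ev: "eval (Irr E \<alpha>) x = x \<otimes> x \<oplus> p \<otimes> x \<oplus> q" if "x \<in> carrier R" for x
    using that pqc unfolding l l1 by (simp add: eval.simps numeral_2_eq_2 a_assoc)
  have al0: "\<alpha> \<otimes> \<alpha> \<oplus> p \<otimes> \<alpha> \<oplus> q = \<zero>" using I(4) ev by simp
  \<comment> \<open>The second root of the quadratic minimal polynomial of \<alpha> over E, from the
    sum of the roots.\<close>
  define x where "x = \<ominus> p \<ominus> \<alpha>"
  have xc: "x \<in> carrier R" unfolding x_def using pqc by simp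
  have xN: "x \<in> N" unfolding x_def using N(6,7) pq(1) assms(4,7) by blast
  have "x \<otimes> x \<oplus> p \<otimes> x \<oplus> q = \<alpha> \<otimes> \<alpha> \<oplus> p \<otimes> \<alpha> \<oplus> q"
    unfolding x_def using pqc al by algebra
  hence "eval (Irr E \<alpha>) x = \<zero>" using ev[OF xc] al0 by simp
  moreover have "Irr E \<alpha> pdivides f"
    using Irr_minimal[OF assms(1) al alg poly_mono[OF polys_closed(1) assms(3)] f_al] .
  ultimately have fx: "eval f x = \<zero>"
    using pdivides_imp_root_sharing[OF carrier_polynomial_shell[OF subfieldE(1)[OF assms(1)] I(1)] _ xc] by blast
  define y where "y = x \<otimes> x \<otimes> x"
  have "y = y1 \<or> y = y2" unfolding y_def using f_root_cases[OF xc] fx by blast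
  moreover have "y \<noteq> y1"
  proof
    assume yy: "y = y1"
    \<comment> \<open>The product of both roots is q, so if x^3 = \<open>y1\<close> then
      \<open>y1\<close>^2 = q^3 lies in E. The quadratic equation of \<open>y1\<close> turns this
      into a statement about a times \<open>y1\<close>, and dividing by a brings \<zeta> into
      E.\<close>
    have "\<alpha> \<otimes> x = q \<ominus> (\<alpha> \<otimes> \<alpha> \<oplus> p \<otimes> \<alpha> \<oplus> q)" unfolding x_def using pqc al by algebra
    hence q: "\<alpha> \<otimes> x = q" unfolding al0 using pqc by (simp add: minus_eq)
    have "y1 \<otimes> y = (\<alpha> \<otimes> x) \<otimes> (\<alpha> \<otimes> x) \<otimes> (\<alpha> \<otimes> x)" unfolding y_def using xc al by (simp add: m_ac)
    hence 1: "y1 \<otimes> y1 \<in> E" unfolding yy q using E(4) pq(2) by simp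
    have "a \<otimes> y1 = (y1 \<otimes> y1 \<oplus> a \<otimes> y1 \<oplus> b) \<ominus> y1 \<otimes> y1 \<ominus> b"
    proof -
      have "a \<otimes> u = (u \<otimes> u \<oplus> a \<otimes> u \<oplus> b) \<ominus> u \<otimes> u \<ominus> b" if "u \<in> carrier R" for u
        using that abn_closed by algebra
      thus ?thesis by simp
    qed
    also have "\<dots> \<in> E" unfolding y_root using 1 E(2,7) bK assms(3) by blast
    finally have "y1 \<in> E" using subfield_cancel[OF assms(1) _ assms(8)] aK assms(3) by auto
    thus False using zeta_if_y1[OF assms(1,3)] assms(6) by blast
  qed
  ultimately show ?thesis using cube_root_mem[OF assms(2) zN xN be] unfolding y_def by blast
qed

subsection \<open>Normality of the intermediate fields\<close>

lemma K_carrier: "K \<subseteq> carrier R"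
  using subfieldE(3)[OF K] .

lemma adjoin_props:
  assumes "x \<in> carrier R"
  shows "subfield (adjoin R K {x}) R" "K \<subseteq> adjoin R K {x}" "x \<in> adjoin R K {x}"
  using adjoin_subfield[OF K_carrier, of "{x}"] assms by simp_all

lemma adjoin_props2:
  assumes "x \<in> carrier R" "y \<in> carrier R"
  shows "subfield (adjoin R K {x, y}) R" "K \<subseteq> adjoin R K {x, y}" "x \<in> adjoin R K {x, y}" "y \<in> adjoin R K {x, y}"
  using adjoin_subfield[OF K_carrier, of "{x, y}"] assms by simp_all

lemma normal_M: "normal_extension R K M"
proof (rule normal_adjoinI[OF K z_closed zeta_poly(1)[OF K] _ zeta_poly(2)[OF K]])
  show "degree (Irr K \<zeta>) = degree [\<one>, \<one>, \<one>]" using degree_Irr_zeta[OF K z_notin] by simp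
  show "{\<zeta>, w} \<subseteq> M" using M_props(3) subfield_closed(4)[OF M_props(1)] by blast
  show "card {\<zeta>, w} = degree [\<one>, \<one>, \<one>]" using z_neq(5) by (simp add: eq_commute)
  show "eval [\<one>, \<one>, \<one>] y = \<zero>" if "y \<in> {\<zeta>, w}" for y using zeta_poly(2,3)[OF K] that by blast
qed simp

lemma conjugates_of_t_distinct:
  "t \<noteq> \<zeta> \<otimes> A \<oplus> w \<otimes> B" "t \<noteq> w \<otimes> A \<oplus> \<zeta> \<otimes> B" "\<zeta> \<otimes> A \<oplus> w \<otimes> B \<noteq> w \<otimes> A \<oplus> \<zeta> \<otimes> B"
proof -
  have assoc: "x \<otimes> (y \<otimes> u) = (x \<otimes> y) \<otimes> u" if "x \<in> carrier R" "y \<in> carrier R" "u \<in> carrier R" for x y u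
    using that by (simp add: m_assoc)
  have "\<zeta> \<otimes> (w \<otimes> A) \<oplus> w \<otimes> (\<zeta> \<otimes> B) = t" "w \<otimes> (w \<otimes> A) \<oplus> \<zeta> \<otimes> (\<zeta> \<otimes> B) = \<zeta> \<otimes> A \<oplus> w \<otimes> B"
    "\<zeta> \<otimes> (\<zeta> \<otimes> A) \<oplus> w \<otimes> (w \<otimes> B) = w \<otimes> A \<oplus> \<zeta> \<otimes> B" "w \<otimes> (\<zeta> \<otimes> A) \<oplus> \<zeta> \<otimes> (w \<otimes> B) = t"
    using assoc[of \<zeta> w A] assoc[of w \<zeta> B] assoc[of w w A] assoc[of \<zeta> \<zeta> B] assoc[of \<zeta> \<zeta> A]
      assoc[of w w B] assoc[of w \<zeta> A] assoc[of \<zeta> w B] zw ww by simp_all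
  thus "t \<noteq> \<zeta> \<otimes> A \<oplus> w \<otimes> B" "t \<noteq> w \<otimes> A \<oplus> \<zeta> \<otimes> B" "\<zeta> \<otimes> A \<oplus> w \<otimes> B \<noteq> w \<otimes> A \<oplus> \<zeta> \<otimes> B"
    using conj_pair_neq(2)[OF conj_pair_rotate(2)[OF conj_pair_AB]]
      conj_pair_neq(2)[OF conj_pair_rotate(1)[OF conj_pair_AB]] conj_pair_neq(2)[OF conj_pair_AB] by metis+
qed

lemma normal_t:
  assumes "t \<notin> K"
  shows "normal_extension R K (adjoin R K {t})"
proof (rule normal_adjoinI[OF K _ polys_closed(2) _ Res_t])
  let ?S = "{t, \<zeta> \<otimes> A \<oplus> w \<otimes> B, w \<otimes> A \<oplus> \<zeta> \<otimes> B}"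
  have tc: "t \<in> carrier R" by simp
  show "degree (Irr K t) = degree Res"
    using degree_Irr_eq_dimension[OF K tc dimension_adjoin_t[OF K order.refl assms]] by simp
  show "?S \<subseteq> adjoin R K {t}"
    using conj_pair_rotate_mem[OF conj_pair_AB adjoin_props(1,2)[OF tc]] adjoin_props(3)[OF tc] by simp
  show "card ?S = degree Res" using conjugates_of_t_distinct by simp
  show "eval Res y = \<zero>" if "y \<in> ?S" for y
    using Res_root_iff[OF conj_pair_AB, of y] that by auto
qed simp_all

text \<open>The cubes of u and v are the roots of y^2 + py + q. So u, v and their multiples by
  \<zeta> and \<zeta>^2 are six distinct roots of X^6 + pX^3 + q, all inside K(u). This serves both
  normal fields of degree 6.\<close>

lemma normal_adjoin_cube_root:
  assumes "u \<in> carrier R" "v \<in> carrier R" "u \<noteq> \<zero>" "v \<noteq> \<zero>" "u \<otimes> u \<otimes> u \<noteq> v \<otimes> v \<otimes> v"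
    and "p \<in> K" "q \<in> K" "u \<otimes> u \<otimes> u \<oplus> v \<otimes> v \<otimes> v = \<ominus> p" "(u \<otimes> u \<otimes> u) \<otimes> (v \<otimes> v \<otimes> v) = q"
    and "\<zeta> \<in> adjoin R K {u}" "v \<in> adjoin R K {u}" "dimension 6 K (adjoin R K {u})"
  shows "normal_extension R K (adjoin R K {u})"
proof -
  let ?p = "[\<one>, \<zero>, \<zero>, p, \<zero>, \<zero>, q]"
  let ?E = "adjoin R K {u}"
  note E = adjoin_props[OF assms(1)]
  note Ec = subfield_closed[OF E(1)]
  have pq: "p \<in> carrier R" "q \<in> carrier R" using assms(6,7) K_closed(1) by auto
  define x y where "x = u \<otimes> u \<otimes> u" and "y = v \<otimes> v \<otimes> v"
  have xy: "x \<in> carrier R" "y \<in> carrier R" unfolding x_def y_def using assms(1,2) by simp_all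
  have p: "\<ominus> (x \<oplus> y) = p" and q: "x \<otimes> y = q"
    using assms(8,9) pq unfolding x_def y_def by simp_all
  have "x \<otimes> x \<oplus> p \<otimes> x \<oplus> q = \<zero>" "y \<otimes> y \<oplus> p \<otimes> y \<oplus> q = \<zero>"
    unfolding p[symmetric] q[symmetric] using xy by algebra+
  hence root: "eval ?p z = \<zero>" if "z \<in> carrier R" "z \<otimes> z \<otimes> z = x \<or> z \<otimes> z \<otimes> z = y" for z
    using eval_sextic[OF that(1) pq] that(2) by auto
  let ?S = "{u, \<zeta> \<otimes> u, w \<otimes> u, v, \<zeta> \<otimes> v, w \<otimes> v}"
  have card3: "card {z, \<zeta> \<otimes> z, w \<otimes> z} = 3" if "z \<in> carrier R" "z \<noteq> \<zero>" for z
  proof -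
    have "z \<noteq> \<zeta> \<otimes> z" "z \<noteq> w \<otimes> z" "\<zeta> \<otimes> z \<noteq> w \<otimes> z"
      using m_rcancel[OF that(2,1), of \<one> \<zeta>] m_rcancel[OF that(2,1), of \<one> w]
        m_rcancel[OF that(2,1), of \<zeta> w] z_neq that by auto
    thus ?thesis by simp
  qed
  have cubes: "z \<otimes> z \<otimes> z = k \<otimes> k \<otimes> k" if "k \<in> carrier R" "z \<in> {k, \<zeta> \<otimes> k, w \<otimes> k}" for z k
    using that cube_unity_mult[OF that(1)] by auto
  have "{u, \<zeta> \<otimes> u, w \<otimes> u} \<inter> {v, \<zeta> \<otimes> v, w \<otimes> v} = {}"
    using cubes[OF assms(1)] cubes[OF assms(2)] assms(5) by (metis disjoint_iff)
  hence "card ({u, \<zeta> \<otimes> u, w \<otimes> u} \<union> {v, \<zeta> \<otimes> v, w \<otimes> v}) = 3 + 3"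
    using card_Un_disjoint card3[OF assms(1,3)] card3[OF assms(2,4)] by (metis finite.emptyI finite.insertI)
  moreover have "{u, \<zeta> \<otimes> u, w \<otimes> u} \<union> {v, \<zeta> \<otimes> v, w \<otimes> v} = ?S" by blast
  ultimately have card: "card ?S = 6" by simp
  show ?thesis
  proof (rule normal_adjoinI[OF K assms(1) sextic_closed[OF K assms(6,7)], where S = ?S])
    show "eval ?p u = \<zero>" using root assms(1) x_def by blast
    show "degree (Irr K u) = degree ?p" using degree_Irr_eq_dimension[OF K assms(1,12)] by simp
    show "card ?S = degree ?p" using card by simp
    have "w \<in> ?E" using Ec(4)[OF assms(10,10)] .
    thus "?S \<subseteq> ?E" using Ec(4) E(3) assms(10,11) by auto
    show "eval ?p z = \<zero>" if "z \<in> ?S" for z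
    proof (rule root)
      show "z \<in> carrier R" using that assms(1,2) by auto
      show "z \<otimes> z \<otimes> z = x \<or> z \<otimes> z \<otimes> z = y"
        using that cubes[OF assms(1), of z] cubes[OF assms(2), of z] unfolding x_def y_def by blast
    qed
  qed simp
qed

text \<open>A single generator with known minimal polynomial is wanted. From A one recovers A^3/b =
  \<open>y1\<close>, hence \<zeta>, and also B = b/A, hence t.\<close>

lemma adjoin_zeta_t: "adjoin R K {\<zeta>, t} = adjoin R K {A}"
proof (rule adjoin_eqI)
  have Ac: "A \<in> carrier R" by simp
  note E = adjoin_props[OF Ac]
  show "subfield (adjoin R K {A}) R" "K \<subseteq> adjoin R K {A}" by (fact E(1,2))+
  have "b \<otimes> y1 \<in> adjoin R K {A}"
    using conj_pair_AB subfield_closed(4)[OF E(1)] E(3) unfolding conj_pair_def by metis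
  hence "y1 \<in> adjoin R K {A}"
    using subfield_cancel[OF E(1) _ nonzero(3)] bK E(2) by auto
  thus "{\<zeta>, t} \<subseteq> adjoin R K {A}"
    using zeta_if_y1[OF E(1,2)] t_if_A[OF E] by simp
next
  fix E assume "subfield E R" "K \<subseteq> E" "{\<zeta>, t} \<subseteq> E"
  thus "adjoin R K {A} \<subseteq> E" using adjoin_least[of E K "{A}"] A_if_t by simp
qed

text \<open>A and B = b/A are cube roots of b \<open>y1\<close> and b \<open>y2\<close>, which are
  the roots of y^2 + ab y + b^3.\<close>

lemma normal_zeta_t:
  assumes "dimension 6 K (adjoin R K {\<zeta>, t})"
  shows "normal_extension R K (adjoin R K {\<zeta>, t})"
  unfolding adjoin_zeta_t
proof (rule normal_adjoin_cube_root[where v = B and p = "a \<otimes> b" and q = "b \<otimes> b \<otimes> b"])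
  have AB: "A \<otimes> B = b" "A \<otimes> A \<otimes> A = b \<otimes> y1" "B \<otimes> B \<otimes> B = b \<otimes> y2"
    using conj_pair_AB unfolding conj_pair_def by auto
  show nz: "A \<noteq> \<zero>" "B \<noteq> \<zero>" using nonzero integral al be by (metis m_closed)+
  show "A \<otimes> A \<otimes> A \<noteq> B \<otimes> B \<otimes> B" unfolding AB using cubes_neq m_lcancel[OF nonzero(3)] by simp
  show "a \<otimes> b \<in> K" "b \<otimes> b \<otimes> b \<in> K" using aK bK K_closed(4) by blast+
  have "b \<otimes> y1 \<oplus> b \<otimes> y2 = b \<otimes> (y1 \<oplus> y2)" by (simp add: r_distr)
  also have "\<dots> = \<ominus> (a \<otimes> b)" unfolding y_sum by (simp add: r_minus m_comm)
  finally show "A \<otimes> A \<otimes> A \<oplus> B \<otimes> B \<otimes> B = \<ominus> (a \<otimes> b)" unfolding AB .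
  have "(b \<otimes> y1) \<otimes> (b \<otimes> y2) = b \<otimes> b \<otimes> (y1 \<otimes> y2)"
  proof -
    have "(b \<otimes> x) \<otimes> (b \<otimes> y) = b \<otimes> b \<otimes> (x \<otimes> y)" if "x \<in> carrier R" "y \<in> carrier R" for x y
      using that by (simp add: m_ac)
    thus ?thesis by simp
  qed
  thus "(A \<otimes> A \<otimes> A) \<otimes> (B \<otimes> B \<otimes> B) = b \<otimes> b \<otimes> b" unfolding AB y_prod .
  have tc: "t \<in> carrier R" by simp
  note E = adjoin_props2[OF z_closed tc]
  show "\<zeta> \<in> adjoin R K {A}" using E(3) unfolding adjoin_zeta_t .
  have Ac: "A \<in> carrier R" by simp
  note EA = adjoin_props[OF Ac]
  show "B \<in> adjoin R K {A}"
    using subfield_cancel[OF EA(1,3) nz(1), of B] AB(1) bK EA(2) by auto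
  show "dimension 6 K (adjoin R K {A})" using assms unfolding adjoin_zeta_t .
qed simp_all

text \<open>The generator is g = c(\<zeta> - \<zeta>^2). Its cube -3b(\<zeta> - \<zeta>^2) gives
  back \<zeta> - \<zeta>^2, hence \<zeta> and c, and its sixth power is -27b^2. So the sextic is X^6
  + 27b^2, with g and -g playing the parts of u and v; their cubes differ because 2 is
  nonzero.\<close>

lemma normal_zeta_c:
  assumes "dimension 6 K (adjoin R K {\<zeta>, c})"
  shows "normal_extension R K (adjoin R K {\<zeta>, c})"
proof -
  define s where "s = \<zeta> \<ominus> w"
  have sc: "s \<in> carrier R" unfolding s_def by simp
  have ss: "s \<otimes> s = \<ominus> (\<one> \<oplus> \<one> \<oplus> \<one>)" unfolding s_def by (rule z_minus_w_square)
  have ss0: "s \<otimes> s \<noteq> \<zero>" unfolding ss using three by (metis a_closed minus_minus minus_zero one_closed)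
  hence s0: "s \<noteq> \<zero>" using sc by auto
  define g where "g = c \<otimes> s"
  have gc: "g \<in> carrier R" unfolding g_def using sc by simp
  have g0: "g \<noteq> \<zero>" unfolding g_def using nonzero(4) s0 integral sc by (metis al be m_closed)
  have g3: "g \<otimes> g \<otimes> g = (b \<otimes> (s \<otimes> s)) \<otimes> s"
  proof -
    have "g \<otimes> g \<otimes> g = (c \<otimes> c \<otimes> c) \<otimes> (s \<otimes> s) \<otimes> s"
    proof -
      have "(x \<otimes> s) \<otimes> (x \<otimes> s) \<otimes> (x \<otimes> s) = (x \<otimes> x \<otimes> x) \<otimes> (s \<otimes> s) \<otimes> s" if "x \<in> carrier R" for x
        using that sc by (simp add: m_ac)
      thus ?thesis unfolding g_def by simp
    qed
    thus ?thesis unfolding c_cube .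
  qed
  note E = adjoin_props[OF gc]
  note Ec = subfield_closed[OF E(1)]
  have ssK: "s \<otimes> s \<in> K" unfolding ss using K_closed(3,5,6) by blast
  have bss: "b \<otimes> (s \<otimes> s) \<in> K" "b \<otimes> (s \<otimes> s) \<noteq> \<zero>"
    using K_closed(4)[OF bK ssK] integral[of b "s \<otimes> s"] nonzero(3) ss0 sc by auto
  have "(b \<otimes> (s \<otimes> s)) \<otimes> s \<in> adjoin R K {g}" using g3 Ec(4) E(3) by metis
  hence sE: "s \<in> adjoin R K {g}" using subfield_cancel[OF E(1) _ bss(2) sc] bss(1) E(2) by blast
  have zE: "\<zeta> \<in> adjoin R K {g}"
  proof (rule sum_diff_imp_mem[OF E(1) _ _ _ _ two])
    show "\<zeta> \<oplus> w \<in> adjoin R K {g}" unfolding z_plus_w using Ec(3,6) by blast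
    show "\<zeta> \<ominus> w \<in> adjoin R K {g}" using sE unfolding s_def .
  qed simp_all
  have "s \<otimes> c \<in> adjoin R K {g}" using E(3) sc unfolding g_def by (simp add: m_comm)
  hence cE: "c \<in> adjoin R K {g}" using subfield_cancel[OF E(1) sE s0] by simp
  have eq: "adjoin R K {\<zeta>, c} = adjoin R K {g}"
  proof (rule adjoin_eqI[OF E(1,2)])
    show "{\<zeta>, c} \<subseteq> adjoin R K {g}" using zE cE by simp
    fix E' assume E': "subfield E' R" "K \<subseteq> E'" "{\<zeta>, c} \<subseteq> E'"
    note E'c = subfield_closed[OF E'(1)]
    have "g \<in> E'" unfolding g_def s_def 
      using E'c(4)[of c "\<zeta> \<ominus> w"] E'c(7)[of \<zeta> w] E'c(4)[of \<zeta> \<zeta>] E'(3) by blast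
    thus "adjoin R K {g} \<subseteq> E'" using adjoin_least[OF E'(1,2), of "{g}"] by simp
  qed
  show ?thesis unfolding eq
  proof (rule normal_adjoin_cube_root[where v = "\<ominus> g" and p = \<zero> and q = "\<ominus> ((g \<otimes> g \<otimes> g) \<otimes> (g \<otimes> g \<otimes> g))"])
    define h where "h = g \<otimes> g \<otimes> g"
    have hc: "h \<in> carrier R" unfolding h_def using gc by simp
    have h0: "h \<noteq> \<zero>" unfolding h_def using g0 integral gc by (metis m_closed)
    have neg: "(\<ominus> g) \<otimes> (\<ominus> g) \<otimes> (\<ominus> g) = \<ominus> h" unfolding h_def using gc by (simp add: l_minus r_minus)
    show "\<ominus> g \<noteq> \<zero>" using g0 gc by (metis minus_minus minus_zero)
    have "(\<one> \<oplus> \<one>) \<otimes> h = h \<oplus> h" using hc by (simp add: l_distr)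
    hence "h \<oplus> h \<noteq> \<zero>" using integral[of "\<one> \<oplus> \<one>" h] two h0 hc by auto
    hence "h \<noteq> \<ominus> h" using hc by (metis r_neg)
    thus "g \<otimes> g \<otimes> g \<noteq> (\<ominus> g) \<otimes> (\<ominus> g) \<otimes> (\<ominus> g)" unfolding neg h_def .
    show "g \<otimes> g \<otimes> g \<oplus> (\<ominus> g) \<otimes> (\<ominus> g) \<otimes> (\<ominus> g) = \<ominus> \<zero>"
      unfolding neg using hc unfolding h_def by (simp add: r_neg)
    show "(g \<otimes> g \<otimes> g) \<otimes> ((\<ominus> g) \<otimes> (\<ominus> g) \<otimes> (\<ominus> g)) = \<ominus> ((g \<otimes> g \<otimes> g) \<otimes> (g \<otimes> g \<otimes> g))"
      unfolding neg using hc unfolding h_def by (simp add: r_minus)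
    have "x \<otimes> s \<otimes> (x \<otimes> s) = x \<otimes> x \<otimes> (s \<otimes> s)" if "x \<in> carrier R" for x
      using that sc by (simp add: m_ac)
    hence "(g \<otimes> g \<otimes> g) \<otimes> (g \<otimes> g \<otimes> g) = (b \<otimes> (s \<otimes> s)) \<otimes> (b \<otimes> (s \<otimes> s)) \<otimes> (s \<otimes> s)"
      unfolding g3 using sc by simp
    thus "\<ominus> ((g \<otimes> g \<otimes> g) \<otimes> (g \<otimes> g \<otimes> g)) \<in> K" using K_closed(4,6) bss(1) ssK by simp
    show "\<ominus> g \<in> adjoin R K {g}" using Ec(6) E(3) by blast
  qed (use gc g0 zE K_closed(2) assms eq in auto)
qed

text \<open>X^3 - b is irreducible over K, so a normal field containing u would contain \<zeta> u
  and thus the quotient \<zeta>.\<close>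

lemma not_normal_if_cube_root:
  assumes "\<forall>u \<in> K. u \<otimes> u \<otimes> u \<noteq> b" "subfield E R" "\<zeta> \<notin> E" "u \<in> E" "u \<otimes> u \<otimes> u = b"
  shows "\<not> normal_extension R K E"
proof
  assume nE: "normal_extension R K E"
  have uc: "u \<in> carrier R" using subfield_closed(1)[OF assms(2,4)] .
  have "degree (Irr K u) = 3"
    using degree_Irr_eq_dimension[OF K uc dimension_adjoin_cube_root[OF K order.refl uc assms(5,1)]] by simp
  moreover have "eval cb u = \<zero>" "eval cb (\<zeta> \<otimes> u) = \<zero>"
    using cb_root_iff cube_unity_mult(1)[OF uc] uc assms(5) by simp_all
  ultimately have zu: "\<zeta> \<otimes> u \<in> E"
    using normal_extension_conjugate_mem[OF K nE assms(4) polys_closed(3)] uc by simp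
  have "u \<noteq> \<zero>" using assms(5) nonzero(3) by auto
  moreover have "u \<otimes> \<zeta> \<in> E" using zu uc by (simp add: m_comm)
  ultimately have "\<zeta> \<in> E" using subfield_cancel[OF assms(2,4)] by simp
  with assms(3) show False by blast
qed

lemma not_normal_al:
  assumes "\<not> F \<subseteq> adjoin R K {\<alpha>}"
  shows "\<not> normal_extension R K (adjoin R K {\<alpha>})"
proof
  assume n: "normal_extension R K (adjoin R K {\<alpha>})"
  have "\<beta> \<in> adjoin R K {\<alpha>}"
    using normal_extension_conjugate_mem[OF K n adjoin_al(3) polys_closed(1) _ f_al _ be f_be] degree_al by simp
  thus False using F_least adjoin_al assms by blast
qed

end

section \<open>Checking a list of intermediate fields degree by degree\<close>

lemma (in field) complete_field_listI:
  assumes "subfield K R" "subfield F R" "dimension m K F"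
    and "distinct (map (\<lambda>(d, E, \<nu>). E) xs)"
    and "\<And>d E \<nu>. (d, E, \<nu>) \<in> set xs \<Longrightarrow> subfield E R \<and> K \<subseteq> E \<and> E \<subseteq> F \<and> dimension d K E \<and>
           d \<noteq> 1 \<and> d \<noteq> m \<and> (\<nu> \<longleftrightarrow> normal_extension R K E)"
    and "\<And>d E. subfield E R \<Longrightarrow> K \<subseteq> E \<Longrightarrow> E \<subseteq> F \<Longrightarrow> dimension d K E \<Longrightarrow> d dvd m \<Longrightarrow> d \<noteq> 1 \<Longrightarrow> d \<noteq> m
           \<Longrightarrow> dimension (m div d) E F \<Longrightarrow> E \<in> set (map (\<lambda>(d, E, \<nu>). E) xs)"
  shows "complete_field_list R K F xs"
proof -
  \<comment> \<open>Strictness is read off from the degrees: a degree other than 1 and m excludes K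
    and F.\<close>
  have "E \<in> strict_intermediate_fields R K F" if "(d, E, \<nu>) \<in> set xs" for d E \<nu>
  proof -
    note E = assms(5)[OF that]
    have "E \<noteq> K"
    proof
      assume "E = K"
      hence "d = 1" using E dimension_is_inj[OF assms(1) _ dimension_one[OF assms(1)]] by blast
      with E show False by blast
    qed
    moreover have "E \<noteq> F"
    proof
      assume "E = F"
      hence "d = m" using E dimension_is_inj[OF assms(1) _ assms(3)] by blast
      with E show False by blast
    qed
    ultimately show ?thesis using E unfolding strict_intermediate_fields_def by blast
  qed
  hence "set (map (\<lambda>(d, E, \<nu>). E) xs) \<subseteq> strict_intermediate_fields R K F" by auto
  moreover have "E \<in> set (map (\<lambda>(d, E, \<nu>). E) xs)" if "E \<in> strict_intermediate_fields R K F" for E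
  proof -
    have E: "subfield E R" "K \<subseteq> E" "E \<subseteq> F" "E \<noteq> K" "E \<noteq> F"
      using that unfolding strict_intermediate_fields_def by auto
    obtain d e where d: "dimension d K E" "m = d * e"
      using dimension_tower[OF assms(1) E(1) assms(2) E(2,3) assms(3)] by blast
    have "d \<noteq> 1" using dimension_one_imp_eq[OF assms(1) E(2)] d(1) E(4) by blast
    moreover have "d \<noteq> m" using dimension_eq_imp_eq[OF assms(1) _ assms(3) E(3)] d(1) E(5) by blast
    ultimately show ?thesis
      using assms(6)[OF E(1-3) d(1)] dimension_tower_dvd(2)[OF assms(1) E(1) assms(2) E(2,3) assms(3) d(1)] d(2)
      by simp
  qed
  ultimately have "set (map (\<lambda>(d, E, \<nu>). E) xs) = strict_intermediate_fields R K F" by blast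
  thus ?thesis unfolding complete_field_list_def using assms(4,5) by blast
qed

text \<open>Fields of different degree differ, so distinctness need only be argued within each block
  of equal degree.\<close>

lemma (in field) distinct_append_dimension:
  assumes "subfield K R" "distinct xs" "distinct ys"
    and "\<And>E. E \<in> set xs \<Longrightarrow> dimension d K E" "\<And>E. E \<in> set ys \<Longrightarrow> \<exists>e. e \<noteq> d \<and> dimension e K E"
  shows "distinct (xs @ ys)"
proof -
  have "E \<notin> set ys" if "E \<in> set xs" for E
    using assms(4)[OF that] assms(5)[of E] dimension_is_inj[OF assms(1)] by blast
  thus ?thesis using assms(2,3) by auto
qed

lemma dvd_6_cases: "d dvd 6 \<Longrightarrow> d \<noteq> 1 \<Longrightarrow> d \<noteq> 6 \<Longrightarrow> d = 2 \<or> d = (3::nat)"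
proof -
  assume d: "d dvd 6" "d \<noteq> 1" "d \<noteq> 6"
  have "d \<le> 6" using dvd_imp_le[OF d(1)] by simp
  hence "d = 0 \<or> d = 1 \<or> d = 2 \<or> d = 3 \<or> d = 4 \<or> d = 5 \<or> d = 6" by linarith
  thus ?thesis using d by (elim disjE) simp_all
qed

lemma dvd_18_cases: "d dvd 18 \<Longrightarrow> d \<noteq> 1 \<Longrightarrow> d \<noteq> 18 \<Longrightarrow> d = 2 \<or> d = 3 \<or> d = 6 \<or> d = (9::nat)"
proof -
  assume d: "d dvd 18" "d \<noteq> 1" "d \<noteq> 18"
  then obtain k where k: "18 = d * k" by (auto elim: dvdE)
  have "2 \<le> k"
  proof (rule ccontr)
    assume "\<not> 2 \<le> k"
    hence "k = 0 \<or> k = 1" by linarith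
    thus False using k d(3) by auto
  qed
  hence "d * 2 \<le> d * k" by (rule mult_le_mono2)
  hence "d * 2 \<le> 18" unfolding k[symmetric] .
  hence "d = 0 \<or> d = 1 \<or> d = 2 \<or> d = 3 \<or> d = 4 \<or> d = 5 \<or> d = 6 \<or> d = 7 \<or> d = 8 \<or> d = 9" by presburger
  thus ?thesis using d by (elim disjE) simp_all
qed

context sextic
begin

subsection \<open>The three cases\<close>

lemma cube_roots_cases:
  assumes "u \<in> carrier R" "u \<otimes> u \<otimes> u = b"
  shows "u = c \<or> u = c \<otimes> \<zeta> \<or> u = c \<otimes> w"
  using cubes_eq_imp[OF assms(1), of c] assms(2) c_cube by (simp add: m_comm)

lemma cube_roots:
  "(c \<otimes> \<zeta>) \<otimes> (c \<otimes> \<zeta>) \<otimes> (c \<otimes> \<zeta>) = b" "(c \<otimes> w) \<otimes> (c \<otimes> w) \<otimes> (c \<otimes> w) = b"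
  "c \<noteq> c \<otimes> \<zeta>" "c \<noteq> c \<otimes> w" "c \<otimes> \<zeta> \<noteq> c \<otimes> w"
proof -
  have cc: "c \<in> carrier R" by simp
  have "c \<otimes> \<zeta> = \<zeta> \<otimes> c" "c \<otimes> w = w \<otimes> c" by (simp_all add: m_comm)
  thus "(c \<otimes> \<zeta>) \<otimes> (c \<otimes> \<zeta>) \<otimes> (c \<otimes> \<zeta>) = b" "(c \<otimes> w) \<otimes> (c \<otimes> w) \<otimes> (c \<otimes> w) = b"
    using cube_unity_mult[OF cc] c_cube by metis+
  show "c \<noteq> c \<otimes> \<zeta>" "c \<noteq> c \<otimes> w" "c \<otimes> \<zeta> \<noteq> c \<otimes> w"
    using m_lcancel[OF nonzero(4) cc, of \<one> \<zeta>] m_lcancel[OF nonzero(4) cc, of \<one> w]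
      m_lcancel[OF nonzero(4) cc, of \<zeta> w] z_neq by auto
qed

lemma c_mem_F: "c \<in> F"
  using subfield_closed(4)[OF F_props(1,3,4)] .

lemma t_mem_F: "t \<in> F"
  using subfield_closed(4,5)[OF F_props(1)] F_props(3,4) c_mem_F by blast

lemma cube_roots_mem_F: "c \<otimes> \<zeta> \<in> F" "c \<otimes> w \<in> F"
  using subfield_closed(4)[OF F_props(1)] c_mem_F F_props(5) by blast+

lemma adjoin_in_F: "x \<in> F \<Longrightarrow> adjoin R K {x} \<subseteq> F"
  using adjoin_least[OF F_props(1,2), of "{x}"] by simp

text \<open>A quadratic field containing \<zeta> is M. Without \<zeta>, the field E(\<zeta>) would
  have degree 4, which divides neither 6 nor 18, the degrees of F that occur.\<close>

lemma quadratic_field_eq_M: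
  assumes "subfield E R" "K \<subseteq> E" "E \<subseteq> F" "dimension 2 K E" "dimension m K F" "\<not> 4 dvd m"
  shows "E = M"
proof (cases "\<zeta> \<in> E")
  case True
  thus ?thesis using dimension_eq_imp_eq[OF K M_dim assms(4) M_least[OF assms(1,2)]] by simp
next
  case False
  note N = adjoin_subfield[OF subfieldE(3)[OF assms(1)], of "{\<zeta>}"]
  have NF: "adjoin R E {\<zeta>} \<subseteq> F" using adjoin_least[OF F_props(1) assms(3), of "{\<zeta>}"] F_props(5) by simp
  have "dimension (2 * 2) K (adjoin R E {\<zeta>})"
    using telescopic_base[OF K assms(1,4) dimension_adjoin_zeta[OF assms(1) False]] .
  hence "4 dvd m"
    using dimension_tower_dvd(1)[OF K N(1) F_props(1) _ NF assms(5)] N(2) assms(2) by auto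
  with assms(6) show ?thesis by blast
qed

text \<open>The degree 3 is odd, so \<zeta> is absent. This excludes normality and makes u the only
  cube root of b in the field, which separates the three fields from each other.\<close>

lemma cube_root_field:
  assumes nb: "\<forall>u \<in> K. u \<otimes> u \<otimes> u \<noteq> b" and u: "u \<in> carrier R" "u \<otimes> u \<otimes> u = b"
  shows "dimension 3 K (adjoin R K {u})" "\<zeta> \<notin> adjoin R K {u}" "\<not> normal_extension R K (adjoin R K {u})"
    and "\<And>v. v \<in> adjoin R K {u} \<Longrightarrow> v \<otimes> v \<otimes> v = b \<Longrightarrow> v = u"
proof -
  note U = adjoin_props[OF u(1)]
  show dim: "dimension 3 K (adjoin R K {u})" using dimension_adjoin_cube_root[OF K order.refl u nb] .
  show z: "\<zeta> \<notin> adjoin R K {u}" using two_dvd_if_zeta[OF U(1,2) _ dim] by auto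
  show "\<not> normal_extension R K (adjoin R K {u})" using not_normal_if_cube_root[OF nb U(1) z U(3) u(2)] .
  show "v = u" if "v \<in> adjoin R K {u}" "v \<otimes> v \<otimes> v = b" for v
    using zeta_mem_if_two_cube_roots[OF U(1) that(1) U(3)] that(2) u(2) z by metis
qed

lemma cube_root_fields_distinct:
  assumes nb: "\<forall>u \<in> K. u \<otimes> u \<otimes> u \<noteq> b"
  shows "distinct [adjoin R K {c}, adjoin R K {c \<otimes> \<zeta>}, adjoin R K {c \<otimes> w}]"
proof -
  have "adjoin R K {u} \<noteq> adjoin R K {v}"
    if "u \<in> carrier R" "v \<in> carrier R" "u \<otimes> u \<otimes> u = b" "v \<otimes> v \<otimes> v = b" "u \<noteq> v" for u v
    using cube_root_field(4)[OF nb that(1,3)] adjoin_props(3)[OF that(2)] that(4,5) by blast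
  thus ?thesis using cube_roots c_cube by simp
qed

lemma cube_root_field_mem:
  assumes "\<forall>u \<in> K. u \<otimes> u \<otimes> u \<noteq> b" "subfield E R" "K \<subseteq> E" "dimension 3 K E"
    and "u \<in> E" "u \<otimes> u \<otimes> u = b"
  shows "E \<in> {adjoin R K {c}, adjoin R K {c \<otimes> \<zeta>}, adjoin R K {c \<otimes> w}}"
proof -
  have uc: "u \<in> carrier R" using subfield_closed(1)[OF assms(2,5)] .
  have "adjoin R K {u} \<subseteq> E" using adjoin_least[OF assms(2,3), of "{u}"] assms(5) by simp
  hence "adjoin R K {u} = E"
    using dimension_eq_imp_eq[OF K cube_root_field(1)[OF assms(1) uc assms(6)] assms(4)] by simp
  thus ?thesis using cube_roots_cases[OF uc assms(6)] by auto
qed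

lemma dimension_M_c:
  assumes "\<forall>u \<in> K. u \<otimes> u \<otimes> u \<noteq> b"
  shows "dimension 3 M (adjoin R M {c})" "dimension 6 K (adjoin R K {\<zeta>, c})"
proof -
  show 3: "dimension 3 M (adjoin R M {c})"
    using dimension_adjoin_cube_root[OF M_props(1,2) _ c_cube no_cube_root_in_M[OF assms]] by simp
  show "dimension 6 K (adjoin R K {\<zeta>, c})"
    using telescopic_base[OF K M_props(1) M_dim 3] adjoin_M[of "{c}"] by simp
qed

text \<open>With t in K the field K(\<zeta>) contains A, so F = K(\<zeta>, c) has degree 6. A cubic
  field has index 2 in F, and descent of X^3 - b puts a cube root of b into it.\<close>

theorem case_A:
  assumes nb: "\<forall>u \<in> K. u \<otimes> u \<otimes> u \<noteq> b" and t: "t \<in> K"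
  shows "complete_field_list R K F
    [(2, M, True), (3, adjoin R K {c}, False), (3, adjoin R K {c \<otimes> \<zeta>}, False), (3, adjoin R K {c \<otimes> w}, False)]"
proof -
  have cc: "c \<in> carrier R" "c \<otimes> \<zeta> \<in> carrier R" "c \<otimes> w \<in> carrier R" by simp_all
  note N = adjoin_props2[OF z_closed cc(1)]
  have "A \<in> adjoin R K {\<zeta>, c}" using A_if_t[OF N(1-3)] t N(2) by blast
  hence "F \<subseteq> adjoin R K {\<zeta>, c}" using F_subset_if_c N by blast
  moreover have "adjoin R K {\<zeta>, c} \<subseteq> F"
    using adjoin_least[OF F_props(1,2), of "{\<zeta>, c}"] F_props(5) c_mem_F by simp
  ultimately have dim: "dimension 6 K F" using dimension_M_c(2)[OF nb] by simp
  show ?thesis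
  proof (rule complete_field_listI[OF K F_props(1) dim])
    have "distinct ([M] @ [adjoin R K {c}, adjoin R K {c \<otimes> \<zeta>}, adjoin R K {c \<otimes> w}])"
    proof (rule distinct_append_dimension[OF K _ cube_root_fields_distinct[OF nb]])
      show "dimension 2 K E" if "E \<in> set [M]" for E using M_dim that by simp
      show "\<exists>e. e \<noteq> 2 \<and> dimension e K E" if "E \<in> set [adjoin R K {c}, adjoin R K {c \<otimes> \<zeta>}, adjoin R K {c \<otimes> w}]" for E
        using that cube_root_field(1)[OF nb cc(1) c_cube] cube_root_field(1)[OF nb cc(2) cube_roots(1)]
          cube_root_field(1)[OF nb cc(3) cube_roots(2)] by (intro exI[of _ 3]) auto
    qed simp
    thus "distinct (map (\<lambda>(d, E, \<nu>). E) [(2, M, True), (3, adjoin R K {c}, False),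
        (3, adjoin R K {c \<otimes> \<zeta>}, False), (3, adjoin R K {c \<otimes> w}, False)])" by simp
  next
    fix d :: nat and E \<nu>
    assume "(d, E, \<nu>) \<in> set [(2, M, True), (3, adjoin R K {c}, False),
        (3, adjoin R K {c \<otimes> \<zeta>}, False), (3, adjoin R K {c \<otimes> w}, False)]"
    then consider "d = 2" "E = M" "\<nu> = True" |
      u where "d = 3" "E = adjoin R K {u}" "\<nu> = False" "u \<in> F" "u \<otimes> u \<otimes> u = b"
      using c_mem_F cube_roots_mem_F c_cube cube_roots(1,2) by auto
    thus "subfield E R \<and> K \<subseteq> E \<and> E \<subseteq> F \<and> dimension d K E \<and> d \<noteq> 1 \<and> d \<noteq> 6 \<and> (\<nu> \<longleftrightarrow> normal_extension R K E)"
    proof cases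
      case 1
      thus ?thesis using M_props(1,2) F_props(6) M_dim normal_M by simp
    next
      case 2
      have uc: "u \<in> carrier R" using subfield_closed(1)[OF F_props(1) 2(4)] .
      show ?thesis
        using 2 adjoin_props(1,2)[OF uc] adjoin_in_F cube_root_field[OF nb uc 2(5)] by simp
    qed
  next
    fix d E assume E: "subfield E R" "K \<subseteq> E" "E \<subseteq> F" "dimension d K E" "dimension (6 div d) E F"
      and d: "d dvd 6" "d \<noteq> 1" "d \<noteq> 6"
    from dvd_6_cases[OF d] consider "d = 2" | "d = 3" by blast
    thus "E \<in> set (map (\<lambda>(d, E, \<nu>). E) [(2, M, True), (3, adjoin R K {c}, False),
        (3, adjoin R K {c \<otimes> \<zeta>}, False), (3, adjoin R K {c \<otimes> w}, False)])"
    proof cases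
      case 1
      thus ?thesis using quadratic_field_eq_M[OF E(1-3) _ dim] E(4) by simp
    next
      case 2
      then obtain u where "u \<in> E" "u \<otimes> u \<otimes> u = b"
        using quadratic_descent(1)[OF E(1) F_props(1) E(2,3)] E(5) c_mem_F by auto
      thus ?thesis using cube_root_field_mem[OF nb E(1,2)] E(4) 2 by simp
    qed
  qed
qed

text \<open>With c in K the field F is K(\<alpha>), of degree 6, and t = c(\<alpha> + \<beta>)
  generates the same field as \<alpha> + \<beta>. A cubic field has index 2 in F and contains t by
  descent of the resolvent.\<close>

theorem case_B:
  assumes c: "c \<in> K" and t: "t \<notin> K"
  shows "complete_field_list R K F [(2, M, True), (3, adjoin R K {\<alpha> \<oplus> \<beta>}, True)]"
proof -
  have tc: "t \<in> carrier R" by simp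
  note T = adjoin_props[OF tc]
  have t_eq: "t = c \<otimes> (\<alpha> \<oplus> \<beta>)" by (simp add: r_distr)
  have g: "\<alpha> \<oplus> \<beta> \<in> carrier R" by simp
  note G = adjoin_props[OF g]
  have eq: "adjoin R K {\<alpha> \<oplus> \<beta>} = adjoin R K {t}"
  proof
    have "\<alpha> \<oplus> \<beta> \<in> adjoin R K {t}"
      using subfield_cancel[OF T(1) _ nonzero(4) g] c T(2,3) unfolding t_eq by blast
    thus "adjoin R K {\<alpha> \<oplus> \<beta>} \<subseteq> adjoin R K {t}" using adjoin_least[OF T(1,2), of "{\<alpha> \<oplus> \<beta>}"] by simp
    have "t \<in> adjoin R K {\<alpha> \<oplus> \<beta>}"
      unfolding t_eq using subfield_closed(4)[OF G(1)] c G(2,3) by blast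
    thus "adjoin R K {t} \<subseteq> adjoin R K {\<alpha> \<oplus> \<beta>}" using adjoin_least[OF G(1,2), of "{t}"] by simp
  qed
  note T_dim = dimension_adjoin_t[OF K order.refl t]
  have "F \<subseteq> adjoin R K {\<alpha>}" using F_subset_if_c[OF adjoin_al(1,2)] adjoin_al(2,3) c by blast
  hence "F = adjoin R K {\<alpha>}" using adjoin_in_F F_props(3) by blast
  hence dim: "dimension 6 K F" using dimension_al by simp
  show ?thesis unfolding eq
  proof (rule complete_field_listI[OF K F_props(1) dim])
    have "M \<noteq> adjoin R K {t}" using dimension_is_inj[OF K M_dim, of 3] T_dim by auto
    thus "distinct (map (\<lambda>(d, E, \<nu>). E) [(2, M, True), (3, adjoin R K {t}, True)])" by simp
  next
    fix d :: nat and E \<nu> assume "(d, E, \<nu>) \<in> set [(2, M, True), (3, adjoin R K {t}, True)]"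
    then consider "d = 2" "E = M" "\<nu> = True" | "d = 3" "E = adjoin R K {t}" "\<nu> = True" by auto
    thus "subfield E R \<and> K \<subseteq> E \<and> E \<subseteq> F \<and> dimension d K E \<and> d \<noteq> 1 \<and> d \<noteq> 6 \<and> (\<nu> \<longleftrightarrow> normal_extension R K E)"
    proof cases
      case 1
      thus ?thesis using M_props(1,2) F_props(6) M_dim normal_M by simp
    next
      case 2
      thus ?thesis using T(1,2) adjoin_in_F[OF t_mem_F] T_dim normal_t[OF t] by simp
    qed
  next
    fix d E assume E: "subfield E R" "K \<subseteq> E" "E \<subseteq> F" "dimension d K E" "dimension (6 div d) E F"
      and d: "d dvd 6" "d \<noteq> 1" "d \<noteq> 6"
    from dvd_6_cases[OF d] consider "d = 2" | "d = 3" by blast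
    thus "E \<in> set (map (\<lambda>(d, E, \<nu>). E) [(2, M, True), (3, adjoin R K {t}, True)])"
    proof cases
      case 1
      thus ?thesis using quadratic_field_eq_M[OF E(1-3) _ dim] E(4) by simp
    next
      case 2
      hence "t \<in> E" using quadratic_descent(2)[OF E(1) F_props(1) E(2,3)] E(5) t_mem_F by simp
      hence "adjoin R K {t} \<subseteq> E" using adjoin_least[OF E(1,2), of "{t}"] by simp
      hence "adjoin R K {t} = E" using dimension_eq_imp_eq[OF K T_dim] E(4) 2 by simp
      thus ?thesis by simp
    qed
  qed
qed

text \<open>K(t) lies in M(A), where \<zeta> turns any cube root of b into all of them, in
  particular c.\<close>

lemma no_cube_root_in_adjoin_t:
  assumes nb: "\<forall>u \<in> K. u \<otimes> u \<otimes> u \<noteq> b" and t: "t \<notin> K"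
  shows "\<forall>v \<in> adjoin R K {t}. v \<otimes> v \<otimes> v \<noteq> b"
proof (intro ballI notI)
  fix v assume v: "v \<in> adjoin R K {t}" and vb: "v \<otimes> v \<otimes> v = b"
  have Ac: "{A} \<subseteq> carrier R" by simp
  note MA = adjoin_subfield[OF subfieldE(3)[OF M_props(1)] Ac]
  have K: "K \<subseteq> adjoin R M {A}" and z: "\<zeta> \<in> adjoin R M {A}" using MA(2) M_props(2,3) by auto
  have "t \<in> adjoin R M {A}" using t_if_A[OF MA(1) K] MA(3) by simp
  hence "adjoin R K {t} \<subseteq> adjoin R M {A}" using adjoin_least[OF MA(1) K, of "{t}"] by simp
  hence "c \<in> adjoin R M {A}" using cube_root_mem[OF MA(1) z, of v c] v vb c_cube by auto
  thus False using c_notin_if_t[OF nb t] by blast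
qed

text \<open>The field K(g) is K(t, u). Indeed t^3 = b g^3 lies in K(g), so the resolvent equation
  t^3 + ab = 3bt yields t, and u = t/g. Its degree is 3 times 3 because K(t) contains no cube root
  of b; being odd, it excludes \<zeta>.\<close>

lemma nonic_field:
  assumes nb: "\<forall>u \<in> K. u \<otimes> u \<otimes> u \<noteq> b" and t: "t \<notin> K"
    and g: "g \<in> carrier R" and u: "u \<in> carrier R" "u \<otimes> u \<otimes> u = b" and gu: "g \<otimes> u = t"
  shows "t \<in> adjoin R K {g}" "u \<in> adjoin R K {g}" "dimension 9 K (adjoin R K {g})"
    "\<zeta> \<notin> adjoin R K {g}" "\<not> normal_extension R K (adjoin R K {g})"
    and "\<And>E. subfield E R \<Longrightarrow> K \<subseteq> E \<Longrightarrow> t \<in> E \<Longrightarrow> u \<in> E \<Longrightarrow> adjoin R K {g} \<subseteq> E"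
proof -
  note G = adjoin_props[OF g]
  note Gc = subfield_closed[OF G(1)]
  have tc: "t \<in> carrier R" by simp
  have "t \<otimes> t \<otimes> t = (g \<otimes> g \<otimes> g) \<otimes> (u \<otimes> u \<otimes> u)"
    unfolding gu[symmetric] using g u(1) by (simp add: m_ac)
  moreover have bG: "b \<in> adjoin R K {g}" using bK G(2) by blast
  ultimately have t3: "t \<otimes> t \<otimes> t \<in> adjoin R K {g}" unfolding u(2) using Gc(4)[OF Gc(4)[OF Gc(4)]] G(3) by simp
  have "x \<otimes> x \<otimes> x \<oplus> a \<otimes> b = (b \<oplus> b \<oplus> b) \<otimes> x"
    if x: "x \<in> carrier R" "x \<otimes> x \<otimes> x \<oplus> (\<ominus> (b \<oplus> b \<oplus> b)) \<otimes> x \<oplus> a \<otimes> b = \<zero>" for x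
  proof -
    have "x \<otimes> x \<otimes> x \<oplus> a \<otimes> b = (x \<otimes> x \<otimes> x \<oplus> (\<ominus> (b \<oplus> b \<oplus> b)) \<otimes> x \<oplus> a \<otimes> b) \<oplus> (b \<oplus> b \<oplus> b) \<otimes> x"
      using x(1) abn_closed by algebra
    thus ?thesis unfolding x(2) using x(1) by simp
  qed
  hence "t \<otimes> t \<otimes> t \<oplus> a \<otimes> b = (b \<oplus> b \<oplus> b) \<otimes> t"
    using Res_t eval_cubic[OF tc, of "\<ominus> (b \<oplus> b \<oplus> b)" "a \<otimes> b"] tc by simp
  moreover have "a \<otimes> b \<in> adjoin R K {g}" using Gc(4) aK bK G(2) by blast
  ultimately have bt: "(b \<oplus> b \<oplus> b) \<otimes> t \<in> adjoin R K {g}" using Gc(5)[OF t3] by metis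
  have "(\<one> \<oplus> \<one> \<oplus> \<one>) \<otimes> b = b \<oplus> b \<oplus> b" by (simp add: l_distr)
  hence "b \<oplus> b \<oplus> b \<noteq> \<zero>" using integral[of "\<one> \<oplus> \<one> \<oplus> \<one>" b] three nonzero(3) by auto
  moreover have "b \<oplus> b \<oplus> b \<in> adjoin R K {g}" using Gc(5) bG by blast
  ultimately show tG: "t \<in> adjoin R K {g}" using subfield_cancel[OF G(1) _ _ tc bt] by blast
  have g0: "g \<noteq> \<zero>" using gu t K_closed(2) u(1) by auto
  show uG: "u \<in> adjoin R K {g}" using subfield_cancel[OF G(1,3) g0 u(1)] tG gu by simp
  have u0: "u \<noteq> \<zero>" using u(2) nonzero(3) by auto
  show least: "adjoin R K {g} \<subseteq> E" if E: "subfield E R" "K \<subseteq> E" "t \<in> E" "u \<in> E" for E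
  proof -
    have "u \<otimes> g \<in> E" using E(3) gu g u(1) by (simp add: m_comm)
    hence "g \<in> E" using subfield_cancel[OF E(1,4) u0 g] by blast
    thus ?thesis using adjoin_least[OF E(1,2), of "{g}"] by simp
  qed
  note T = adjoin_props[OF tc]
  have uc: "{u} \<subseteq> carrier R" using u(1) by simp
  note TU = adjoin_subfield[OF subfieldE(3)[OF T(1)] uc]
  have "adjoin R (adjoin R K {t}) {u} = adjoin R K {g}"
  proof (rule equalityI)
    have "adjoin R K {t} \<subseteq> adjoin R K {g}" using adjoin_least[OF G(1,2), of "{t}"] tG by simp
    thus "adjoin R (adjoin R K {t}) {u} \<subseteq> adjoin R K {g}" using adjoin_least[OF G(1), of _ "{u}"] uG by simp
    show "adjoin R K {g} \<subseteq> adjoin R (adjoin R K {t}) {u}"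
      using least[OF TU(1)] TU(2,3) T(2,3) by blast
  qed
  moreover have "dimension 3 (adjoin R K {t}) (adjoin R (adjoin R K {t}) {u})"
    using dimension_adjoin_cube_root[OF T(1,2) u no_cube_root_in_adjoin_t[OF nb t]] .
  ultimately have "dimension 3 (adjoin R K {t}) (adjoin R K {g})" by simp
  thus dim: "dimension 9 K (adjoin R K {g})"
    using telescopic_base[OF K T(1) dimension_adjoin_t[OF K order.refl t]] by force
  show z: "\<zeta> \<notin> adjoin R K {g}" using two_dvd_if_zeta[OF G(1,2) _ dim] by auto
  show "\<not> normal_extension R K (adjoin R K {g})" using not_normal_if_cube_root[OF nb G(1) z uG u(2)] .
qed

text \<open>Here F has degree 18. A field of degree 9 has index 2, so it contains t and a cube root
  u of b and is generated by t/u. A field of degree 6 contains \<zeta> and falls under the Kummer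
  classification. A cubic field E is reached through E(\<zeta>), which has degree 6.\<close>

theorem case_C:
  assumes nb: "\<forall>u \<in> K. u \<otimes> u \<otimes> u \<noteq> b" and t: "t \<notin> K"
  shows "complete_field_list R K F
    [(2, M, True),
     (3, adjoin R K {t}, True),
     (3, adjoin R K {c}, False), (3, adjoin R K {c \<otimes> \<zeta>}, False), (3, adjoin R K {c \<otimes> w}, False),
     (6, adjoin R K {\<zeta>, c}, True), (6, adjoin R K {\<zeta>, t}, True),
     (6, adjoin R K {\<alpha>}, False), (6, adjoin R K {\<beta>}, False),
     (9, adjoin R K {\<alpha> \<oplus> \<beta>}, False), (9, adjoin R K {(\<alpha> \<oplus> \<beta>) \<otimes> \<zeta>}, False),
     (9, adjoin R K {(\<alpha> \<oplus> \<beta>) \<otimes> w}, False)]" (is "complete_field_list R K F ?xs")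
proof -
  have cc: "c \<in> carrier R" "c \<otimes> \<zeta> \<in> carrier R" "c \<otimes> w \<in> carrier R" and tc: "t \<in> carrier R" by simp_all
  note T = adjoin_props[OF tc]
  note T_dim = dimension_adjoin_t[OF K order.refl t]
  note Nc = adjoin_props2[OF z_closed cc(1)]
  note Nt = adjoin_props2[OF z_closed tc]
  note Nc_dim = dimension_M_c[OF nb]
  have Mt_dim: "dimension 3 M (adjoin R M {t})" using dimension_adjoin_t[OF M_props(1,2) t_notin_M[OF t]] .
  have Nt_dim: "dimension 6 K (adjoin R K {\<zeta>, t})"
    using telescopic_base[OF K M_props(1) M_dim Mt_dim] adjoin_M[of "{t}"] by simp
  have al_dim: "dimension 6 K (adjoin R K {\<alpha>})" and be_dim: "dimension 6 K (adjoin R K {\<beta>})"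
    using dimension_al sextic.dimension_al[OF swap] by simp_all
  note be_props = adjoin_props[OF be]

  \<comment> \<open>The indices are matched so that \<open>u i\<close> is c times the inverse of the
    cube root of unity in \<open>g i\<close>; the product is t for every i.\<close>
  define u where "u = (\<lambda>i::nat. if i = 0 then c else if i = 1 then c \<otimes> w else c \<otimes> \<zeta>)"
  define g where "g = (\<lambda>i::nat. if i = 0 then \<alpha> \<oplus> \<beta> else if i = 1 then (\<alpha> \<oplus> \<beta>) \<otimes> \<zeta> else (\<alpha> \<oplus> \<beta>) \<otimes> w)"
  have u: "u i \<in> carrier R" "u i \<otimes> u i \<otimes> u i = b" for i
    unfolding u_def using cc c_cube cube_roots by simp_all
  have gc: "g i \<in> carrier R" for i unfolding g_def by simp
  have gu: "g i \<otimes> u i = t" for i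
  proof -
    have "s \<otimes> x \<otimes> (c \<otimes> y) = (x \<otimes> y) \<otimes> (c \<otimes> s)" if "s \<in> carrier R" "x \<in> carrier R" "y \<in> carrier R" for s x y
      using that by (simp add: m_ac)
    from this[of "\<alpha> \<oplus> \<beta>" \<zeta> w] this[of "\<alpha> \<oplus> \<beta>" w \<zeta>] have
      "(\<alpha> \<oplus> \<beta>) \<otimes> \<zeta> \<otimes> (c \<otimes> w) = c \<otimes> (\<alpha> \<oplus> \<beta>)" "(\<alpha> \<oplus> \<beta>) \<otimes> w \<otimes> (c \<otimes> \<zeta>) = c \<otimes> (\<alpha> \<oplus> \<beta>)"
      unfolding zw by simp_all
    moreover have "(\<alpha> \<oplus> \<beta>) \<otimes> c = c \<otimes> (\<alpha> \<oplus> \<beta>)" by (simp add: m_comm)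
    moreover have "c \<otimes> (\<alpha> \<oplus> \<beta>) = t" by (simp add: r_distr)
    ultimately show ?thesis unfolding g_def u_def by simp
  qed
  have u_inj: "u i = u j \<Longrightarrow> i < 3 \<Longrightarrow> j < 3 \<Longrightarrow> i = j" for i j
    unfolding u_def using cube_roots(3-5) by (auto split: if_splits)
  note G = nonic_field[OF nb t gc u gu]
  have gF: "g i \<in> F" for i
    unfolding g_def using subfield_closed(4,5)[OF F_props(1)] F_props(3-5) by auto

  have F_dim: "dimension 18 K F"
  proof -
    let ?P = "adjoin R K {\<zeta>, c}"
    \<comment> \<open>The tower K, M, M(c), F has steps 2, 3, 3. If t were in M(c), then M(t) = M(c)
      by degree, and c would lie in M(A), against independence.\<close>
    have tP: "t \<notin> ?P"
    proof
      assume tP: "t \<in> ?P"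
      have MP: "M \<subseteq> ?P" using M_least[OF Nc(1-3)] .
      have "adjoin R M {t} \<subseteq> ?P" using adjoin_least[OF Nc(1) MP, of "{t}"] tP by simp
      moreover have "dimension 3 M ?P" using Nc_dim(1) adjoin_M[of "{c}"] by simp
      ultimately have P: "adjoin R M {t} = ?P" using dimension_eq_imp_eq[OF M_props(1) Mt_dim] by blast
      have "{A} \<subseteq> carrier R" by simp
      note MA = adjoin_subfield[OF subfieldE(3)[OF M_props(1)] this]
      have "t \<in> adjoin R M {A}" using t_if_A[OF MA(1)] MA(2,3) M_props(2) by blast
      hence "adjoin R M {t} \<subseteq> adjoin R M {A}" using adjoin_least[OF MA(1,2), of "{t}"] by simp
      hence "c \<in> adjoin R M {A}" using Nc(4) unfolding P by blast
      thus False using c_notin_if_t[OF nb t] by blast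
    qed
    have "{t} \<subseteq> carrier R" by simp
    note Pt = adjoin_subfield[OF subfieldE(3)[OF Nc(1)] this]
    have KP: "K \<subseteq> adjoin R ?P {t}" using Nc(2) Pt(2) by blast
    have zP: "\<zeta> \<in> adjoin R ?P {t}" using Nc(3) Pt(2) by blast
    have cP: "c \<in> adjoin R ?P {t}" using Nc(4) Pt(2) by blast
    have "A \<in> adjoin R ?P {t}" using A_if_t[OF Pt(1) KP zP] Pt(3) by simp
    hence "F \<subseteq> adjoin R ?P {t}" using F_subset_if_c[OF Pt(1) KP cP] by blast
    moreover have "?P \<subseteq> F" using adjoin_least[OF F_props(1,2), of "{\<zeta>, c}"] F_props(5) c_mem_F by simp
    hence "adjoin R ?P {t} \<subseteq> F" using adjoin_least[OF F_props(1), of ?P "{t}"] t_mem_F by simp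
    ultimately have "dimension 3 ?P F" using dimension_adjoin_t[OF Nc(1,2) tP] by simp
    thus ?thesis using telescopic_base[OF K Nc(1) Nc_dim(2)] by force
  qed
  have not_F: "\<not> F \<subseteq> E" if "dimension 6 K E" "E \<subseteq> F" for E
    using dimension_is_inj[OF K F_dim, of 6] that by auto

  have sextic_cases: "E \<in> {adjoin R K {\<zeta>, c}, adjoin R K {\<zeta>, t}, adjoin R K {\<alpha>}, adjoin R K {\<beta>}}"
    if E: "subfield E R" "K \<subseteq> E" "E \<subseteq> F" "dimension 6 K E" "\<zeta> \<in> E" for E
  proof -
    have "dimension 3 E F" using dimension_tower_dvd(2)[OF K E(1) F_props(1) E(2,3) F_dim E(4)] by simp
    then consider "c \<in> E" | "\<alpha> \<in> E" | "\<beta> \<in> E" | "A \<in> E"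
      using kummer_classification[OF E(1,2,5,3)] by blast
    thus ?thesis
    proof cases
      case 1
      hence "adjoin R K {\<zeta>, c} \<subseteq> E" using adjoin_least[OF E(1,2), of "{\<zeta>, c}"] E(5) by simp
      thus ?thesis using dimension_eq_imp_eq[OF K Nc_dim(2) E(4)] by simp
    next
      case 2
      hence "adjoin R K {\<alpha>} \<subseteq> E" using adjoin_least[OF E(1,2), of "{\<alpha>}"] by simp
      thus ?thesis using dimension_eq_imp_eq[OF K al_dim E(4)] by simp
    next
      case 3
      hence "adjoin R K {\<beta>} \<subseteq> E" using adjoin_least[OF E(1,2), of "{\<beta>}"] by simp
      thus ?thesis using dimension_eq_imp_eq[OF K be_dim E(4)] by simp
    next
      case 4
      hence "adjoin R K {\<zeta>, t} \<subseteq> E"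
        using adjoin_least[OF E(1,2), of "{\<zeta>, t}"] E(5) t_if_A[OF E(1,2)] by simp
      thus ?thesis using dimension_eq_imp_eq[OF K Nt_dim E(4)] by simp
    qed
  qed

  have cubic_cases: "E = adjoin R K {t} \<or> E \<in> {adjoin R K {c}, adjoin R K {c \<otimes> \<zeta>}, adjoin R K {c \<otimes> w}}"
    if E: "subfield E R" "K \<subseteq> E" "E \<subseteq> F" "dimension 3 K E" for E
  proof -
    have z: "\<zeta> \<notin> E" using two_dvd_if_zeta[OF E(1,2) _ E(4)] by auto
    let ?N = "adjoin R E {\<zeta>}"
    have "{\<zeta>} \<subseteq> carrier R" by simp
    note N = adjoin_subfield[OF subfieldE(3)[OF E(1)] this]
    have KN: "K \<subseteq> ?N" using E(2) N(2) by blast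
    have NF: "?N \<subseteq> F" using adjoin_least[OF F_props(1) E(3), of "{\<zeta>}"] F_props(5) by simp
    note N2 = dimension_adjoin_zeta[OF E(1) z]
    have "dimension (3 * 2) K ?N" using telescopic_base[OF K E(1,4) N2] .
    hence N6: "dimension 6 K ?N" by simp
    have "dimension 3 ?N F" using dimension_tower_dvd(2)[OF K N(1) F_props(1) KN NF F_dim N6] by simp
    then consider "c \<in> ?N" | "\<alpha> \<in> ?N \<or> \<beta> \<in> ?N" | "A \<in> ?N"
      using kummer_classification[OF N(1) KN _ NF] N(3) by blast
    thus ?thesis
    proof cases
      case 1
      then obtain v where "v \<in> E" "v \<otimes> v \<otimes> v = b"
        using quadratic_descent(1)[OF E(1) N(1) E(2) N(2) N2] by blast
      thus ?thesis using cube_root_field_mem[OF nb E(1,2,4)] by blast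
    next
      case 2
      \<comment> \<open>The case without a cubic to descend: one of \<alpha>, \<beta> in E(\<zeta>)
        forces the other, so the field of degree 6 would be all of F. That a is nonzero comes from t
        not lying in K.\<close>
      have "\<alpha> \<in> ?N \<and> \<beta> \<in> ?N"
        using be_mem_if_quadratic[OF E(1) N(1) E(2) N(2) N2 z _ a_nonzero[OF t]]
          sextic.be_mem_if_quadratic[OF swap E(1) N(1) E(2) N(2) N2 z _ a_nonzero[OF t]] 2 by blast
      hence "F \<subseteq> ?N" using F_least[OF N(1) KN] by blast
      thus ?thesis using not_F[OF N6 NF] by blast
    next
      case 3
      hence "t \<in> ?N" using t_if_A[OF N(1) KN] by blast
      hence "t \<in> E" using quadratic_descent(2)[OF E(1) N(1) E(2) N(2) N2] by blast
      hence "adjoin R K {t} \<subseteq> E" using adjoin_least[OF E(1,2), of "{t}"] by simp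
      hence "adjoin R K {t} = E" using dimension_eq_imp_eq[OF K T_dim E(4)] by blast
      thus ?thesis by simp
    qed
  qed

  have nonic_cases: "E \<in> {adjoin R K {\<alpha> \<oplus> \<beta>}, adjoin R K {(\<alpha> \<oplus> \<beta>) \<otimes> \<zeta>}, adjoin R K {(\<alpha> \<oplus> \<beta>) \<otimes> w}}"
    if E: "subfield E R" "K \<subseteq> E" "E \<subseteq> F" "dimension 9 K E" for E
  proof -
    have EF: "dimension 2 E F" using dimension_tower_dvd(2)[OF K E(1) F_props(1) E(2,3) F_dim E(4)] by simp
    have tE: "t \<in> E" using quadratic_descent(2)[OF E(1) F_props(1) E(2,3) EF t_mem_F] .
    obtain v where v: "v \<in> E" "v \<otimes> v \<otimes> v = b"
      using quadratic_descent(1)[OF E(1) F_props(1) E(2,3) EF c_mem_F] by blast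
    have "v = u 0 \<or> v = u 2 \<or> v = u 1"
      using cube_roots_cases[OF subfield_closed(1)[OF E(1) v(1)] v(2)] unfolding u_def by simp
    then obtain i where i: "v = u i" by blast
    have "adjoin R K {g i} \<subseteq> E" using G(6)[OF E(1,2) tE] v(1) i by simp
    hence "E = adjoin R K {g i}" using dimension_eq_imp_eq[OF K G(3) E(4)] by blast
    moreover have "g i = \<alpha> \<oplus> \<beta> \<or> g i = (\<alpha> \<oplus> \<beta>) \<otimes> \<zeta> \<or> g i = (\<alpha> \<oplus> \<beta>) \<otimes> w"
      unfolding g_def by simp
    ultimately show ?thesis by (elim disjE) simp_all
  qed

  have sextic_fields:
    "adjoin R K {\<zeta>, c} \<subseteq> F" "adjoin R K {\<zeta>, t} \<subseteq> F" "adjoin R K {\<alpha>} \<subseteq> F" "adjoin R K {\<beta>} \<subseteq> F"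
    using adjoin_least[OF F_props(1,2), of "{\<zeta>, c}"] adjoin_least[OF F_props(1,2), of "{\<zeta>, t}"]
      F_props(3-5) c_mem_F t_mem_F adjoin_in_F by simp_all
  have no_two: "adjoin R K {\<zeta>, c} \<noteq> adjoin R K {\<zeta>, t}" "adjoin R K {\<zeta>, c} \<noteq> adjoin R K {\<alpha>}"
    "adjoin R K {\<zeta>, c} \<noteq> adjoin R K {\<beta>}" "adjoin R K {\<zeta>, t} \<noteq> adjoin R K {\<alpha>}"
    "adjoin R K {\<zeta>, t} \<noteq> adjoin R K {\<beta>}" "adjoin R K {\<alpha>} \<noteq> adjoin R K {\<beta>}"
  proof -
    \<comment> \<open>Any two of c, \<alpha>, \<beta>, A generate F, which does not fit into a field
      of degree 6.\<close>
    have ANt: "A \<in> adjoin R K {\<zeta>, t}" using A_if_t[OF Nt] .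
    show "adjoin R K {\<zeta>, c} \<noteq> adjoin R K {\<zeta>, t}"
      using F_subset_if_c[OF Nc(1,2,4)] ANt not_F[OF Nc_dim(2) sextic_fields(1)] by auto
    show "adjoin R K {\<zeta>, c} \<noteq> adjoin R K {\<alpha>}" "adjoin R K {\<zeta>, c} \<noteq> adjoin R K {\<beta>}"
      using F_subset_if_c[OF Nc(1,2,4)] adjoin_al(3) be_props(3) not_F[OF Nc_dim(2) sextic_fields(1)] by auto
    show "adjoin R K {\<zeta>, t} \<noteq> adjoin R K {\<alpha>}" "adjoin R K {\<zeta>, t} \<noteq> adjoin R K {\<beta>}"
      using F_subset_if_al_A[OF Nt(1,2) _ ANt] F_subset_if_be_A[OF Nt(1,2) _ ANt] adjoin_al(3) be_props(3)
        not_F[OF Nt_dim sextic_fields(2)] by auto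
    show "adjoin R K {\<alpha>} \<noteq> adjoin R K {\<beta>}"
      using F_least[OF adjoin_al] be_props(3) not_F[OF al_dim sextic_fields(3)] by auto
  qed

  let ?D2 = "[M]" and ?D6 = "[adjoin R K {\<zeta>, c}, adjoin R K {\<zeta>, t}, adjoin R K {\<alpha>}, adjoin R K {\<beta>}]"
    and ?D3 = "[adjoin R K {t}, adjoin R K {c}, adjoin R K {c \<otimes> \<zeta>}, adjoin R K {c \<otimes> w}]"
    and ?D9 = "[adjoin R K {g 0}, adjoin R K {g 1}, adjoin R K {g 2}]"
  have D3: "dimension 3 K E" if "E \<in> set ?D3" for E
    using that T_dim cube_root_field(1)[OF nb cc(1) c_cube] cube_root_field(1)[OF nb cc(2) cube_roots(1)]
      cube_root_field(1)[OF nb cc(3) cube_roots(2)] by auto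
  have D6: "dimension 6 K E" if "E \<in> set ?D6" for E
    using that Nc_dim(2) Nt_dim al_dim be_dim by auto
  have D9: "dimension 9 K E" if "E \<in> set ?D9" for E
    using that G(3) by auto
  have distinct3: "distinct ?D3"
  proof -
    have "adjoin R K {t} \<noteq> adjoin R K {v}" if v: "v \<in> carrier R" "v \<otimes> v \<otimes> v = b" for v
      using no_cube_root_in_adjoin_t[OF nb t] adjoin_props(3)[OF v(1)] v(2) by blast
    thus ?thesis using cube_root_fields_distinct[OF nb] cc c_cube cube_roots(1,2) by simp
  qed
  have distinct9: "distinct ?D9"
  proof -
    have "adjoin R K {g i} \<noteq> adjoin R K {g j}" if ij: "i < 3" "j < 3" "i \<noteq> j" for i j
    proof
      assume eq: "adjoin R K {g i} = adjoin R K {g j}"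
      \<comment> \<open>Equal fields would contain two different cube roots of b and hence \<zeta>,
        impossible in odd degree.\<close>
      have "u j \<in> adjoin R K {g i}" using G(2)[of j] unfolding eq .
      hence "\<zeta> \<in> adjoin R K {g i}"
        using zeta_mem_if_two_cube_roots[OF adjoin_props(1)[OF gc] G(2)] u(2) u_inj ij by metis
      thus False using G(4) by blast
    qed
    thus ?thesis by simp
  qed
  have "distinct (?D2 @ ?D3 @ ?D6 @ ?D9)"
  proof (rule distinct_append_dimension[OF K])
    show "distinct (?D3 @ ?D6 @ ?D9)"
    proof (rule distinct_append_dimension[OF K distinct3 _ D3])
      show "distinct (?D6 @ ?D9)"
      proof (rule distinct_append_dimension[OF K _ distinct9 D6])
        show "distinct ?D6" using no_two by simp
        show "\<exists>e. e \<noteq> 6 \<and> dimension e K E" if "E \<in> set ?D9" for E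
          using D9[OF that] by (intro exI[of _ 9]) simp
      qed
      show "\<exists>e. e \<noteq> 3 \<and> dimension e K E" if "E \<in> set (?D6 @ ?D9)" for E
      proof -
        have "E \<in> set ?D6 \<or> E \<in> set ?D9" using that by auto
        hence "dimension 6 K E \<or> dimension 9 K E" using D6 D9 by blast
        moreover have "(6::nat) \<noteq> 3" "(9::nat) \<noteq> 3" by simp_all
        ultimately show ?thesis by blast
      qed
    qed
    show "dimension 2 K E" if "E \<in> set ?D2" for E using that M_dim by simp
    show "\<exists>e. e \<noteq> 2 \<and> dimension e K E" if "E \<in> set (?D3 @ ?D6 @ ?D9)" for E
    proof -
      have "E \<in> set ?D3 \<or> E \<in> set ?D6 \<or> E \<in> set ?D9" using that by auto
      hence "dimension 3 K E \<or> dimension 6 K E \<or> dimension 9 K E" using D3 D6 D9 by blast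
      moreover have "(3::nat) \<noteq> 2" "(6::nat) \<noteq> 2" "(9::nat) \<noteq> 2" by simp_all
      ultimately show ?thesis by blast
    qed
  qed simp
  hence distinct: "distinct (map (\<lambda>(d, E, \<nu>). E) ?xs)" unfolding g_def by simp

  define entry where "entry = (\<lambda>(d, E, \<nu>). subfield E R \<and> K \<subseteq> E \<and> E \<subseteq> F \<and> dimension d K E \<and>
    d \<noteq> 1 \<and> d \<noteq> 18 \<and> (\<nu> \<longleftrightarrow> normal_extension R K E))"
  have "entry (2, M, True)"
    using M_props(1,2) F_props(6) M_dim normal_M unfolding entry_def by simp
  moreover have "entry (3, adjoin R K {t}, True)"
    using T(1,2) adjoin_in_F[OF t_mem_F] T_dim normal_t[OF t] unfolding entry_def by simp
  moreover have "entry (3, adjoin R K {v}, False)" if v: "v \<in> F" "v \<otimes> v \<otimes> v = b" for v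
  proof -
    have vc: "v \<in> carrier R" using subfield_closed(1)[OF F_props(1) v(1)] .
    show ?thesis
      using adjoin_props(1,2)[OF vc] adjoin_in_F[OF v(1)] cube_root_field(1,3)[OF nb vc v(2)]
      unfolding entry_def by simp
  qed
  hence "entry (3, adjoin R K {c}, False)" "entry (3, adjoin R K {c \<otimes> \<zeta>}, False)"
    "entry (3, adjoin R K {c \<otimes> w}, False)"
    using c_mem_F cube_roots_mem_F c_cube cube_roots(1,2) by blast+
  moreover have "entry (6, adjoin R K {\<zeta>, c}, True)"
    using Nc(1,2) sextic_fields Nc_dim(2) normal_zeta_c unfolding entry_def by simp
  moreover have "entry (6, adjoin R K {\<zeta>, t}, True)"
    using Nt(1,2) sextic_fields Nt_dim normal_zeta_t unfolding entry_def by simp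
  moreover have "entry (6, adjoin R K {\<alpha>}, False)"
    using adjoin_al(1,2) sextic_fields al_dim not_normal_al[OF not_F[OF al_dim sextic_fields(3)]]
    unfolding entry_def by simp
  moreover have "entry (6, adjoin R K {\<beta>}, False)"
  proof -
    \<comment> \<open>With the roles swapped, the splitting field appears with its generators in the
      other order.\<close>
    have "adjoin R K {\<beta>, \<alpha>} = F" by (simp add: insert_commute)
    hence "\<not> normal_extension R K (adjoin R K {\<beta>})"
      using sextic.not_normal_al[OF swap] not_F[OF be_dim sextic_fields(4)] by simp
    thus ?thesis using be_props(1,2) sextic_fields be_dim unfolding entry_def by simp
  qed
  moreover have g9: "entry (9, adjoin R K {g i}, False)" for i
    using adjoin_props(1,2)[OF gc] adjoin_in_F[OF gF] G(3,5) unfolding entry_def by simp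
  hence "entry (9, adjoin R K {\<alpha> \<oplus> \<beta>}, False)" "entry (9, adjoin R K {(\<alpha> \<oplus> \<beta>) \<otimes> \<zeta>}, False)"
    "entry (9, adjoin R K {(\<alpha> \<oplus> \<beta>) \<otimes> w}, False)"
    using g9[of 0] g9[of 1] g9[of 2] unfolding g_def by simp_all
  ultimately have entries: "\<forall>x \<in> set ?xs. entry x" by simp
  show ?thesis
  proof (rule complete_field_listI[OF K F_props(1) F_dim distinct])
    fix d :: nat and E \<nu> assume "(d, E, \<nu>) \<in> set ?xs"
    hence "entry (d, E, \<nu>)" using entries by blast
    thus "subfield E R \<and> K \<subseteq> E \<and> E \<subseteq> F \<and> dimension d K E \<and> d \<noteq> 1 \<and> d \<noteq> 18 \<and> (\<nu> \<longleftrightarrow> normal_extension R K E)"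
      unfolding entry_def by simp
  next
    fix d :: nat and E assume E: "subfield E R" "K \<subseteq> E" "E \<subseteq> F" "dimension d K E" "dimension (18 div d) E F"
      and d: "d dvd 18" "d \<noteq> 1" "d \<noteq> 18"
    define S3 S6 S9 where
      "S3 = {adjoin R K {c}, adjoin R K {c \<otimes> \<zeta>}, adjoin R K {c \<otimes> w}}" and
      "S6 = {adjoin R K {\<zeta>, c}, adjoin R K {\<zeta>, t}, adjoin R K {\<alpha>}, adjoin R K {\<beta>}}" and
      "S9 = {adjoin R K {\<alpha> \<oplus> \<beta>}, adjoin R K {(\<alpha> \<oplus> \<beta>) \<otimes> \<zeta>}, adjoin R K {(\<alpha> \<oplus> \<beta>) \<otimes> w}}"
    note cases = cubic_cases[folded S3_def, OF E(1-3)] sextic_cases[folded S6_def, OF E(1-3)]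
      nonic_cases[folded S9_def, OF E(1-3)]
    define T where "T = adjoin R K {t}"
    have "E = M \<or> E = T \<or> E \<in> S3 \<or> E \<in> S6 \<or> E \<in> S9"
    proof -
      from dvd_18_cases[OF d] consider "d = 2" | "d = 3" | "d = 6" | "d = 9" by blast
      thus ?thesis
      proof cases
        case 1
        hence "E = M" using quadratic_field_eq_M[OF E(1-3) _ F_dim] E(4) by simp
        thus ?thesis by (rule disjI1)
      next
        case 2
        hence "E = T \<or> E \<in> S3" using cases(1) E(4) unfolding T_def by simp
        thus ?thesis by (elim disjE) simp_all
      next
        case 3
        \<comment> \<open>The index of E in F is 3, so the quadratic extension E(\<zeta>) cannot lie
          between them.\<close>
        have "\<zeta> \<in> E"
        proof (rule ccontr)
          assume z: "\<zeta> \<notin> E"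
          have "{\<zeta>} \<subseteq> carrier R" by simp
          note N = adjoin_subfield[OF subfieldE(3)[OF E(1)] this]
          have NF: "adjoin R E {\<zeta>} \<subseteq> F"
            using adjoin_least[OF F_props(1) E(3), of "{\<zeta>}"] F_props(5) by simp
          have "dimension 3 E F" using E(5) 3 by simp
          hence "2 dvd (3::nat)"
            using dimension_tower_dvd(1)[OF E(1) N(1) F_props(1) N(2) NF _ dimension_adjoin_zeta[OF E(1) z]] by blast
          thus False by simp
        qed
        hence "E \<in> S6" using cases(2) E(4) 3 by simp
        thus ?thesis by simp
      next
        case 4
        hence "E \<in> S9" using cases(3) E(4) by simp
        thus ?thesis by simp
      qed
    qed
    hence "E \<in> {M} \<union> ({T} \<union> (S3 \<union> (S6 \<union> S9)))"
      by (simp only: Un_iff singleton_iff)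
    thus "E \<in> set (map (\<lambda>(d, E, \<nu>). E) ?xs)"
      by (simp only: T_def S3_def S6_def S9_def list.map prod.case list.set Un_insert_left Un_empty_left)
  qed
qed

end

section \<open>From the stated hypotheses to the working assumptions\<close>

lemma (in ring) one_multiples_if_ring_char:
  assumes "subring K R" "\<one> \<noteq> \<zero>"
  shows "ring_char (R\<lparr>carrier := K\<rparr>) \<noteq> 2 \<Longrightarrow> \<one> \<oplus> \<one> \<noteq> \<zero>"
    and "ring_char (R\<lparr>carrier := K\<rparr>) \<noteq> 3 \<Longrightarrow> \<one> \<oplus> \<one> \<oplus> \<one> \<noteq> \<zero>"
proof -
  interpret K: ring "R\<lparr>carrier := K\<rparr>" using subring_is_ring[OF assms(1)] .
  let ?n = "ring_char (R\<lparr>carrier := K\<rparr>)"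
  \<comment> \<open>Powers in the additive group are multiples of 1, so k times 1 vanishes exactly
    when the characteristic divides k; the value 0 for infinite order fits this too. As 1 is nonzero
    the characteristic is not 1, so dividing a prime means being equal to it.\<close>
  have pow: "\<one> [^]\<^bsub>add_monoid (R\<lparr>carrier := K\<rparr>)\<^esub> k = \<zero> \<longleftrightarrow> ?n dvd k" for k :: nat
    using group.pow_eq_id[OF K.a_group, of \<one> k] subringE(3)[OF assms(1)] unfolding ring_char_def by simp
  have "?n \<noteq> 1" using pow[of 1] assms(2) by (simp add: nat_pow_def)
  moreover have "?n dvd 2" if "\<one> \<oplus> \<one> = \<zero>"
    using pow[of 2] that by (simp add: nat_pow_def numeral_2_eq_2)
  moreover have "?n dvd 3" if "\<one> \<oplus> \<one> \<oplus> \<one> = \<zero>"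
    using pow[of 3] that by (simp add: nat_pow_def numeral_3_eq_3)
  moreover have "k = 1 \<or> k = 2" if "k dvd 2" for k :: nat
  proof -
    have "k = 0 \<or> k = 1 \<or> k = 2" using dvd_imp_le[OF that] by linarith
    thus ?thesis using that by auto
  qed
  moreover have "k = 1 \<or> k = 3" if "k dvd 3" for k :: nat
  proof -
    have "k = 0 \<or> k = 1 \<or> k = 2 \<or> k = 3" using dvd_imp_le[OF that] by linarith
    thus ?thesis using that by auto
  qed
  ultimately show "?n \<noteq> 2 \<Longrightarrow> \<one> \<oplus> \<one> \<noteq> \<zero>" "?n \<noteq> 3 \<Longrightarrow> \<one> \<oplus> \<one> \<oplus> \<one> \<noteq> \<zero>"
    by blast+
qed

text \<open>Cancel z - 1 in (z - 1)(z^2 + z + 1) = z^3 - 1 = 0.\<close>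

lemma (in field) primitive_cube_root_eq:
  assumes "primitive_root_of_unity R 3 z"
  shows "z \<in> carrier R" "z \<otimes> z \<oplus> z \<oplus> \<one> = \<zero>"
proof -
  show z: "z \<in> carrier R" using assms unfolding primitive_root_of_unity_def by blast
  have "z [^] (3::nat) = \<one>" using assms unfolding primitive_root_of_unity_def by blast
  hence z3: "z \<otimes> z \<otimes> z = \<one>" using cube_eq[OF z] by simp
  have "z [^] (1::nat) \<noteq> \<one>" using assms unfolding primitive_root_of_unity_def by (metis one_less_numeral_iff semiring_norm(77) zero_less_one)
  hence z1: "z \<noteq> \<one>" using z by simp
  have "(z \<ominus> \<one>) \<otimes> (z \<otimes> z \<oplus> z \<oplus> \<one>) = z \<otimes> z \<otimes> z \<ominus> \<one>"
    using z one_closed by algebra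
  hence "(z \<ominus> \<one>) \<otimes> (z \<otimes> z \<oplus> z \<oplus> \<one>) = \<zero>" unfolding z3 by simp
  hence "z \<ominus> \<one> = \<zero> \<or> z \<otimes> z \<oplus> z \<oplus> \<one> = \<zero>" by (rule integral) (use z in simp_all)
  thus "z \<otimes> z \<oplus> z \<oplus> \<one> = \<zero>" using z1 z by simp
qed

text \<open>Every root of f has the cube of \<alpha> or of \<beta>, so it is one of them times a
  cube root of unity, and F contains \<zeta>.\<close>

lemma (in sextic) splitting_field_eq_F:
  assumes "splitting_field R K f F'" "\<alpha> \<in> F'" "\<beta> \<in> F'"
  shows "F' = F"
proof
  have F': "subfield F' R" "K \<subseteq> F'" "F' = adjoin R K {x \<in> F'. is_root f x}"
    using assms(1) unfolding splitting_field_def by auto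
  show "F \<subseteq> F'" using F_least[OF F'(1,2) assms(2,3)] .
  have "{x \<in> F'. is_root f x} \<subseteq> F"
  proof
    fix x assume "x \<in> {x \<in> F'. is_root f x}"
    hence x: "x \<in> carrier R" "eval f x = \<zero>" unfolding is_root_def by auto
    show "x \<in> F"
      using f_root_cases[OF x] cube_root_mem[OF F_props(1,5,3) x(1)] cube_root_mem[OF F_props(1,5,4) x(1)]
      by auto
  qed
  thus "F' \<subseteq> F" using adjoin_least[OF F_props(1,2)] F'(3) by blast
qed

theorem mainTheorem6:
  fixes L :: "('a, 'm) ring_scheme" (structure)
    and K F :: "'a set" and \<zeta> a b n \<alpha> \<beta> :: 'a and f R :: "'a list"
  defines "f \<equiv> [\<one>, \<zero>, \<zero>, a, \<zero>, \<zero>, b]"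
    and "R \<equiv> [\<one>, \<zero>, \<ominus> ([(3::nat)] \<cdot> b), a \<otimes> b]"
  assumes "field L" and "subfield K L"
    and "ring_char (L\<lparr>carrier := K\<rparr>) \<noteq> 2" and "ring_char (L\<lparr>carrier := K\<rparr>) \<noteq> 3"
    and "primitive_root_of_unity L 3 \<zeta>" and "\<zeta> \<notin> K"
    and "a \<in> K" and "b \<in> K" and "pirreducible K f"
    and "splitting_field L K f F"
    and "n \<in> K" and "a [^] (2::nat) \<ominus> [(4::nat)] \<cdot> b = \<ominus> ([(3::nat)] \<cdot> (n [^] (2::nat)))"
    and "\<alpha> \<in> F" and "ring.is_root L f \<alpha>" and "\<beta> \<in> F" and "ring.is_root L f \<beta>"
    and "\<alpha> [^] (3::nat) \<noteq> \<beta> [^] (3::nat)"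
  shows
    "(\<not> (\<exists>c \<in> K. c [^] (3::nat) = b) \<and> \<not> pirreducible K R \<longrightarrow>
        complete_field_list L K F
          [(2, adjoin L K {\<zeta>}, True),
           (3, adjoin L K {\<alpha> \<otimes> \<beta>}, False),
           (3, adjoin L K {\<alpha> \<otimes> \<beta> \<otimes> \<zeta>}, False),
           (3, adjoin L K {\<alpha> \<otimes> \<beta> \<otimes> \<zeta> [^] (2::nat)}, False)])
     \<and>
     ((\<exists>c \<in> K. c [^] (3::nat) = b) \<and> pirreducible K R \<and> \<alpha> \<otimes> \<beta> \<in> K \<longrightarrow>
        complete_field_list L K F
          [(2, adjoin L K {\<zeta>}, True),
           (3, adjoin L K {\<alpha> \<oplus> \<beta>}, True)])
     \<and>
     (\<not> (\<exists>c \<in> K. c [^] (3::nat) = b) \<and> pirreducible K R \<longrightarrow>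
        complete_field_list L K F
          [(2, adjoin L K {\<zeta>}, True),
           (3, adjoin L K {\<alpha> \<otimes> \<beta> \<otimes> (\<alpha> \<oplus> \<beta>)}, True),
           (3, adjoin L K {\<alpha> \<otimes> \<beta>}, False),
           (3, adjoin L K {\<alpha> \<otimes> \<beta> \<otimes> \<zeta>}, False),
           (3, adjoin L K {\<alpha> \<otimes> \<beta> \<otimes> \<zeta> [^] (2::nat)}, False),
           (6, adjoin L K {\<zeta>, \<alpha> \<otimes> \<beta>}, True),
           (6, adjoin L K {\<zeta>, \<alpha> \<otimes> \<beta> \<otimes> (\<alpha> \<oplus> \<beta>)}, True),
           (6, adjoin L K {\<alpha>}, False),
           (6, adjoin L K {\<beta>}, False),
           (9, adjoin L K {\<alpha> \<oplus> \<beta>}, False),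
           (9, adjoin L K {(\<alpha> \<oplus> \<beta>) \<otimes> \<zeta>}, False),
           (9, adjoin L K {(\<alpha> \<oplus> \<beta>) \<otimes> \<zeta> [^] (2::nat)}, False)])"
proof -
  interpret field L by fact
  note sub = subfieldE(1)[OF \<open>subfield K L\<close>]
  have in_L: "x \<in> carrier L" if "x \<in> K" for x using that subfieldE(3)[OF \<open>subfield K L\<close>] by blast
  note abn = in_L[OF \<open>a \<in> K\<close>] in_L[OF \<open>b \<in> K\<close>] in_L[OF \<open>n \<in> K\<close>]
  have triple: "[(3::nat)] \<cdot> x = x \<oplus> x \<oplus> x" and quadruple: "[(4::nat)] \<cdot> x = x \<oplus> x \<oplus> x \<oplus> x"
    if "x \<in> carrier L" for x
    using that by (simp_all add: numeral_3_eq_3 numeral_eq_Suc)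
  have roots: "\<alpha> \<in> carrier L" "eval f \<alpha> = \<zero>" "\<beta> \<in> carrier L" "eval f \<beta> = \<zero>"
    using \<open>is_root f \<alpha>\<close> \<open>is_root f \<beta>\<close> unfolding is_root_def by auto
  note z = primitive_cube_root_eq[OF \<open>primitive_root_of_unity L 3 \<zeta>\<close>]
  interpret sextic L \<zeta> K a b n \<alpha> \<beta>
  proof (intro sextic.intro cube_root_of_unity.intro cube_root_of_unity_axioms.intro sextic_axioms.intro)
    show "\<zeta> \<in> carrier L" "\<zeta> \<otimes> \<zeta> \<oplus> \<zeta> \<oplus> \<one> = \<zero>" using z by auto
    show "\<one> \<oplus> \<one> \<oplus> \<one> \<noteq> \<zero>" "\<one> \<oplus> \<one> \<noteq> \<zero>"
      using one_multiples_if_ring_char[OF sub one_not_zero]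
        \<open>ring_char (L\<lparr>carrier := K\<rparr>) \<noteq> 2\<close> \<open>ring_char (L\<lparr>carrier := K\<rparr>) \<noteq> 3\<close> by auto
    show "pirreducible K [\<one>, \<zero>, \<zero>, a, \<zero>, \<zero>, b]" using \<open>pirreducible K f\<close> unfolding f_def .
    show "a \<otimes> a \<ominus> (b \<oplus> b \<oplus> b \<oplus> b) = \<ominus> (n \<otimes> n \<oplus> n \<otimes> n \<oplus> n \<otimes> n)"
      using \<open>a [^] (2::nat) \<ominus> [(4::nat)] \<cdot> b = \<ominus> ([(3::nat)] \<cdot> (n [^] (2::nat)))\<close>
      unfolding square_eq[OF abn(1)] square_eq[OF abn(3)] quadruple[OF abn(2)] triple[OF m_closed[OF abn(3,3)]] .
    show "eval [\<one>, \<zero>, \<zero>, a, \<zero>, \<zero>, b] \<alpha> = \<zero>" "eval [\<one>, \<zero>, \<zero>, a, \<zero>, \<zero>, b] \<beta> = \<zero>"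
      using roots(2,4) unfolding f_def .
    show "\<alpha> \<otimes> \<alpha> \<otimes> \<alpha> \<noteq> \<beta> \<otimes> \<beta> \<otimes> \<beta>"
      using \<open>\<alpha> [^] (3::nat) \<noteq> \<beta> [^] (3::nat)\<close> cube_eq[OF roots(1)] cube_eq[OF roots(3)] by simp
  qed (fact assms roots)+
  have F: "F = adjoin L K {\<alpha>, \<beta>}"
    using splitting_field_eq_F[of F] \<open>splitting_field L K f F\<close> \<open>\<alpha> \<in> F\<close> \<open>\<beta> \<in> F\<close> unfolding f_def by blast
  \<comment> \<open>A cubic is irreducible exactly when it has no root in K, and any root of the
    resolvent in K brings t into K.\<close>
  have R_irr: "pirreducible K R \<longleftrightarrow> t \<notin> K"
    unfolding R_def triple[OF abn(2)] using t_in_K_iff by blast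
  have cubes: "(\<exists>u \<in> K. u [^] (3::nat) = b) \<longleftrightarrow> \<not> (\<forall>u \<in> K. u \<otimes> u \<otimes> u \<noteq> b)"
    using cube_eq[OF in_L] by auto
  have t: "\<alpha> \<otimes> \<beta> \<otimes> (\<alpha> \<oplus> \<beta>) = t" using roots(1,3) by (simp add: r_distr)
  show ?thesis
    unfolding F R_irr cubes t square_eq[OF z(1)] using case_A case_B case_C by blast
qed

end
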